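(* Let $F$ be an infinite field of characteristic $p>0$, and let $q\in\Lambda(n)$ with $(q,p)=1$ and $\lambda=\lambda(q)\in\Lambda^+_p(n)$. Then there are isomorphisms of right $FS_n$-modules \[\Xi^qe_{\lambda,F}FS_n\cong\mathrm{Lie}_F(q)\cong e_{\lambda,F}FS_n.\] In particular, $\Xi^qe_{\lambda,F}FS_n$ is a projective direct summand of $\Xi^qFS_n$ of dimension $|\mathcal{C}_{\lambda,p}|=|\mathcal{C}_\lambda|=n!/\lambda?$.
   Context: Compositions $q=(q_1,\dots,q_k)$ of $n$; $q^+_j=q_1+\dots+q_j$; $m_i(q)$ number of parts equal to $i$; $(q,p)=1$: no part divisible by $p$; $\lambda(q)$ rearrangement into a partition; $\Lambda^+_p(n)$ partitions with all $m_i<p$; $\lambda?=\prod i^{m_i}m_i!$; $[\lambda]!=\prod m_i(\lambda)!$; $q\approx r$ rearrangement; $r\preccurlyeq q$: a rearrangement of $r$ is a concatenation of compositions of $q_1,\dots,q_k$; $r\prec q$: $r\preccurlyeq q$, $r\not\approx q$. Permutations compose left to right. $\Xi^q$ = sum of $\sigma\in S_n$ with descents in $\{q^+_1,\dots,q^+_k\}$, $\mathcal{D}_n(F)$ their span. $\omega_j=(1-c_j)\cdots(1-c_2)$, $c_i=(i,\dots,1)$; $\omega^q=\omega_{q_1}^{+q^+_0}\cdots\omega_{q_k}^{+q^+_{k-1}}$ ($\sigma^{+r}$ shifts support by $r$); $\omega_q=\omega^q\Xi^q$; $\mathrm{Lie}_F(q)=\omega_qFS_n$. $\mathcal{C}_\lambda$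 is the conjugacy class of cycle type $\lambda$; $\mathcal{C}_{\lambda,p}$ the set of permutations whose cycle type is $p$-equivalent to $\lambda$ ($p'$-parts conjugate). $\{e_{\lambda,F}\}_{\lambda\in\Lambda^+_p(n)}$ is a complete set of orthogonal primitive idempotents of $\mathcal{D}_n(F)$ with sum $1$, such that the Solomon epimorphism ($\Xi^q\mapsto$ permutation character on cosets of $S_q$) sends $e_{\lambda,F}$ to the characteristic function of $\mathcal{C}_{\lambda,p}$, and $e_{\lambda,F}=\frac1{[\lambda]!}\Xi^\lambda+\epsilon_\lambda$ with $\epsilon_\lambda$ a combination of $\Xi^\xi$, $\xi\prec\lambda$. *)

theory Defs
  imports Complex_Main "HOL-Combinatorics.Permutations" "HOL-Library.Multiset" "HOL-Library.Function_Algebras"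
    "HOL-Computational_Algebra.Primes"
begin

(* Permutations of {1..n}; products are taken LEFT TO RIGHT:  sigma tau = tau o sigma  *)
type_synonym 'a grp = "(nat \<Rightarrow> nat) \<Rightarrow> 'a"        (* elements of the group algebra F S_n *)
type_synonym 'a fmod = "nat \<Rightarrow> (nat \<Rightarrow> nat) \<Rightarrow> 'a"  (* elements of free modules (F S_n)^k *)

definition perms :: "nat \<Rightarrow> (nat \<Rightarrow> nat) set" where
  "perms n = {\<sigma>. \<sigma> permutes {1..n}}"

definition galg :: "nat \<Rightarrow> ('a::zero) grp set" where
  "galg n = {x. \<forall>\<sigma>. \<sigma> \<notin> perms n \<longrightarrow> x \<sigma> = 0}"

(* product in F S_n, permutations composed left to right *)
definition gmul :: "nat \<Rightarrow> ('a::comm_ring_1) grp \<Rightarrow> 'a grp \<Rightarrow> 'a grp" where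
  "gmul n x y = (\<lambda>\<pi>. \<Sum>\<sigma>\<in>perms n. \<Sum>\<tau>\<in>perms n. if \<tau> \<circ> \<sigma> = \<pi> then x \<sigma> * y \<tau> else 0)"

definition gbas :: "(nat \<Rightarrow> nat) \<Rightarrow> ('a::comm_ring_1) grp" where
  "gbas \<sigma> = (\<lambda>\<pi>. if \<pi> = \<sigma> then 1 else 0)"

definition gone :: "('a::comm_ring_1) grp" where
  "gone = gbas id"

definition gsc :: "'a::comm_ring_1 \<Rightarrow> 'a grp \<Rightarrow> 'a grp" where
  "gsc c x = (\<lambda>\<pi>. c * x \<pi>)"

definition gprod :: "nat \<Rightarrow> ('a::comm_ring_1) grp list \<Rightarrow> 'a grp" where
  "gprod n xs = foldr (gmul n) xs gone"

definition is_comp :: "nat \<Rightarrow> nat list \<Rightarrow> bool" where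
  "is_comp n q \<longleftrightarrow> (\<forall>x\<in>set q. 0 < x) \<and> sum_list q = n"

definition comps :: "nat \<Rightarrow> nat list set" where
  "comps n = {q. is_comp n q}"

definition psum :: "nat list \<Rightarrow> nat \<Rightarrow> nat" where
  "psum q j = sum_list (take j q)"

definition descents :: "nat \<Rightarrow> (nat \<Rightarrow> nat) \<Rightarrow> nat set" where
  "descents n \<sigma> = {i. 1 \<le> i \<and> i < n \<and> \<sigma> (Suc i) < \<sigma> i}"

definition Xi :: "nat \<Rightarrow> nat list \<Rightarrow> ('a::comm_ring_1) grp" where
  "Xi n q = (\<lambda>\<pi>. if \<pi> \<in> perms n \<and> descents n \<pi> \<subseteq> {psum q j | j. 1 \<le> j \<and> j \<le> length q}
                then 1 else 0)"

definition desc_alg :: "nat \<Rightarrow> ('a::comm_ring_1) grp set" where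
  "desc_alg n = {(\<Sum>r\<in>comps n. gsc (c r) (Xi n r)) | c. True}"

(* c_i^{+r} = (r+i, r+i-1, ..., r+1) *)
definition cyc :: "nat \<Rightarrow> nat \<Rightarrow> nat \<Rightarrow> nat" where
  "cyc r i = (\<lambda>k. if k = r + 1 then r + i else if r + 1 < k \<and> k \<le> r + i then k - 1 else k)"

definition omega_shift :: "nat \<Rightarrow> nat \<Rightarrow> nat \<Rightarrow> ('a::comm_ring_1) grp" where
  "omega_shift n r j = gprod n (map (\<lambda>i. gone - gbas (cyc r i)) (rev [2..<Suc j]))"

definition omega_up :: "nat \<Rightarrow> nat list \<Rightarrow> ('a::comm_ring_1) grp" where
  "omega_up n q = gprod n (map (\<lambda>j. omega_shift n (psum q j) (q ! j)) [0..<length q])"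

definition omega_low :: "nat \<Rightarrow> nat list \<Rightarrow> ('a::comm_ring_1) grp" where
  "omega_low n q = gmul n (omega_up n q) (Xi n q)"

definition blk :: "nat list \<Rightarrow> nat \<Rightarrow> nat" where
  "blk q k = card {j. 1 \<le> j \<and> j \<le> length q \<and> psum q j < k}"

definition young :: "nat \<Rightarrow> nat list \<Rightarrow> (nat \<Rightarrow> nat) set" where
  "young n q = {\<sigma>\<in>perms n. \<forall>k\<in>{1..n}. blk q (\<sigma> k) = blk q k}"

(* right coset S_q sigma = { tau sigma } = { sigma o tau } *)
definition rcoset :: "nat \<Rightarrow> nat list \<Rightarrow> (nat \<Rightarrow> nat) \<Rightarrow> (nat \<Rightarrow> nat) set" where
  "rcoset n q \<sigma> = {\<sigma> \<circ> \<tau> | \<tau>. \<tau> \<in> young n q}"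

definition perm_char :: "nat \<Rightarrow> nat list \<Rightarrow> (nat \<Rightarrow> nat) \<Rightarrow> nat" where
  "perm_char n q \<pi> = card {C. \<exists>\<sigma>\<in>perms n. C = rcoset n q \<sigma> \<and> (\<lambda>x. \<pi> \<circ> x) ` C = C}"

definition orbit_of :: "(nat \<Rightarrow> nat) \<Rightarrow> nat \<Rightarrow> nat set" where
  "orbit_of \<sigma> i = {(\<sigma> ^^ k) i | k. True}"

definition cycle_type :: "nat \<Rightarrow> (nat \<Rightarrow> nat) \<Rightarrow> nat multiset" where
  "cycle_type n \<sigma> = image_mset card (mset_set {orbit_of \<sigma> i | i. i \<in> {1..n}})"

(* cycle type of the p'-part: a cycle of length p^a r (p not dividing r) gives p^a cycles of length r *)
definition pprime_type :: "nat \<Rightarrow> nat multiset \<Rightarrow> nat multiset" where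
  "pprime_type p \<mu> = sum_mset (image_mset
     (\<lambda>m. replicate_mset (p ^ multiplicity p m) (m div p ^ multiplicity p m)) \<mu>)"

definition conj_class :: "nat \<Rightarrow> nat multiset \<Rightarrow> (nat \<Rightarrow> nat) set" where
  "conj_class n lam = {\<sigma>\<in>perms n. cycle_type n \<sigma> = lam}"

definition pconj_class :: "nat \<Rightarrow> nat \<Rightarrow> nat multiset \<Rightarrow> (nat \<Rightarrow> nat) set" where
  "pconj_class p n lam = {\<sigma>\<in>perms n. pprime_type p (cycle_type n \<sigma>) = pprime_type p lam}"

definition pres_parts :: "nat \<Rightarrow> nat \<Rightarrow> nat multiset set" where
  "pres_parts p n = {lam. 0 \<notin># lam \<and> sum_mset lam = n \<and> (\<forall>i. count lam i < p)}"

definition lam_q :: "nat multiset \<Rightarrow> nat" where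
  "lam_q lam = (\<Prod>i\<in>set_mset lam. i ^ count lam i * fact (count lam i))"

definition brfact :: "nat multiset \<Rightarrow> nat" where
  "brfact lam = (\<Prod>i\<in>set_mset lam. fact (count lam i))"

definition part_comp :: "nat multiset \<Rightarrow> nat list" where
  "part_comp lam = rev (sorted_list_of_multiset lam)"

definition refines :: "nat list \<Rightarrow> nat list \<Rightarrow> bool" where
  "refines r q \<longleftrightarrow> (\<exists>rs. length rs = length q \<and> (\<forall>j<length q. is_comp (q ! j) (rs ! j))
                        \<and> mset (concat rs) = mset r)"

definition srefines :: "nat list \<Rightarrow> nat list \<Rightarrow> bool" where
  "srefines r q \<longleftrightarrow> refines r q \<and> mset r \<noteq> mset q"

definition is_idem :: "nat \<Rightarrow> ('a::comm_ring_1) grp \<Rightarrow> bool" where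
  "is_idem n e \<longleftrightarrow> gmul n e e = e"

definition primitive_idem_in :: "nat \<Rightarrow> 'a grp set \<Rightarrow> ('a::comm_ring_1) grp \<Rightarrow> bool" where
  "primitive_idem_in n D e \<longleftrightarrow> e \<in> D \<and> is_idem n e \<and> e \<noteq> 0 \<and>
     \<not> (\<exists>f\<in>D. \<exists>g\<in>D. is_idem n f \<and> is_idem n g \<and> f \<noteq> 0 \<and> g \<noteq> 0 \<and>
          gmul n f g = 0 \<and> gmul n g f = 0 \<and> e = f + g)"

definition is_e_family :: "nat \<Rightarrow> nat \<Rightarrow> (nat multiset \<Rightarrow> ('a::field) grp) \<Rightarrow> bool" where
  "is_e_family p n e \<longleftrightarrow>
     (\<forall>lam\<in>pres_parts p n. primitive_idem_in n (desc_alg n) (e lam)) \<and>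
     (\<forall>lam\<in>pres_parts p n. \<forall>\<mu>\<in>pres_parts p n. lam \<noteq> \<mu> \<longrightarrow> gmul n (e lam) (e \<mu>) = 0) \<and>
     (\<Sum>lam\<in>pres_parts p n. e lam) = gone \<and>
     (\<forall>lam\<in>pres_parts p n. \<exists>c. e lam = (\<Sum>r\<in>comps n. gsc (c r) (Xi n r)) \<and>
        (\<forall>\<pi>\<in>perms n. (\<Sum>r\<in>comps n. c r * of_nat (perm_char n r \<pi>))
                        = (if \<pi> \<in> pconj_class p n lam then 1 else 0))) \<and>
     (\<forall>lam\<in>pres_parts p n. \<exists>c. e lam = gsc (1 / of_nat (brfact lam)) (Xi n (part_comp lam))
        + (\<Sum>\<xi>\<in>{\<xi>\<in>comps n. srefines \<xi> (part_comp lam)}. gsc (c \<xi>) (Xi n \<xi>)))"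

(* right F S_n-modules: submodules of free modules (F S_n)^k *)
definition ract :: "nat \<Rightarrow> ('a::comm_ring_1) fmod \<Rightarrow> 'a grp \<Rightarrow> 'a fmod" where
  "ract n v a = (\<lambda>i. gmul n (v i) a)"

definition freemod :: "nat \<Rightarrow> nat \<Rightarrow> ('a::comm_ring_1) fmod set" where
  "freemod n k = {v. \<forall>i \<sigma>. (k \<le> i \<or> \<sigma> \<notin> perms n) \<longrightarrow> v i \<sigma> = 0}"

definition submod :: "nat \<Rightarrow> nat \<Rightarrow> ('a::comm_ring_1) fmod set \<Rightarrow> bool" where
  "submod n k S \<longleftrightarrow> S \<subseteq> freemod n k \<and> 0 \<in> S \<and> (\<forall>v\<in>S. \<forall>w\<in>S. v + w \<in> S)
      \<and> (\<forall>v\<in>S. \<forall>a\<in>galg n. ract n v a \<in> S)"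

definition mod_iso :: "nat \<Rightarrow> ('a::comm_ring_1) fmod set \<Rightarrow> 'a fmod set \<Rightarrow> bool" where
  "mod_iso n S T \<longleftrightarrow> (\<exists>k l. submod n k S \<and> submod n l T) \<and>
     (\<exists>f. bij_betw f S T \<and> (\<forall>v\<in>S. \<forall>w\<in>S. f (v + w) = f v + f w)
          \<and> (\<forall>v\<in>S. \<forall>a\<in>galg n. f (ract n v a) = ract n (f v) a))"

definition dsummand :: "nat \<Rightarrow> ('a::comm_ring_1) fmod set \<Rightarrow> 'a fmod set \<Rightarrow> bool" where
  "dsummand n M N \<longleftrightarrow> (\<exists>k. submod n k M \<and> submod n k N \<and> M \<subseteq> N \<and>
     (\<exists>C. submod n k C \<and> C \<subseteq> N \<and> M \<inter> C = {0} \<and> (\<forall>v\<in>N. \<exists>m\<in>M. \<exists>c\<in>C. v = m + c)))"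

definition projective :: "nat \<Rightarrow> ('a::comm_ring_1) fmod set \<Rightarrow> bool" where
  "projective n M \<longleftrightarrow> (\<exists>k P. dsummand n P (freemod n k) \<and> mod_iso n M P)"

(* the right ideal x F S_n, viewed inside (F S_n)^1 *)
definition rideal :: "nat \<Rightarrow> ('a::comm_ring_1) grp \<Rightarrow> 'a fmod set" where
  "rideal n x = {(\<lambda>i. if i = 0 then gmul n x a else 0) | a. a \<in> galg n}"

definition fdim :: "('a::field) fmod set \<Rightarrow> nat" where
  "fdim S = vector_space.dim (\<lambda>c v. (\<lambda>i \<sigma>. c * v i \<sigma>)) S"

end

theory Submission
  imports Defs "HOL-Combinatorics.Orbits"
begin

text \<open>
  Identify a permutation with its word \<open>\<pi>(1) \<dots> \<pi>(n)\<close>. Left multiplication by \<open>\<Xi>\<^sup>r\<close> then sums a function over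
  all shuffles of the \<open>r\<close>-blocks of a word, and \<open>\<omega>\<^sub>q\<close> is the function that multiplies the Dynkin coefficients
  of the \<open>q\<close>-blocks. Dynkin coefficients vanish on proper shuffles, whence \<open>\<Xi>\<^sup>r \<omega>\<^sub>q = 0\<close> if \<open>r\<close> has more parts
  than \<open>q\<close>, \<open>\<Xi>\<^sup>r \<omega>\<^sub>q = [\<lambda>]! \<omega>\<^sub>r\<close> if \<open>r\<close> is a rearrangement of \<open>q\<close>, and \<open>\<omega>\<^sub>q \<omega>\<^sub>q = \<lambda>? \<omega>\<^sub>q\<close>.

  Hence \<open>e\<^sub>\<lambda> \<omega>\<^sub>\<lambda> = \<omega>\<^sub>\<lambda>\<close>, and \<open>\<nu> = \<omega>\<^sub>\<lambda> / \<lambda>?\<close> is an idempotent of the descent algebra. So \<open>\<nu> e\<^sub>\<lambda>\<close> is a non-zero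
  idempotent below the primitive idempotent \<open>e\<^sub>\<lambda>\<close>, and \<open>\<nu> e\<^sub>\<lambda> = e\<^sub>\<lambda>\<close>. Therefore \<open>e\<^sub>\<lambda> F S\<^sub>n = \<omega>\<^sub>\<lambda> F S\<^sub>n\<close>, and applying
  \<open>\<Xi>\<^sup>q\<close> gives \<open>\<Xi>\<^sup>q e\<^sub>\<lambda> F S\<^sub>n = \<omega>\<^sub>q F S\<^sub>n\<close>.

  For the dimension, \<open>\<omega>\<^sub>q\<close> has integer coefficients and \<open>p\<close> does not divide \<open>\<lambda>?\<close>, so its rank over \<open>F\<close> equals its
  rank over the rationals, which is the trace \<open>n!\<close> divided by \<open>\<lambda>?\<close>.
\<close>

section \<open>Shuffles and Dynkin coefficients\<close>

text \<open>The only denominators are [\<lambda>]! and \<lambda>?, and both are prime to p because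
  no part is divisible by p and every multiplicity is below p. The comparison of e_\<lambda> with
  \<omega>_\<lambda> has to take place inside the descent algebra, where the primitivity of
  e_\<lambda> is given. So \<omega>_q must be shown to lie there, which holds because a Dynkin
  coefficient only sees which neighbours in a word descend. Nonvanishing comes from the coefficient
  of \<omega>_q at the identity, which is 1; the same coefficient fills the diagonal of the matrix
  of left multiplication by \<omega>_q, and this is the origin of the trace n!. Over F a trace would
  fix the dimension only modulo p, hence the passage to the rationals. Vanishing on proper shuffles
  is Ree's criterion for Lie elements. It is used twice: against \<Xi>^r and, through shuffles with
  reversed words, for the Dynkin-Specht-Wever identity behind \<omega>_q \<omega>_q = \<lambda>?
  \<omega>_q.\<close>

definition shuf :: "'b list list \<Rightarrow> 'b list set" where
  "shuf ps = {t. distinct t \<and> set t = set (concat ps) \<and> (\<forall>p\<in>set ps. filter (\<lambda>a. a \<in> set p) t = p)}"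

lemma finite_shuf: "finite (shuf ps)"
  by (rule finite_subset[OF _ finite_subset_distinct[of "set (concat ps)"]]) (auto simp: shuf_def)

lemma shuf_length: "distinct (concat ps) \<Longrightarrow> t \<in> shuf ps \<Longrightarrow> length t = length (concat ps)"
  unfolding shuf_def by (metis (mono_tags, lifting) distinct_card mem_Collect_eq)

lemma distinct_concat_nth_disjoint:
  "distinct (concat ps) \<Longrightarrow> i < length ps \<Longrightarrow> j < length ps \<Longrightarrow> i \<noteq> j \<Longrightarrow> set (ps ! i) \<inter> set (ps ! j) = {}"
proof (induction ps arbitrary: i j)
  case (Cons p ps)
  show ?case
  proof (cases i)
    case 0
    then show ?thesis using Cons.prems by (cases j) (auto dest!: nth_mem)
  next
    case (Suc i')
    then show ?thesis using Cons by (cases j) (auto dest!: nth_mem)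
  qed
qed simp

text \<open>The letter a occurs in no other block and only once in its own, so deleting it at the
  front leaves every other restriction unchanged.\<close>

lemma Cons_mem_shuf_split:
  assumes "distinct (concat (ps1 @ (a # p) # ps2))"
  shows "a # t \<in> shuf (ps1 @ (a # p) # ps2) \<longleftrightarrow> t \<in> shuf (ps1 @ p # ps2)"
proof -
  have a: "a \<notin> set p" "\<And>u. u \<in> set ps1 \<Longrightarrow> a \<notin> set u" "\<And>u. u \<in> set ps2 \<Longrightarrow> a \<notin> set u"
    using assms by auto
  have f: "filter (\<lambda>b. b \<in> set (a # p)) t = filter (\<lambda>b. b \<in> set p) t" if "a \<notin> set t"
    using that by (intro filter_cong) auto
  have a': "a \<notin> set (concat (ps1 @ p # ps2))" using a by auto
  show ?thesis
  proof (cases "a \<in> set t")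
    case True
    then show ?thesis using a' unfolding shuf_def by auto
  next
    case False
    have "set (a # t) = set (concat (ps1 @ (a # p) # ps2)) \<longleftrightarrow> set t = set (concat (ps1 @ p # ps2))"
    proof -
      have "set (concat (ps1 @ (a # p) # ps2)) = insert a (set (concat (ps1 @ p # ps2)))" by auto
      then show ?thesis using False a' by (simp add: insert_ident del: set_concat concat_append)
    qed
    moreover have "(\<forall>u\<in>set (ps1 @ (a # p) # ps2). filter (\<lambda>b. b \<in> set u) (a # t) = u)
        \<longleftrightarrow> (\<forall>u\<in>set (ps1 @ p # ps2). filter (\<lambda>b. b \<in> set u) t = u)"
      using a f[OF False] by auto
    ultimately show ?thesis using False unfolding shuf_def by (simp del: set_concat concat_append)
  qed
qed

lemma Cons_mem_shuf:
  assumes "distinct (concat ps)" "i < length ps" "ps ! i = a # p"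
  shows "a # t \<in> shuf ps \<longleftrightarrow> t \<in> shuf (ps[i := p])"
proof -
  have 1: "ps = take i ps @ (a # p) # drop (Suc i) ps"
    using assms id_take_nth_drop by metis
  have 2: "ps[i := p] = take i ps @ p # drop (Suc i) ps"
    using assms(2) by (rule upd_conv_take_nth_drop)
  show ?thesis unfolding 2 using Cons_mem_shuf_split[of "take i ps" a p "drop (Suc i) ps" t] assms(1) 1
    by metis
qed

lemma shuf_nth: "t \<in> shuf ps \<Longrightarrow> i < length ps \<Longrightarrow> filter (\<lambda>a. a \<in> set (ps ! i)) t = ps ! i"
  unfolding shuf_def by auto

lemma shuf_empty: "concat ps = [] \<Longrightarrow> shuf ps = {[]}"
  unfolding shuf_def by (cases "ps = []") (auto simp flip: set_empty)

text \<open>A shuffle starts with the head of exactly one non-empty block, and disjointness of the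
  blocks tells these heads apart; what remains is a shuffle with that block shortened.\<close>

lemma sum_shuf_front:
  assumes d: "distinct (concat ps)" and ne: "concat ps \<noteq> []"
  shows "(\<Sum>t\<in>shuf ps. x t) =
    (\<Sum>i | i < length ps \<and> ps ! i \<noteq> []. \<Sum>t\<in>shuf (ps[i := tl (ps ! i)]). x (hd (ps ! i) # t))"
proof -
  let ?I = "{i. i < length ps \<and> ps ! i \<noteq> []}"
  have eq: "shuf ps = (\<Union>i\<in>?I. (#) (hd (ps ! i)) ` shuf (ps[i := tl (ps ! i)]))" (is "_ = ?R")
  proof (intro set_eqI iffI)
    fix t assume t: "t \<in> shuf ps"
    then have "t \<noteq> []" using ne unfolding shuf_def by auto
    then obtain a s where as: "t = a # s" by (cases t) auto
    then have "a \<in> set (concat ps)" using t unfolding shuf_def by auto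
    then obtain i where i: "i < length ps" "a \<in> set (ps ! i)" by (metis (no_types, lifting) UN_iff in_set_conv_nth set_concat)
    have "filter (\<lambda>b. b \<in> set (ps ! i)) t = ps ! i" by (rule shuf_nth[OF t i(1)])
    then have "a # filter (\<lambda>b. b \<in> set (ps ! i)) s = ps ! i" using i as by simp
    then obtain p where p: "ps ! i = a # p" by metis
    then have "s \<in> shuf (ps[i := p])" using Cons_mem_shuf[OF d i(1) p] t as by simp
    then show "t \<in> ?R" using p i as by (auto intro!: exI[of _ i])
  next
    fix t assume "t \<in> ?R"
    then obtain i s where "i < length ps" "ps ! i \<noteq> []" "t = hd (ps ! i) # s" "s \<in> shuf (ps[i := tl (ps ! i)])"
      by auto
    then show "t \<in> shuf ps" using Cons_mem_shuf[OF d, of i "hd (ps ! i)" "tl (ps ! i)"] by simp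
  qed
  have "(\<Sum>t\<in>shuf ps. x t) = (\<Sum>i\<in>?I. \<Sum>t\<in>(#) (hd (ps ! i)) ` shuf (ps[i := tl (ps ! i)]). x t)"
    unfolding eq
  proof (rule sum.UNION_disjoint)
    show "\<forall>i\<in>?I. \<forall>j\<in>?I. i \<noteq> j \<longrightarrow> (#) (hd (ps ! i)) ` shuf (ps[i := tl (ps ! i)]) \<inter>
        (#) (hd (ps ! j)) ` shuf (ps[j := tl (ps ! j)]) = {}"
    proof (intro ballI impI)
      fix i j assume ij: "i \<in> ?I" "j \<in> ?I" "i \<noteq> j"
      then have "hd (ps ! i) \<noteq> hd (ps ! j)"
        using distinct_concat_nth_disjoint[OF d, of i j] hd_in_set[of "ps ! i"] hd_in_set[of "ps ! j"]
        by (metis (mono_tags, lifting) disjoint_iff mem_Collect_eq)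
      then show "(#) (hd (ps ! i)) ` shuf (ps[i := tl (ps ! i)]) \<inter>
        (#) (hd (ps ! j)) ` shuf (ps[j := tl (ps ! j)]) = {}" by auto
    qed
  qed (auto simp: finite_shuf)
  also have "\<dots> = (\<Sum>i\<in>?I. \<Sum>t\<in>shuf (ps[i := tl (ps ! i)]). x (hd (ps ! i) # t))"
    by (rule sum.cong[OF refl], subst sum.reindex) auto
  finally show ?thesis .
qed

lemma rev_mem_shuf: "rev t \<in> shuf (map rev ps) \<longleftrightarrow> t \<in> shuf ps"
proof -
  have "filter P (rev t) = rev p \<longleftrightarrow> filter P t = p" for P and p :: "'a list"
    by (metis rev_filter rev_rev_ident)
  then show ?thesis unfolding shuf_def by auto
qed

lemma sum_shuf_rev: "(\<Sum>t\<in>shuf (map rev ps). x (rev t)) = (\<Sum>t\<in>shuf ps. x t)"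
proof -
  have "t \<in> rev ` shuf ps" if "t \<in> shuf (map rev ps)" for t
    using that rev_mem_shuf[of "rev t" ps] by (intro image_eqI[of _ _ "rev t"]) auto
  then have "shuf (map rev ps) = rev ` shuf ps" by (auto simp: rev_mem_shuf)
  then show ?thesis by (simp add: sum.reindex)
qed

lemma distinct_concat_map_rev: "distinct (concat (map rev ps)) \<longleftrightarrow> distinct (concat ps)"
  by (induction ps) auto

lemma tl_rev: "tl (rev xs) = rev (butlast xs)"
  by (metis butlast_rev rev_rev_ident)

text \<open>Reversal exchanges the two ends of a shuffle, so the recursion at the first letter
  yields one at the last.\<close>

lemma sum_shuf_back:
  assumes d: "distinct (concat ps)" and ne: "concat ps \<noteq> []"
  shows "(\<Sum>t\<in>shuf ps. x t) =
    (\<Sum>i | i < length ps \<and> ps ! i \<noteq> []. \<Sum>t\<in>shuf (ps[i := butlast (ps ! i)]). x (t @ [last (ps ! i)]))"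
proof -
  have "(\<Sum>t\<in>shuf ps. x t) = (\<Sum>t\<in>shuf (map rev ps). x (rev t))" by (simp add: sum_shuf_rev)
  also have "\<dots> = (\<Sum>i | i < length (map rev ps) \<and> map rev ps ! i \<noteq> [].
      \<Sum>t\<in>shuf ((map rev ps)[i := tl (map rev ps ! i)]). x (rev (hd (map rev ps ! i) # t)))"
    using ne d by (intro sum_shuf_front) (auto simp: distinct_concat_map_rev)
  also have "\<dots> = (\<Sum>i | i < length ps \<and> ps ! i \<noteq> [].
      \<Sum>t\<in>shuf (map rev (ps[i := butlast (ps ! i)])). x (rev t @ [last (ps ! i)]))"
    by (intro sum.cong) (auto simp: map_update hd_rev tl_rev)
  also have "\<dots> = (\<Sum>i | i < length ps \<and> ps ! i \<noteq> [].
      \<Sum>t\<in>shuf (ps[i := butlast (ps ! i)]). x (t @ [last (ps ! i)]))"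
    by (intro sum.cong refl sum_shuf_rev[where x="\<lambda>t. x (t @ [last (ps ! i)])" for i])
  finally show ?thesis .
qed

text \<open>
  The coefficient of a word in the left-normed bracket \<open>[\<dots>[[a\<^sub>1, a\<^sub>2], a\<^sub>3] \<dots>, a\<^sub>k]\<close> of its letters \<open>a\<^sub>1 < \<dots> < a\<^sub>k\<close>:
  the word must descend to \<open>a\<^sub>1\<close> and ascend afterwards, and every descent contributes a sign. The value at
  the empty word is junk.
\<close>

fun lie_coeff :: "nat list \<Rightarrow> 'a::comm_ring_1" where
  "lie_coeff [] = 0"
| "lie_coeff [a] = 1"
| "lie_coeff (a # b # w) =
    (if b < a then - lie_coeff (b # w) else if sorted (a # b # w) then 1 else 0)"

lemma lie_coeff_sorted: "w \<noteq> [] \<Longrightarrow> sorted w \<Longrightarrow> lie_coeff w = 1"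
  by (induction w rule: lie_coeff.induct) auto

text \<open>With m the largest letter the bracket is [P, m] = P m - m P, where P is the bracket of
  the other letters. A word of two or more distinct letters cannot have m at both ends, so at most
  one term is present.\<close>

lemma lie_coeff_max:
  assumes "distinct w" "length w \<ge> 2" "m \<in> set w" "\<forall>x\<in>set w. x \<le> m"
  shows "lie_coeff w = (if last w = m then lie_coeff (butlast w) else 0)
     - (if hd w = m then lie_coeff (tl w) else 0 :: 'a::comm_ring_1)"
  using assms
proof (induction w arbitrary: m rule: lie_coeff.induct)
  case (3 a b w)
  show ?case
  proof (cases "w = []")
    case True
    then show ?thesis using 3 by (auto split: if_splits)
  next
    case ne: False
    then obtain v l where w: "w = v @ [l]" by (metis rev_exhaust)
    show ?thesis
    proof (cases "b < a")
      case ba: True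
      show ?thesis
      proof (cases "a = m")
        case True
        then show ?thesis using 3 ba w by auto
      next
        case False
        have bm: "b \<noteq> m" using ba 3(5) by auto
        have "lie_coeff (b # w) = (if last (b # w) = m then lie_coeff (butlast (b # w)) else 0)
           - (if hd (b # w) = m then lie_coeff (tl (b # w)) else 0 :: 'a)"
          using 3 ba False ne by (intro "3.IH") (auto simp: Suc_le_eq)
        then show ?thesis using ba bm False w by auto
      qed
    next
      case False
      then have ab: "a < b" using 3(2) by auto
      then have "a \<noteq> m" using 3 by auto
      have "sorted (a # b # w) \<longleftrightarrow> l = m \<and> sorted (a # b # v)"
      proof -
        have "sorted (a # b # w) \<longleftrightarrow> sorted (a # b # v) \<and> (\<forall>x\<in>set (a # b # v). x \<le> l)"
          using w sorted_append[of "a # b # v" "[l]"] by auto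
        moreover have "(\<forall>x\<in>set (a # b # v). x \<le> l) \<longleftrightarrow> l = m"
          using 3(4,5) w by (auto intro: antisym)
        ultimately show ?thesis by auto
      qed
      then show ?thesis using False \<open>a \<noteq> m\<close> w by auto
    qed
  qed
qed auto

lemma distinct_concat_update:
  assumes "distinct (concat ps)" "i < length ps" "distinct p" "set p \<subseteq> set (ps ! i)"
  shows "distinct (concat (ps[i := p]))"
proof -
  have 1: "ps = take i ps @ ps ! i # drop (Suc i) ps"
    using assms id_take_nth_drop by metis
  have 2: "ps[i := p] = take i ps @ p # drop (Suc i) ps"
    using assms(2) by (rule upd_conv_take_nth_drop)
  have "distinct (concat (take i ps @ ps ! i # drop (Suc i) ps))" using assms(1) 1 by simp
  then show ?thesis unfolding 2 using assms(3,4) by auto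
qed

lemma length_concat_update:
  "i < length ps \<Longrightarrow> length (concat (ps[i := p])) + length (ps ! i) = length (concat ps) + length p"
  by (induction ps arbitrary: i) (auto split: nat.splits)

text \<open>
  The largest letter must stand at an end of the word. If it forms a block of its own, the two ends
  cancel; otherwise remove it and use induction.
\<close>

lemma sum_shuf_lie_coeff:
  assumes "distinct (concat ps)" "i < length ps" "j < length ps" "i \<noteq> j" "ps ! i \<noteq> []" "ps ! j \<noteq> []"
  shows "(sum lie_coeff (shuf ps)) = (0::'a::comm_ring_1)"
  using assms
proof (induction "length (concat ps)" arbitrary: ps rule: less_induct)
  case (less ps)
  let ?A = "set (concat ps)"
  have ij: "set (ps ! i) \<subseteq> ?A" "set (ps ! j) \<subseteq> ?A" using less.prems by (auto intro: nth_mem)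
  have ne: "concat ps \<noteq> []" using less.prems(2,5) by (auto dest: nth_mem)
  have c2: "card ?A \<ge> 2"
  proof -
    have "hd (ps ! i) \<noteq> hd (ps ! j)"
      using distinct_concat_nth_disjoint[OF less.prems(1-4)] less.prems(5,6)
       hd_in_set[of "ps ! i"] hd_in_set[of "ps ! j"] by (metis disjoint_iff)
    moreover have "{hd (ps ! i), hd (ps ! j)} \<subseteq> ?A"
      using less.prems ij hd_in_set[of "ps ! i"] hd_in_set[of "ps ! j"] by blast
    ultimately show ?thesis using card_mono[of ?A "{hd (ps ! i), hd (ps ! j)}"] by simp
  qed
  define m where "m = Max ?A"
  have mA: "m \<in> ?A" unfolding m_def using ne by (intro Max_in) auto
  have mmax: "\<forall>x\<in>?A. x \<le> m" unfolding m_def using Max_ge by blast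
  obtain k where k: "k < length ps" "m \<in> set (ps ! k)"
    using mA by (metis (no_types, lifting) UN_iff in_set_conv_nth set_concat)
  have knot: "m \<notin> set (ps ! l)" if "l < length ps" "l \<noteq> k" for l
    using distinct_concat_nth_disjoint[OF less.prems(1) k(1) that(1)] that k by auto
  have kd: "distinct (ps ! k)" using less.prems(1) k(1) by (simp add: distinct_concat_iff)
  let ?I = "{i. i < length ps \<and> ps ! i \<noteq> []}"
  let ?N = "\<lambda>ps. (sum lie_coeff (shuf ps) :: 'a)"
  \<comment> \<open>Only block \<open>k\<close> contains \<open>m\<close>, so a single summand of
    the recursion at the first letter survives.\<close>
  have hd_part: "(\<Sum>t\<in>shuf ps. if hd t = m then lie_coeff (tl t) else 0) =
     (if hd (ps ! k) = m then ?N (ps[k := tl (ps ! k)]) else 0)"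
  proof -
    have "(\<Sum>t\<in>shuf ps. if hd t = m then lie_coeff (tl t) else 0) =
      (\<Sum>i\<in>?I. \<Sum>t\<in>shuf (ps[i := tl (ps ! i)]). if hd (ps ! i) = m then lie_coeff t else 0 :: 'a)"
      using sum_shuf_front[OF less.prems(1) ne, of "\<lambda>t. if hd t = m then lie_coeff (tl t) else 0"] by (simp cong: if_cong)
    also have "\<dots> = (\<Sum>i\<in>{k}. \<Sum>t\<in>shuf (ps[i := tl (ps ! i)]). if hd (ps ! i) = m then lie_coeff t else 0 :: 'a)"
    proof (rule sum.mono_neutral_right)
      show "\<forall>i\<in>?I - {k}. (\<Sum>t\<in>shuf (ps[i := tl (ps ! i)]). if hd (ps ! i) = m then lie_coeff t else 0) = (0 :: 'a)"
      proof
        fix i assume i: "i \<in> ?I - {k}"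
        then have "hd (ps ! i) \<noteq> m" using knot[of i] hd_in_set[of "ps ! i"] by auto
        then show "(\<Sum>t\<in>shuf (ps[i := tl (ps ! i)]). if hd (ps ! i) = m then lie_coeff t else 0) = (0 :: 'a)"
          by simp
      qed
    qed (use k in auto)
    also have "\<dots> = (if hd (ps ! k) = m then ?N (ps[k := tl (ps ! k)]) else 0)" by auto
    finally show ?thesis .
  qed
  have last_part: "(\<Sum>t\<in>shuf ps. if last t = m then lie_coeff (butlast t) else 0) =
     (if last (ps ! k) = m then ?N (ps[k := butlast (ps ! k)]) else 0)"
  proof -
    have "(\<Sum>t\<in>shuf ps. if last t = m then lie_coeff (butlast t) else 0) =
      (\<Sum>i\<in>?I. \<Sum>t\<in>shuf (ps[i := butlast (ps ! i)]). if last (ps ! i) = m then lie_coeff t else 0 :: 'a)"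
      using sum_shuf_back[OF less.prems(1) ne, of "\<lambda>t. if last t = m then lie_coeff (butlast t) else 0"] by (simp cong: if_cong)
    also have "\<dots> = (\<Sum>i\<in>{k}. \<Sum>t\<in>shuf (ps[i := butlast (ps ! i)]). if last (ps ! i) = m then lie_coeff t else 0 :: 'a)"
    proof (rule sum.mono_neutral_right)
      show "\<forall>i\<in>?I - {k}. (\<Sum>t\<in>shuf (ps[i := butlast (ps ! i)]). if last (ps ! i) = m then lie_coeff t else 0) = (0 :: 'a)"
      proof
        fix i assume i: "i \<in> ?I - {k}"
        then have "last (ps ! i) \<noteq> m" using knot[of i] last_in_set[of "ps ! i"] by auto
        then show "(\<Sum>t\<in>shuf (ps[i := butlast (ps ! i)]). if last (ps ! i) = m then lie_coeff t else 0) = (0 :: 'a)"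
          by simp
      qed
    qed (use k in auto)
    also have "\<dots> = (if last (ps ! k) = m then ?N (ps[k := butlast (ps ! k)]) else 0)" by auto
    finally show ?thesis .
  qed
  have "?N ps = (\<Sum>t\<in>shuf ps. (if last t = m then lie_coeff (butlast t) else 0)
     - (if hd t = m then lie_coeff (tl t) else 0))"
  proof (intro sum.cong refl lie_coeff_max)
    fix t assume "t \<in> shuf ps"
    then have t: "distinct t" "set t = ?A" unfolding shuf_def by auto
    then show "distinct t" "m \<in> set t" "\<forall>x\<in>set t. x \<le> m" using mA mmax by auto
    show "2 \<le> length t" using c2 distinct_card[OF t(1)] t(2) by simp
  qed
  also have "\<dots> = (if last (ps ! k) = m then ?N (ps[k := butlast (ps ! k)]) else 0)
      - (if hd (ps ! k) = m then ?N (ps[k := tl (ps ! k)]) else 0)"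
    by (simp only: sum_subtractf hd_part last_part)
  also have "\<dots> = 0"
  proof (cases "length (ps ! k) = 1")
    case True
    then obtain a where "ps ! k = [a]" by (auto simp: length_Suc_conv)
    then show ?thesis by auto
  next
    case False
    moreover have "ps ! k \<noteq> []" using k by auto
    ultimately have l2: "length (ps ! k) \<ge> 2" by (cases "ps ! k" rule: lie_coeff.cases) auto
    \<comment> \<open>Shortening block \<open>k\<close> to a non-empty word keeps blocks
      \<open>i\<close> and \<open>j\<close> non-empty, so the induction hypothesis still
      applies.\<close>
    have z: "?N (ps[k := p]) = 0" if "p \<noteq> []" "length p < length (ps ! k)" "distinct p" "set p \<subseteq> set (ps ! k)" for p
    proof (rule less.hyps)
      show "length (concat (ps[k := p])) < length (concat ps)"
        using length_concat_update[OF k(1), of p] that by linarith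
      show "distinct (concat (ps[k := p]))" by (rule distinct_concat_update) (use that k less.prems in auto)
    qed (use less.prems that k in \<open>auto simp: nth_list_update split: if_splits\<close>)
    have "?N (ps[k := butlast (ps ! k)]) = 0" 
      by (rule z) (use l2 kd in \<open>auto simp: distinct_butlast dest: in_set_butlastD simp flip: length_greater_0_conv\<close>)
    moreover have "?N (ps[k := tl (ps ! k)]) = 0" 
      by (rule z) (use l2 kd in \<open>auto simp: distinct_tl dest: list.set_sel(2)[rotated] simp flip: length_greater_0_conv\<close>)
    ultimately show ?thesis by simp
  qed
  finally show ?case .
qed

section \<open>Cutting shuffles into a prefix and a suffix\<close>

definition splits :: "nat \<Rightarrow> 'b list list \<Rightarrow> nat list set" where
  "splits k ps = {ms. length ms = length ps \<and> (\<forall>i<length ps. ms ! i \<le> length (ps ! i)) \<and> sum_list ms = k}"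

lemma concat_map2_take_drop:
  assumes "length ms = length ps" "distinct (concat ps)"
  shows "distinct (concat (map2 take ms ps)) \<and> distinct (concat (map2 drop ms ps))
    \<and> set (concat (map2 take ms ps)) \<inter> set (concat (map2 drop ms ps)) = {}
    \<and> set (concat (map2 take ms ps)) \<union> set (concat (map2 drop ms ps)) = set (concat ps)"
  using assms
proof (induction ms ps rule: list_induct2)
  case (Cons m ms p ps)
  have td: "distinct (take m p)" "distinct (drop m p)" "set (take m p) \<inter> set (drop m p) = {}"
      "set (take m p) \<union> set (drop m p) = set p"
    using Cons.prems by (auto simp: set_take_disj_set_drop_if_distinct simp flip: set_append)
  have pps: "set p \<inter> set (concat ps) = {}" using Cons.prems by auto
  have IH: "distinct (concat (map2 take ms ps))" "distinct (concat (map2 drop ms ps))"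
     "set (concat (map2 take ms ps)) \<inter> set (concat (map2 drop ms ps)) = {}"
     "set (concat (map2 take ms ps)) \<union> set (concat (map2 drop ms ps)) = set (concat ps)"
    using Cons by auto
  show ?case using td pps IH unfolding list.map zip_Cons_Cons concat.simps prod.case distinct_append set_append
    by blast
qed simp

lemma length_concat_map2_take:
  "length ms = length ps \<Longrightarrow> \<forall>i<length ps. ms ! i \<le> length (ps ! i) \<Longrightarrow>
   length (concat (map2 take ms ps)) = sum_list ms"
  by (induction ms ps rule: list_induct2) (auto simp: All_less_Suc2)

lemma length_concat_map2_drop:
  "length ms = length ps \<Longrightarrow> \<forall>i<length ps. ms ! i \<le> length (ps ! i) \<Longrightarrow>
   length (concat (map2 drop ms ps)) + sum_list ms = length (concat ps)"
  by (induction ms ps rule: list_induct2) (auto simp: All_less_Suc2)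

lemma mem_shuf_iff:
  "t \<in> shuf ps \<longleftrightarrow> distinct t \<and> set t = set (concat ps) \<and>
     (\<forall>i<length ps. filter (\<lambda>a. a \<in> set (ps ! i)) t = ps ! i)"
  unfolding shuf_def by (simp add: all_set_conv_all_nth del: set_concat)

lemma finite_splits: "finite (splits k ps)"
proof (rule finite_subset)
  show "splits k ps \<subseteq> {xs. set xs \<subseteq> {..k} \<and> length xs = length ps}"
    using member_le_sum_list by (fastforce simp: splits_def)
  show "finite {xs. set xs \<subseteq> {..k} \<and> length xs = length ps}" by (rule finite_lists_length_eq) simp
qed

text \<open>Shuffling is compatible with deconcatenation: cutting a shuffle after k letters cuts
  every block into a prefix and a suffix, and the two pieces are arbitrary shuffles of the prefixes
  and of the suffixes. The entries of \<open>ms\<close> record how many letters each block gives to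
  the first piece.\<close>

lemma sum_shuf_split:
  fixes f g :: "'b list \<Rightarrow> 'a::comm_ring_1"
  assumes d: "distinct (concat ps)" and k: "k \<le> length (concat ps)"
  shows "(\<Sum>t\<in>shuf ps. f (take k t) * g (drop k t)) =
    (\<Sum>ms\<in>splits k ps. (\<Sum>t\<in>shuf (map2 take ms ps). f t) * (\<Sum>t\<in>shuf (map2 drop ms ps). g t))"
proof -
  let ?S = "\<lambda>ms. shuf (map2 take ms ps) \<times> shuf (map2 drop ms ps)"
  let ?m = "\<lambda>t. map (\<lambda>p. length (filter (\<lambda>a. a \<in> set p) (take k t))) ps"
  have "(\<Sum>t\<in>shuf ps. f (take k t) * g (drop k t)) =
     (\<Sum>(ms, t, s)\<in>Sigma (splits k ps) ?S. f t * g s)"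
  proof (rule sum.reindex_bij_witness[where j = "\<lambda>t. (?m t, take k t, drop k t)" and i = "\<lambda>(ms, t, s). t @ s"])
    fix t assume t: "t \<in> shuf ps"
    have tl: "length t = length (concat ps)" by (rule shuf_length[OF d t])
    have dt: "distinct t" "set t = set (concat ps)" using t by (auto simp: shuf_def)
    show "(case (?m t, take k t, drop k t) of (ms, t, s) \<Rightarrow> t @ s) = t" by simp
    \<comment> \<open>The letters of \<open>p\<close> occur in \<open>t\<close> in the order of
      \<open>p\<close>, so those before the cut form a prefix of \<open>p\<close>.\<close>
    have fil: "filter (\<lambda>a. a \<in> set p) (take k t) = take (length (filter (\<lambda>a. a \<in> set p) (take k t))) p
       \<and> filter (\<lambda>a. a \<in> set p) (drop k t) = drop (length (filter (\<lambda>a. a \<in> set p) (take k t))) p"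
      if "p \<in> set ps" for p
    proof -
      have "filter (\<lambda>a. a \<in> set p) (take k t) @ filter (\<lambda>a. a \<in> set p) (drop k t) = p"
        using t that unfolding filter_append[symmetric] append_take_drop_id shuf_def by blast
      then show ?thesis by (metis append_eq_conv_conj)
    qed
    let ?ms = "?m t"
    have T: "map2 take ?ms ps = map (\<lambda>p. filter (\<lambda>a. a \<in> set p) (take k t)) ps"
      using fil by (auto simp: zip_map1 zip_same_conv_map)
    have D: "map2 drop ?ms ps = map (\<lambda>p. filter (\<lambda>a. a \<in> set p) (drop k t)) ps"
      using fil by (auto simp: zip_map1 zip_same_conv_map)
    have t1: "take k t \<in> shuf (map2 take ?ms ps)"
      unfolding T shuf_def using dt set_take_subset[of k t]
      by (auto simp: distinct_take intro!: filter_cong)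
    have t2: "drop k t \<in> shuf (map2 drop ?ms ps)"
      unfolding D shuf_def using dt set_drop_subset[of k t]
      by (auto simp: distinct_drop intro!: filter_cong)
    have le: "\<forall>i<length ps. ?ms ! i \<le> length (ps ! i)"
    proof (intro allI impI)
      fix i assume i: "i < length ps"
      then have "filter (\<lambda>a. a \<in> set (ps ! i)) t = ps ! i" by (rule shuf_nth[OF t])
      then have "length (filter (\<lambda>a. a \<in> set (ps ! i)) (take k t @ drop k t)) = length (ps ! i)" by simp
      then show "?ms ! i \<le> length (ps ! i)" unfolding filter_append using i by simp
    qed
    have "length (take k t) = length (concat (map2 take ?ms ps))"
      using concat_map2_take_drop[of ?ms ps] d t1 by (intro shuf_length) auto
    then have "sum_list ?ms = k"
      using length_concat_map2_take[of ?ms ps] le k tl by simp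
    then have "?ms \<in> splits k ps" using le by (simp add: splits_def)
    then show "(?m t, take k t, drop k t) \<in> Sigma (splits k ps) ?S" using t1 t2 by simp
    show "(case (?m t, take k t, drop k t) of (ms, t, s) \<Rightarrow> f t * g s) = f (take k t) * g (drop k t)" by simp
  next
    fix z assume "z \<in> Sigma (splits k ps) ?S"
    then obtain ms t s where z: "z = (ms, t, s)" and ms: "ms \<in> splits k ps"
      and t: "t \<in> shuf (map2 take ms ps)" and s: "s \<in> shuf (map2 drop ms ps)" by auto
    have l: "length ms = length ps" and le: "\<forall>i<length ps. ms ! i \<le> length (ps ! i)" and sm: "sum_list ms = k"
      using ms by (auto simp: splits_def)
    note cm = concat_map2_take_drop[OF l d]
    have lt: "length t = k"
      using shuf_length[OF _ t] cm length_concat_map2_take[OF l le] sm by simp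
    have st: "distinct t" "set t = set (concat (map2 take ms ps))"
       "distinct s" "set s = set (concat (map2 drop ms ps))" using t s unfolding shuf_def by blast+
    have fil: "filter (\<lambda>a. a \<in> set (ps ! i)) t = take (ms ! i) (ps ! i)"
       "filter (\<lambda>a. a \<in> set (ps ! i)) s = drop (ms ! i) (ps ! i)" if i: "i < length ps" for i
    proof -
      have iT: "i < length (map2 take ms ps)" "map2 take ms ps ! i = take (ms ! i) (ps ! i)"
        and iD: "i < length (map2 drop ms ps)" "map2 drop ms ps ! i = drop (ms ! i) (ps ! i)" using l i by auto
      have ft: "filter (\<lambda>a. a \<in> set (take (ms ! i) (ps ! i))) t = take (ms ! i) (ps ! i)"
        using shuf_nth[OF t iT(1)] iT(2) by simp
      have fs: "filter (\<lambda>a. a \<in> set (drop (ms ! i) (ps ! i))) s = drop (ms ! i) (ps ! i)"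
        using shuf_nth[OF s iD(1)] iD(2) by simp
      have "set (take (ms ! i) (ps ! i)) \<subseteq> set t" "set (drop (ms ! i) (ps ! i)) \<subseteq> set s"
        using ft fs by (metis filter_is_subset)+
      moreover have "set t \<inter> set s = {}" using st cm by simp
      moreover have "set (ps ! i) = set (take (ms ! i) (ps ! i)) \<union> set (drop (ms ! i) (ps ! i))"
        by (simp flip: set_append)
      ultimately have "filter (\<lambda>a. a \<in> set (ps ! i)) t = filter (\<lambda>a. a \<in> set (take (ms ! i) (ps ! i))) t"
        "filter (\<lambda>a. a \<in> set (ps ! i)) s = filter (\<lambda>a. a \<in> set (drop (ms ! i) (ps ! i))) s"
        by (intro filter_cong; blast)+
      then show "filter (\<lambda>a. a \<in> set (ps ! i)) t = take (ms ! i) (ps ! i)"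
       "filter (\<lambda>a. a \<in> set (ps ! i)) s = drop (ms ! i) (ps ! i)" using ft fs by simp_all
    qed
    have "t @ s \<in> shuf ps" unfolding mem_shuf_iff using st cm fil by (simp del: set_concat)
    then show "(case z of (ms, t, s) \<Rightarrow> t @ s) \<in> shuf ps" using z by simp
    have "?m (t @ s) = ms" using lt fil(1) l le by (intro nth_equalityI) auto
    then show "(?m (case z of (ms, t, s) \<Rightarrow> t @ s), take k (case z of (ms, t, s) \<Rightarrow> t @ s),
        drop k (case z of (ms, t, s) \<Rightarrow> t @ s)) = z" using z lt by simp
  qed
  also have "\<dots> = (\<Sum>ms\<in>splits k ps. \<Sum>(t, s)\<in>?S ms. f t * g s)"
    by (rule sum.Sigma[symmetric]) (auto simp: finite_splits finite_shuf)
  also have "\<dots> = (\<Sum>ms\<in>splits k ps. (\<Sum>t\<in>shuf (map2 take ms ps). f t) * (\<Sum>t\<in>shuf (map2 drop ms ps). g t))"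
    by (simp add: sum_product sum.cartesian_product)
  finally show ?thesis .
qed

text \<open>With \<open>sorted_ind\<close> for g this gives the coefficients of \<Xi>^q, with
  \<open>lie_coeff\<close> those of \<omega>_q. Letters beyond the total length of q are
  ignored.\<close>

fun block_prod :: "('b list \<Rightarrow> 'a::comm_ring_1) \<Rightarrow> nat list \<Rightarrow> 'b list \<Rightarrow> 'a" where
  "block_prod g [] w = 1"
| "block_prod g (a # q) w = g (take a w) * block_prod g q (drop a w)"

fun chunks :: "nat list \<Rightarrow> 'b list \<Rightarrow> 'b list list" where
  "chunks [] w = []"
| "chunks (a # q) w = take a w # chunks q (drop a w)"

lemma sum_list_replicate_update: "i < l \<Longrightarrow> sum_list ((replicate l (0::nat))[i := a]) = a"
  by (simp add: sum_list_update)

lemma shuf_singleton: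
  assumes "i < l" "distinct p"
  shows "shuf ((replicate l [])[i := p]) = {p}"
proof -
  have s: "set (concat ((replicate l [])[i := p])) = set p"
    using assms by (auto simp: set_update_distinct in_set_conv_nth nth_list_update split: if_splits)
     (metis length_list_update length_replicate nth_list_update_eq nth_mem)
  show ?thesis
  proof (intro set_eqI iffI)
    fix t assume t: "t \<in> shuf ((replicate l [])[i := p])"
    have "filter (\<lambda>a. a \<in> set p) t = p" using shuf_nth[OF t, of i] assms by simp
    moreover have "filter (\<lambda>a. a \<in> set p) t = t" using t s unfolding shuf_def by (auto intro: filter_True)
    ultimately show "t \<in> {p}" by simp
  next
    fix t assume "t \<in> {p}"
    then show "t \<in> shuf ((replicate l [])[i := p])"
      unfolding mem_shuf_iff s using assms by (auto simp: nth_list_update)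
  qed
qed

text \<open>Cut after the first a letters. They form a shuffle of block prefixes, and the sum of the
  Dynkin coefficients over such shuffles vanishes unless all a letters come from one block
  i.\<close>

lemma sum_shuf_block_prod_lie_coeff_Cons:
  assumes d: "distinct (concat ps)" and a: "0 < a" and s: "a \<le> length (concat ps)"
  shows "(sum (block_prod lie_coeff (a # q)) (shuf ps)) =
    (\<Sum>i | i < length ps \<and> a \<le> length (ps ! i). lie_coeff (take a (ps ! i)) *
       (sum (block_prod lie_coeff q) (shuf (ps[i := drop a (ps ! i)])) :: 'a::comm_ring_1))"
proof -
  let ?l = "length ps"
  \<comment> \<open>The split vector that takes all \<open>a\<close> letters from block
    \<open>i\<close>.\<close>
  let ?e = "\<lambda>i. (replicate ?l 0)[i := a]"
  let ?J = "{i. i < ?l \<and> a \<le> length (ps ! i)}"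
  let ?F = "\<lambda>ms. (sum lie_coeff (shuf (map2 take ms ps))) * (sum (block_prod lie_coeff q) (shuf (map2 drop ms ps)) :: 'a)"
  have "(sum (block_prod lie_coeff (a # q)) (shuf ps)) = (\<Sum>ms\<in>splits a ps. ?F ms)"
    using sum_shuf_split[OF d s] by simp
  also have "\<dots> = (\<Sum>ms\<in>?e ` ?J. ?F ms)"
  proof (rule sum.mono_neutral_right)
    show "?e ` ?J \<subseteq> splits a ps"
      by (auto simp: splits_def sum_list_replicate_update nth_list_update)
    show "\<forall>ms\<in>splits a ps - ?e ` ?J. ?F ms = 0"
    proof
      fix ms assume ms: "ms \<in> splits a ps - ?e ` ?J"
      then have l: "length ms = ?l" and le: "\<forall>i<?l. ms ! i \<le> length (ps ! i)" and sm: "sum_list ms = a"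
        by (auto simp: splits_def)
      have "\<exists>i<?l. ms ! i \<noteq> 0"
      proof (rule ccontr)
        assume "\<not> (\<exists>i<?l. ms ! i \<noteq> 0)"
        then have "sum_list ms = 0" using l by (auto simp: in_set_conv_nth)
        then show False using sm a by simp
      qed
      then obtain i where i: "i < ?l" "ms ! i \<noteq> 0" by auto
      \<comment> \<open>A single non-zero entry would have to be \<open>a\<close>, making
        \<open>ms\<close> one of the excluded vectors.\<close>
      have "\<exists>j<?l. j \<noteq> i \<and> ms ! j \<noteq> 0"
      proof (rule ccontr)
        assume no: "\<not> (\<exists>j<?l. j \<noteq> i \<and> ms ! j \<noteq> 0)"
        have e: "ms = (replicate ?l 0)[i := ms ! i]"
        proof (rule nth_equalityI)
          fix r assume "r < length ms"
          then show "ms ! r = (replicate ?l 0)[i := ms ! i] ! r"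
            using no l i(1) by (cases "r = i") auto
        qed (simp add: l)
        then have "ms ! i = a" using sum_list_replicate_update[OF i(1), of "ms ! i"] sm by simp
        then have "ms \<in> ?e ` ?J" using e i le by (intro image_eqI[of _ _ i]) auto
        then show False using ms by simp
      qed
      then obtain j where j: "j < ?l" "j \<noteq> i" "ms ! j \<noteq> 0" by auto
      have "(sum lie_coeff (shuf (map2 take ms ps))) = (0 :: 'a)"
        by (rule sum_shuf_lie_coeff[of _ i j]) (use l d i j le concat_map2_take_drop[OF l d] in auto)
      then show "?F ms = 0" by simp
    qed
  qed (rule finite_splits)
  also have "\<dots> = (\<Sum>i\<in>?J. ?F (?e i))"
  proof (rule sum.reindex_cong[OF _ refl refl])
    show "inj_on ?e ?J"
    proof (rule inj_onI)
      fix i j assume h: "i \<in> ?J" "j \<in> ?J" "?e i = ?e j"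
      then have "?e i ! i = ?e j ! i" by (simp only:)
      then show "i = j" using h(1,2) a by (cases "i = j") auto
    qed
  qed
  also have "\<dots> = (\<Sum>i\<in>?J. lie_coeff (take a (ps ! i)) * (sum (block_prod lie_coeff q) (shuf (ps[i := drop a (ps ! i)]))))"
  proof (rule sum.cong[OF refl])
    fix i assume i: "i \<in> ?J"
    have "map2 take (?e i) ps = (replicate ?l [])[i := take a (ps ! i)]"
      using i by (intro nth_equalityI) (auto simp: nth_list_update)
    moreover have "map2 drop (?e i) ps = ps[i := drop a (ps ! i)]"
      using i by (intro nth_equalityI) (auto simp: nth_list_update)
    moreover have "distinct (ps ! i)" using d i by (simp add: distinct_concat_iff)
    ultimately show "?F (?e i) = lie_coeff (take a (ps ! i)) * (sum (block_prod lie_coeff q) (shuf (ps[i := drop a (ps ! i)])))"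
      using i by (simp add: shuf_singleton)
  qed
  finally show ?thesis .
qed

text \<open>The recursion shortens blocks in place and leaves empty words behind; only blocks that
  still have letters matter for the count.\<close>

definition nonempties :: "'b list list \<Rightarrow> 'b list multiset" where
  "nonempties ps = filter_mset (\<lambda>p. p \<noteq> []) (mset ps)"

lemma nonempties_update:
  assumes "i < length ps" "ps ! i \<noteq> []"
  shows "add_mset (ps ! i) (nonempties (ps[i := p])) = nonempties ps + (if p = [] then {#} else {#p#})"
proof -
  obtain R where R: "mset ps = add_mset (ps ! i) R"
    using assms(1) multi_member_split[of "ps ! i" "mset ps"] by auto
  then have "mset (ps[i := p]) = add_mset p R" using assms(1) by (simp add: mset_update)
  then show ?thesis unfolding nonempties_def R using assms(2) by simp
qed

text \<open>In every surviving term a part of q takes its letters from one block and so exhausts at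
  most one block; with fewer parts than blocks the letters cannot be used up.\<close>

lemma sum_shuf_block_prod_lie_coeff_eq_0:
  assumes "distinct (concat ps)" "\<forall>a\<in>set q. 0 < a" "sum_list q = length (concat ps)"
    "length q < size (nonempties ps)"
  shows "(sum (block_prod lie_coeff q) (shuf ps)) = (0::'a::comm_ring_1)"
  using assms
proof (induction q arbitrary: ps)
  case Nil
  then have "concat ps = []" by simp
  then have "nonempties ps = {#}" by (auto simp: nonempties_def filter_mset_eq_conv)
  then show ?case using Nil by simp
next
  case (Cons a q)
  have "(sum (block_prod lie_coeff q) (shuf (ps[i := drop a (ps ! i)]))) = (0::'a)"
    if i: "i < length ps" "a \<le> length (ps ! i)" for i
  proof (rule Cons.IH)
    have di: "distinct (ps ! i)" using Cons.prems(1) i by (simp add: distinct_concat_iff)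
    show "distinct (concat (ps[i := drop a (ps ! i)]))"
      by (rule distinct_concat_update) (use Cons.prems i di in \<open>auto dest: in_set_dropD\<close>)
    show "sum_list q = length (concat (ps[i := drop a (ps ! i)]))"
      using length_concat_update[OF i(1), of "drop a (ps ! i)"] Cons.prems(3) i by simp
    have "ps ! i \<noteq> []" using i Cons.prems(2) by auto
    from nonempties_update[OF i(1) this, of "drop a (ps ! i)"]
    have "Suc (size (nonempties (ps[i := drop a (ps ! i)]))) \<ge> size (nonempties ps)"
      by (metis le_add1 size_add_mset size_union)
    then show "length q < size (nonempties (ps[i := drop a (ps ! i)]))" using Cons.prems(4) by simp
  qed (use Cons.prems in auto)
  moreover have "0 < a" "a \<le> length (concat ps)" using Cons.prems(2) by (auto simp flip: Cons.prems(3))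
  ultimately show ?case
    unfolding sum_shuf_block_prod_lie_coeff_Cons[OF Cons.prems(1) \<open>0 < a\<close> \<open>a \<le> length (concat ps)\<close>]
    by (intro sum.neutral) auto
qed

lemma size_filter_mset_eq: "size (filter_mset (\<lambda>x. f x = a) M) = count (image_mset f M) a"
  by (induction M) auto

lemma brfact_add_mset: "brfact (add_mset a M) = Suc (count M a) * brfact M"
proof -
  have *: "brfact N = (\<Prod>i\<in>S. fact (count N i))" if "finite S" "set_mset N \<subseteq> S" for N S
    unfolding brfact_def by (rule prod.mono_neutral_left) (use that in \<open>auto simp: not_in_iff\<close>)
  let ?S = "insert a (set_mset M)"
  have "brfact (add_mset a M) = (\<Prod>i\<in>?S. fact (count (add_mset a M) i))" by (rule *) auto
  also have "\<dots> = fact (Suc (count M a)) * (\<Prod>i\<in>?S - {a}. fact (count (add_mset a M) i))"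
    by (subst prod.remove[of _ a]) auto
  also have "(\<Prod>i\<in>?S - {a}. fact (count (add_mset a M) i) :: nat) = (\<Prod>i\<in>?S - {a}. fact (count M i))"
    by (rule prod.cong) auto
  also have "fact (Suc (count M a)) * \<dots> = Suc (count M a) * (\<Prod>i\<in>?S. fact (count M i))"
    by (subst (2) prod.remove[of _ a]) (auto simp: algebra_simps)
  also have "(\<Prod>i\<in>?S. fact (count M i)) = brfact M" by (rule *[symmetric]) auto
  finally show ?thesis .
qed

text \<open>A part a must use up a whole block of length a, for otherwise more non-empty blocks than
  parts would remain. There are as many choices as blocks of that length, and over all parts these
  choices multiply to [\<lambda>]!.\<close>

lemma sum_shuf_block_prod_lie_coeff_eq:
  assumes "distinct (concat ps)" "\<forall>a\<in>set q. 0 < a" "image_mset length (nonempties ps) = mset q"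
  shows "(sum (block_prod lie_coeff q) (shuf ps)) =
    (of_nat (brfact (mset q)) * prod_mset (image_mset lie_coeff (nonempties ps)) :: 'a::comm_ring_1)"
  using assms
proof (induction q arbitrary: ps)
  case Nil
  then have "concat ps = []" by (auto simp: nonempties_def filter_mset_eq_conv)
  then show ?case using Nil by (simp add: shuf_empty brfact_def)
next
  case (Cons a q)
  have "length (concat ps) = sum_mset (image_mset length (nonempties ps))"
    by (induction ps) (auto simp: nonempties_def)
  then have len: "length (concat ps) = sum_list (a # q)" using Cons.prems(3) by (metis sum_mset_sum_list)
  have sz: "size (nonempties ps) = Suc (length q)"
    using Cons.prems(3) by (metis length_Cons size_image_mset size_mset)
  let ?J = "{i. i < length ps \<and> a \<le> length (ps ! i)}"
  let ?E = "{i. i < length ps \<and> length (ps ! i) = a}"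
  let ?P = "prod_mset (image_mset lie_coeff (nonempties ps)) :: 'a"
  let ?T = "\<lambda>i. lie_coeff (take a (ps ! i)) * (sum (block_prod lie_coeff q) (shuf (ps[i := drop a (ps ! i)])) :: 'a)"
  have d': "distinct (concat (ps[i := drop a (ps ! i)]))" if i: "i < length ps" for i
  proof -
    have di: "distinct (ps ! i)" using Cons.prems(1) i by (simp add: distinct_concat_iff)
    show ?thesis
      by (rule distinct_concat_update) (use Cons.prems i di in \<open>auto dest: in_set_dropD\<close>)
  qed
  have "(sum (block_prod lie_coeff (a # q)) (shuf ps)) = (\<Sum>i\<in>?J. ?T i)"
    using Cons.prems len by (intro sum_shuf_block_prod_lie_coeff_Cons) auto
  \<comment> \<open>A non-empty remainder keeps all blocks alive while one part is gone, which gives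
    zero.\<close>
  also have "\<dots> = (\<Sum>i\<in>?E. ?T i)"
  proof (rule sum.mono_neutral_right)
    show "\<forall>i\<in>?J - ?E. ?T i = 0"
    proof
      fix i assume i: "i \<in> ?J - ?E"
      then have ne: "ps ! i \<noteq> []" "drop a (ps ! i) \<noteq> []" by auto
      have "size (nonempties (ps[i := drop a (ps ! i)])) = size (nonempties ps)"
      proof -
        have "size (add_mset (ps ! i) (nonempties (ps[i := drop a (ps ! i)])))
          = size (nonempties ps + {#drop a (ps ! i)#})"
          using nonempties_update[of i ps "drop a (ps ! i)"] ne i by simp
        then show ?thesis by simp
      qed
      moreover have "sum_list q = length (concat (ps[i := drop a (ps ! i)]))"
        using length_concat_update[of i ps "drop a (ps ! i)"] len i by simp
      ultimately have "(sum (block_prod lie_coeff q) (shuf (ps[i := drop a (ps ! i)]))) = (0::'a)"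
        using d' i Cons.prems sz by (intro sum_shuf_block_prod_lie_coeff_eq_0) auto
      then show "?T i = 0" by simp
    qed
  qed auto
  also have "\<dots> = (\<Sum>i\<in>?E. of_nat (brfact (mset q)) * ?P)"
  proof (rule sum.cong[OF refl])
    fix i assume i: "i \<in> ?E"
    then have ne: "ps ! i \<noteq> []" using Cons.prems(2) by auto
    have u: "add_mset (ps ! i) (nonempties (ps[i := []])) = nonempties ps"
      using nonempties_update[of i ps "[]"] i ne by simp
    have "add_mset (length (ps ! i)) (image_mset length (nonempties (ps[i := []]))) = mset (a # q)"
      using Cons.prems(3) unfolding u[symmetric] by simp
    then have "image_mset length (nonempties (ps[i := []])) = mset q" using i by simp
    then have "(sum (block_prod lie_coeff q) (shuf (ps[i := []]))) =
      (of_nat (brfact (mset q)) * prod_mset (image_mset lie_coeff (nonempties (ps[i := []]))) :: 'a)"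
      using Cons.IH[of "ps[i := []]"] d'[of i] i Cons.prems by simp
    then show "?T i = of_nat (brfact (mset q)) * ?P" unfolding u[symmetric] using i by (simp add: ac_simps)
  qed
  also have "\<dots> = of_nat (card ?E) * (of_nat (brfact (mset q)) * ?P)" by simp
  also have "card ?E = count (mset (a # q)) a"
  proof -
    have "card ?E = length (filter (\<lambda>p. length p = a) ps)" by (simp add: length_filter_conv_card)
    also have "\<dots> = size (filter_mset (\<lambda>p. length p = a) (mset ps))" by (metis mset_filter size_mset)
    \<comment> \<open>As \<open>a\<close> is positive, the empty words among the blocks do not
      count.\<close>
    also have "filter_mset (\<lambda>p. length p = a) (mset ps) = filter_mset (\<lambda>p. length p = a) (nonempties ps)"
      unfolding nonempties_def filter_filter_mset using Cons.prems(2) by (intro filter_mset_cong) auto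
    also have "size \<dots> = count (image_mset length (nonempties ps)) a"
      by (rule size_filter_mset_eq)
    finally show ?thesis unfolding Cons.prems(3) .
  qed
  finally show ?case unfolding mset.simps brfact_add_mset of_nat_mult
    by (simp only: mult.assoc count_add_mset if_True simp_thms)
qed

lemma block_prod_conv_chunks: "block_prod g q w = prod_list (map g (chunks q w))"
  by (induction q arbitrary: w) auto

lemma concat_chunks: "concat (chunks q w) = take (sum_list q) w"
  by (induction q arbitrary: w) (auto simp: take_add)

lemma map_length_chunks: "sum_list q \<le> length w \<Longrightarrow> map length (chunks q w) = q"
  by (induction q arbitrary: w) auto

lemma nonempties_chunks:
  assumes "\<forall>a\<in>set q. 0 < a" "sum_list q \<le> length w"
  shows "nonempties (chunks q w) = mset (chunks q w)"
proof -
  have "p \<noteq> []" if "p \<in> set (chunks q w)" for p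
  proof -
    have "length p \<in> set (map length (chunks q w))" using that by simp
    then show ?thesis using assms map_length_chunks[OF assms(2)] by auto
  qed
  then show ?thesis by (auto simp: nonempties_def filter_mset_eq_conv)
qed

lemma sum_shuf_chunks_lie_coeff:
  assumes "distinct w" "sum_list r = length w" "\<forall>a\<in>set r. 0 < a" "mset r = mset q"
  shows "(sum (block_prod lie_coeff q) (shuf (chunks r w))) =
    (of_nat (brfact (mset q)) * block_prod lie_coeff r w :: 'a::comm_ring_1)"
proof -
  have "(sum (block_prod lie_coeff q) (shuf (chunks r w))) =
    (of_nat (brfact (mset q)) * prod_mset (image_mset lie_coeff (nonempties (chunks r w))) :: 'a)"
  proof (rule sum_shuf_block_prod_lie_coeff_eq)
    show "distinct (concat (chunks r w))" using assms by (simp add: concat_chunks)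
    show "\<forall>a\<in>set q. 0 < a" using assms(3,4) by (metis set_mset_mset)
    show "image_mset length (nonempties (chunks r w)) = mset q"
      using assms map_length_chunks[of r w] by (simp add: nonempties_chunks flip: mset_map)
  qed
  then show ?thesis using assms
    by (simp add: nonempties_chunks block_prod_conv_chunks prod_mset_prod_list flip: mset_map)
qed

lemma sum_shuf_chunks_lie_coeff_eq_0:
  assumes "distinct w" "sum_list r = length w" "\<forall>a\<in>set r. 0 < a"
    and "sum_list q = length w" "\<forall>a\<in>set q. 0 < a" "length q < length r"
  shows "(sum (block_prod lie_coeff q) (shuf (chunks r w))) = (0 :: 'a::comm_ring_1)"
proof (rule sum_shuf_block_prod_lie_coeff_eq_0)
  show "length q < size (nonempties (chunks r w))"
    using assms map_length_chunks[of r w] by (simp add: nonempties_chunks flip: length_map[of length])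
qed (use assms in \<open>auto simp: concat_chunks\<close>)

section \<open>Functions of words that depend only on descents\<close>

definition same_desc :: "nat list \<Rightarrow> nat list \<Rightarrow> bool" where
  "same_desc p p' \<longleftrightarrow> length p = length p' \<and>
     (\<forall>i. Suc i < length p \<longrightarrow> (p ! i < p ! Suc i \<longleftrightarrow> p' ! i < p' ! Suc i))"

lemma same_desc_take: "same_desc p p' \<Longrightarrow> same_desc (take m p) (take m p')"
  by (auto simp: same_desc_def)

lemma same_desc_drop: "same_desc p p' \<Longrightarrow> same_desc (drop m p) (drop m p')"
  by (auto simp: same_desc_def)

lemma sorted_distinct_iff_nth_Suc:
  fixes p :: "nat list"
  assumes "distinct p"
  shows "sorted p \<longleftrightarrow> (\<forall>i. Suc i < length p \<longrightarrow> p ! i < p ! Suc i)"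
proof -
  have "sorted_wrt (<) p \<longleftrightarrow> (\<forall>i. Suc i < length p \<longrightarrow> p ! i < p ! Suc i)"
    by (rule sorted_wrt_iff_nth_Suc_transp) (rule transp_on_less)
  then show ?thesis using assms strict_sorted_iff[of p] by blast
qed

lemma same_desc_sorted: "same_desc p p' \<Longrightarrow> distinct p \<Longrightarrow> distinct p' \<Longrightarrow> sorted p \<longleftrightarrow> sorted p'"
  unfolding sorted_distinct_iff_nth_Suc[of p] sorted_distinct_iff_nth_Suc[of p'] same_desc_def by metis

text \<open>For distinct letters sortedness is a condition on neighbours, so the whole recursion of
  \<open>lie_coeff\<close> compares neighbours only; the two words may use different letters. This
  is what puts \<omega>_q into the descent algebra.\<close>

lemma same_desc_lie_coeff:
  "same_desc p p' \<Longrightarrow> distinct p \<Longrightarrow> distinct p' \<Longrightarrow> lie_coeff p = (lie_coeff p' :: 'a::comm_ring_1)"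
proof (induction p arbitrary: p' rule: lie_coeff.induct)
  case 1
  then show ?case by (simp add: same_desc_def)
next
  case (2 a)
  then show ?case by (cases p') (auto simp: same_desc_def)
next
  case (3 a b w)
  then have "length p' = Suc (Suc (length w))" by (simp add: same_desc_def)
  then obtain a' b' w' where p': "p' = a' # b' # w'" by (auto simp: length_Suc_conv)
  have sd: "same_desc (b # w) (b' # w')" using same_desc_drop[OF 3(2), of 1] p' by simp
  have ab: "a < b \<longleftrightarrow> a' < b'"
    using 3(2)[unfolded same_desc_def p', THEN conjunct2, rule_format, of 0] by simp
  have srt: "sorted (a # b # w) \<longleftrightarrow> sorted (a' # b' # w')" using 3(2,3,4) p' by (intro same_desc_sorted) simp_all
  have ne: "a \<noteq> b" "a' \<noteq> b'" using 3(3,4) p' by simp_all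
  show ?case
  proof (cases "b < a")
    case True
    then have "b' < a'" using ab ne by linarith
    moreover have "lie_coeff (b # w) = (lie_coeff (b' # w') :: 'a)" using 3(3,4) p' by (intro 3(1)[OF True sd]) simp_all
    ultimately show ?thesis using True p' by simp
  next
    case False
    then have "\<not> b' < a'" using ab ne by linarith
    then show ?thesis using False srt p' by (simp del: sorted_simps sorted_wrt.simps)
  qed
qed

lemma same_desc_block_prod_lie_coeff:
  "same_desc w w' \<Longrightarrow> distinct w \<Longrightarrow> distinct w' \<Longrightarrow>
   block_prod lie_coeff q w = (block_prod lie_coeff q w' :: 'a::comm_ring_1)"
proof (induction q arbitrary: w w')
  case (Cons a q)
  have "lie_coeff (take a w) = (lie_coeff (take a w') :: 'a)"
    using Cons.prems by (intro same_desc_lie_coeff same_desc_take) auto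
  moreover have "block_prod lie_coeff q (drop a w) = (block_prod lie_coeff q (drop a w') :: 'a)"
    using Cons.prems by (intro Cons.IH same_desc_drop) auto
  ultimately show ?case by simp
qed simp

definition sorted_ind :: "nat list \<Rightarrow> 'a::comm_ring_1" where
  "sorted_ind w = (if sorted w then 1 else 0)"

text \<open>An increasing word is determined by its letters and restricts to increasing blocks. So
  at most one shuffle is increasing, and it exists exactly when all blocks are increasing.\<close>

lemma sum_shuf_sorted:
  assumes d: "distinct (concat us)"
  shows "(sum sorted_ind (shuf us)) = (if \<forall>u\<in>set us. sorted u then 1 else 0 :: 'a::comm_ring_1)"
proof -
  have "(sum sorted_ind (shuf us)) = (\<Sum>t\<in>{t\<in>shuf us. sorted t}. 1 :: 'a)"
    by (subst sum.inter_filter) (auto simp: finite_shuf sorted_ind_def)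
  also have "\<dots> = of_nat (card {t\<in>shuf us. sorted t})" by simp
  also have "{t\<in>shuf us. sorted t} = (if \<forall>u\<in>set us. sorted u then {sorted_list_of_set (set (concat us))} else {})"
  proof (cases "\<forall>u\<in>set us. sorted u")
    case True
    let ?t = "sorted_list_of_set (set (concat us))"
    have "filter (\<lambda>a. a \<in> set u) ?t = u" if "u \<in> set us" for u
    proof (rule sorted_distinct_set_unique)
      show "distinct u" using d that by (simp add: distinct_concat_iff)
      show "set (filter (\<lambda>a. a \<in> set u) ?t) = set u" using that by auto
    qed (use that True in \<open>auto simp: sorted_wrt_filter simp del: set_concat\<close>)
    then have "?t \<in> shuf us" unfolding shuf_def by (simp del: set_concat)
    moreover have "t = ?t" if "t \<in> shuf us" "sorted t" for t
      using that unfolding shuf_def by (metis (mono_tags, lifting) mem_Collect_eq sorted_list_of_set.idem_if_sorted_distinct)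
    moreover have "sorted ?t" by simp
    ultimately have "{t\<in>shuf us. sorted t} = {?t}" by blast
    then show ?thesis using True by simp
  next
    case False
    then obtain u where u: "u \<in> set us" "\<not> sorted u" by auto
    have "\<not> sorted t" if "t \<in> shuf us" for t
    proof
      assume "sorted t"
      then have "sorted (filter (\<lambda>a. a \<in> set u) t)" by (rule sorted_wrt_filter)
      then show False using that u unfolding shuf_def by auto
    qed
    then show ?thesis using False by auto
  qed
  finally show ?thesis by simp
qed

text \<open>
  This is the multiplicative closure of the descent algebra: the sum is the coefficient of a product
  \<open>\<Xi>\<^sup>r \<Xi>\<^sup>q\<close> at the permutation with \<open>r\<close>-blocks \<open>ps\<close>.
\<close>

lemma sum_shuf_block_prod_sorted_same_desc:
  assumes "list_all2 same_desc ps ps'" "distinct (concat ps)" "distinct (concat ps')"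
    "sum_list q = length (concat ps)"
  shows "(sum (block_prod sorted_ind q) (shuf ps)) = (\<Sum>t\<in>shuf ps'. block_prod sorted_ind q t :: 'a::comm_ring_1)"
  using assms
proof (induction q arbitrary: ps ps')
  case (Nil ps ps')
  have "length (concat ps) = length (concat ps')"
    using Nil(1) by (induction rule: list_all2_induct) (auto simp: same_desc_def)
  moreover have "length (concat ps) = 0" using Nil(4) by simp
  ultimately have "concat ps = []" "concat ps' = []" by (metis length_0_conv)+
  then show ?case by (simp add: shuf_empty)
next
  case (Cons a q ps ps')
  have lc: "length (concat ps) = length (concat ps')"
    using Cons(2) by (induction rule: list_all2_induct) (auto simp: same_desc_def)
  have l: "length ps = length ps'" using Cons(2) by (rule list_all2_lengthD)
  have sd: "same_desc (ps ! i) (ps' ! i)" if "i < length ps" for i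
    using Cons(2) that by (rule list_all2_nthD)
  then have li: "length (ps ! i) = length (ps' ! i)" if "i < length ps" for i
    using that by (simp add: same_desc_def)
  \<comment> \<open>Split vectors depend on block lengths alone, so the expansions for both lists
    run over the same vectors.\<close>
  have sp: "splits a ps = splits a ps'" using l li by (auto simp: splits_def)
  have expand: "(sum (block_prod sorted_ind (a # q)) (shuf ps)) =
    (\<Sum>ms\<in>splits a ps. (sum sorted_ind (shuf (map2 take ms ps))) * (sum (block_prod sorted_ind q) (shuf (map2 drop ms ps)) :: 'a))"
    if "distinct (concat ps)" "sum_list (a # q) = length (concat ps)" for ps
    unfolding block_prod.simps by (rule sum_shuf_split) (use that in auto)
  have "(sum sorted_ind (shuf (map2 take ms ps))) * (sum (block_prod sorted_ind q) (shuf (map2 drop ms ps))) =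
     (sum sorted_ind (shuf (map2 take ms ps'))) * (sum (block_prod sorted_ind q) (shuf (map2 drop ms ps')) :: 'a)"
    if ms: "ms \<in> splits a ps" for ms
  proof -
    have lm: "length ms = length ps" and le: "\<forall>i<length ps. ms ! i \<le> length (ps ! i)" and sm: "sum_list ms = a"
      using ms by (auto simp: splits_def)
    note c1 = concat_map2_take_drop[OF lm Cons.prems(2)]
    note c2 = concat_map2_take_drop[OF lm[unfolded l] Cons.prems(3)]
    have "sorted (take (ms ! i) (ps ! i)) \<longleftrightarrow> sorted (take (ms ! i) (ps' ! i))" if "i < length ps" for i
      using that sd Cons.prems(2,3) l
      by (intro same_desc_sorted same_desc_take distinct_take) (auto simp: distinct_concat_iff)
    then have "(\<forall>u\<in>set (map2 take ms ps). sorted u) \<longleftrightarrow> (\<forall>u\<in>set (map2 take ms ps'). sorted u)"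
      unfolding all_set_conv_all_nth using lm l by simp
    then have 1: "(sum sorted_ind (shuf (map2 take ms ps))) = (sum sorted_ind (shuf (map2 take ms ps')) :: 'a)"
      using c1 c2 by (simp only: sum_shuf_sorted)
    have "(sum (block_prod sorted_ind q) (shuf (map2 drop ms ps))) =
      (sum (block_prod sorted_ind q) (shuf (map2 drop ms ps')) :: 'a)"
    proof (rule Cons.IH)
      show "list_all2 same_desc (map2 drop ms ps) (map2 drop ms ps')"
        using lm l sd by (auto simp: list_all2_conv_all_nth same_desc_drop)
      show "sum_list q = length (concat (map2 drop ms ps))"
        using length_concat_map2_drop[OF lm le] sm Cons.prems(4) by simp
    qed (use c1 c2 in auto)
    then show ?thesis using 1 by simp
  qed
  then show ?case
    unfolding expand[OF Cons.prems(2,4)] expand[OF Cons.prems(3) Cons.prems(4)[unfolded lc]] sp[symmetric]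
    by (intro sum.cong) auto
qed

lemma same_desc_chunks: "same_desc w w' \<Longrightarrow> list_all2 same_desc (chunks q w) (chunks q w')"
  by (induction q arbitrary: w w') (auto simp: same_desc_take same_desc_drop)

text \<open>
  The action of \<open>\<omega>\<^sub>k = (1 - c\<^sub>k) \<cdots> (1 - c\<^sub>2)\<close> on a function of words of length \<open>k\<close>.
\<close>

function dynkin_op :: "('b list \<Rightarrow> 'a::comm_ring_1) \<Rightarrow> 'b list \<Rightarrow> 'a" where
  "dynkin_op x w = (if length w \<le> 1 then x w else
     dynkin_op (\<lambda>t. x (t @ [last w])) (butlast w) - dynkin_op (\<lambda>t. x (t @ [hd w])) (tl w))"
  by auto
termination by (relation "measure (\<lambda>(x, w). length w)") auto

declare dynkin_op.simps [simp del]

lemma dynkin_op_cong: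
  "(\<And>t. mset t = mset w \<Longrightarrow> x t = y t) \<Longrightarrow> dynkin_op x w = dynkin_op y w"
proof (induction x w arbitrary: y rule: dynkin_op.induct)
  case (1 x w)
  show ?case
  proof (cases "length w \<le> 1")
    case True
    then show ?thesis using 1(3) by (simp add: dynkin_op.simps)
  next
    case False
    then have w: "w \<noteq> []" by auto
    have "dynkin_op (\<lambda>t. x (t @ [last w])) (butlast w) = dynkin_op (\<lambda>t. y (t @ [last w])) (butlast w)"
      using False w 1(3)
      by (intro 1(1)) (auto, metis append_butlast_last_id mset_append mset_single_iff union_mset_add_mset_right add_mset_add_single mset.simps)
    moreover have "dynkin_op (\<lambda>t. x (t @ [hd w])) (tl w) = dynkin_op (\<lambda>t. y (t @ [hd w])) (tl w)"
      using False w 1(3) by (intro 1(2)) (cases w; auto)+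
    ultimately show ?thesis using False by (simp add: dynkin_op.simps[of _ w])
  qed
qed

lemma dynkin_op_scale: "dynkin_op (\<lambda>t. a * x t * b) w = a * dynkin_op x w * b"
proof (induction x w rule: dynkin_op.induct)
  case (1 x w)
  then show ?case by (subst (1 2) dynkin_op.simps) (auto simp: algebra_simps)
qed

lemma dynkin_op_zero: "dynkin_op (\<lambda>t. 0) w = 0"
  using dynkin_op_scale[of 0 "\<lambda>_. 0" 0 w] by simp

text \<open>With \<open>a\<close> frozen as the last letter, \<open>t @ [a]\<close> is increasing
  iff \<open>t\<close> is increasing and no letter exceeds \<open>a\<close>. The first assumption is
  the induction hypothesis of the identification of \<open>dynkin_op sorted_ind\<close> with
  \<open>lie_coeff\<close>.\<close>

lemma dynkin_op_sorted_append:
  assumes "\<And>w'. length w' = length w \<Longrightarrow> distinct w' \<Longrightarrow> w' \<noteq> [] \<Longrightarrow> dynkin_op sorted_ind w' = (lie_coeff w' :: 'a::comm_ring_1)"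
    and "distinct w" "w \<noteq> []" "a \<notin> set w"
  shows "dynkin_op (\<lambda>t. sorted_ind (t @ [a])) w = (if \<forall>x\<in>set w. x \<le> a then lie_coeff w else (0 :: 'a))"
proof (cases "\<forall>x\<in>set w. x \<le> a")
  case True
  have "dynkin_op (\<lambda>t. sorted_ind (t @ [a])) w = (dynkin_op sorted_ind w :: 'a)"
  proof (rule dynkin_op_cong)
    fix t assume "mset t = mset w"
    then have "set t = set w" by (metis set_mset_mset)
    then show "sorted_ind (t @ [a]) = sorted_ind t" using True by (simp add: sorted_ind_def sorted_append)
  qed
  then show ?thesis using True assms by simp
next
  case False
  have "dynkin_op (\<lambda>t. sorted_ind (t @ [a]) :: 'a) w = dynkin_op (\<lambda>t. 0) w"
  proof (rule dynkin_op_cong)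
    fix t assume "mset t = mset w"
    then have "set t = set w" by (metis set_mset_mset)
    then show "sorted_ind (t @ [a]) = (0 :: 'a)" using False by (auto simp: sorted_ind_def sorted_append)
  qed
  then show ?thesis using False by (auto simp: dynkin_op_zero)
qed

text \<open>Both sides obey the same recursion: the two terms of \<open>dynkin_op\<close> freeze the
  last or the first letter at the end, and each survives only if that letter is the largest, as in
  \<open>lie_coeff_max\<close>.\<close>

lemma dynkin_op_sorted_ind:
  "distinct w \<Longrightarrow> w \<noteq> [] \<Longrightarrow> dynkin_op sorted_ind w = (lie_coeff w :: 'a::comm_ring_1)"
proof (induction "length w" arbitrary: w rule: less_induct)
  case less
  show ?case
  proof (cases "length w \<le> 1")
    case True
    then have "length w = 1" using less(3) by (cases w) auto
    then obtain a where "w = [a]" by (auto simp: length_Suc_conv)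
    then show ?thesis by (simp add: dynkin_op.simps sorted_ind_def)
  next
    case False
    then obtain a v where v: "w = a # v" "v \<noteq> []" by (cases w) auto
    obtain u b where u: "w = u @ [b]" "u \<noteq> []" using False by (cases w rule: rev_cases) auto
    define m where "m = Max (set w)"
    have m: "m \<in> set w" "\<forall>x\<in>set w. x \<le> m" unfolding m_def using less(3) by (auto intro: Max_in)
    have 1: "dynkin_op (\<lambda>t. sorted_ind (t @ [b])) u = (if \<forall>x\<in>set u. x \<le> b then lie_coeff u else 0 :: 'a)"
      by (rule dynkin_op_sorted_append) (use less u in auto)
    have 2: "dynkin_op (\<lambda>t. sorted_ind (t @ [a])) v = (if \<forall>x\<in>set v. x \<le> a then lie_coeff v else 0 :: 'a)"
      by (rule dynkin_op_sorted_append) (use less v in auto)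
    have b: "(\<forall>x\<in>set u. x \<le> b) \<longleftrightarrow> b = m" using m u by (auto intro: antisym)
    have a: "(\<forall>x\<in>set v. x \<le> a) \<longleftrightarrow> a = m" using m v by (auto intro: antisym)
    have "dynkin_op sorted_ind w = dynkin_op (\<lambda>t. sorted_ind (t @ [last w])) (butlast w)
       - dynkin_op (\<lambda>t. sorted_ind (t @ [hd w])) (tl w)" using False by (subst dynkin_op.simps) simp
    also have "dynkin_op (\<lambda>t. sorted_ind (t @ [last w])) (butlast w) =
       (if last w = m then lie_coeff (butlast w) else 0 :: 'a)" using 1 b u by simp
    also have "dynkin_op (\<lambda>t. sorted_ind (t @ [hd w])) (tl w) =
       (if hd w = m then lie_coeff (tl w) else 0 :: 'a)" using 2 a v by simp
    also have "(if last w = m then lie_coeff (butlast w) else 0 :: 'a) - (if hd w = m then lie_coeff (tl w) else 0)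
       = lie_coeff w" by (rule lie_coeff_max[symmetric]) (use less m False in auto)
    finally show ?thesis .
  qed
qed

text \<open>Modulo proper shuffles the word u a v equals (-1)^|u| times the sum of all words that
  consist of a followed by a shuffle of the reversal of u with v. The reversal and the sign are
  those of the antipode of the shuffle algebra.\<close>

definition rev_shuf_sum :: "('b list \<Rightarrow> 'a::comm_ring_1) \<Rightarrow> 'b list \<Rightarrow> 'b \<Rightarrow> 'b list \<Rightarrow> 'a" where
  "rev_shuf_sum x u a v = (\<Sum>t\<in>shuf [rev u, v]. x (a # t))"

lemma Collect_less_2_eq: "{i. i < Suc (Suc 0) \<and> P i} = (if P 0 then {0} else {}) \<union> (if P 1 then {1} else {})"
proof -
  have "i < Suc (Suc 0) \<longleftrightarrow> i = 0 \<or> i = 1" for i by linarith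
  then have e: "{i. i < Suc (Suc 0) \<and> P i} = {0, 1} \<inter> Collect P" by blast
  show ?thesis unfolding e by (cases "P 0"; cases "P 1") auto
qed

lemma sum_shuf_pair_front:
  assumes "distinct (b # s @ c # w)"
  shows "(\<Sum>t\<in>shuf [b # s, c # w]. x t) =
    (\<Sum>t\<in>shuf [s, c # w]. x (b # t)) + (\<Sum>t\<in>shuf [b # s, w]. x (c # t) :: 'a::comm_ring_1)"
proof -
  have "(\<Sum>t\<in>shuf [b # s, c # w]. x t) = (\<Sum>i | i < length [b # s, c # w] \<and> [b # s, c # w] ! i \<noteq> [].
     \<Sum>t\<in>shuf ([b # s, c # w][i := tl ([b # s, c # w] ! i)]). x (hd ([b # s, c # w] ! i) # t))"
    by (rule sum_shuf_front) (use assms in auto)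
  then show ?thesis by (simp add: Collect_less_2_eq)
qed

text \<open>
  For the functions \<open>x\<close> at hand, the shuffles of \<open>b # s\<close> and \<open>a # v\<close> starting with \<open>b\<close> cancel those starting with
  \<open>a\<close>, so the letters of \<open>u\<close> can be moved past \<open>a\<close> one at a time.
\<close>

lemma rev_shuf_sum_lie:
  fixes x :: "'b list \<Rightarrow> 'a::comm_ring_1"
  assumes lie: "\<And>s w. s \<noteq> [] \<Longrightarrow> w \<noteq> [] \<Longrightarrow> distinct (s @ w) \<Longrightarrow> (\<Sum>t\<in>shuf [s, w]. x t) = 0"
  shows "distinct (u @ a # v) \<Longrightarrow> (-1) ^ length u * rev_shuf_sum x u a v = x (u @ a # v)"
proof (induction u arbitrary: a v rule: rev_induct)
  case Nil
  have "shuf [[], v] = {v}" using shuf_singleton[of 1 2 v] Nil by (simp add: numeral_2_eq_2)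
  then show ?case by (simp add: rev_shuf_sum_def)
next
  case (snoc b u)
  have "0 = (\<Sum>t\<in>shuf [b # rev u, a # v]. x t)" using snoc.prems by (intro lie[symmetric]) auto
  also have "\<dots> = (\<Sum>t\<in>shuf [rev u, a # v]. x (b # t)) + (\<Sum>t\<in>shuf [b # rev u, v]. x (a # t))"
    using snoc.prems by (intro sum_shuf_pair_front) auto
  finally have "rev_shuf_sum x (u @ [b]) a v = - rev_shuf_sum x u b (a # v)"
    by (simp add: rev_shuf_sum_def eq_neg_iff_add_eq_0 add.commute)
  then show ?case using snoc.IH[of b "a # v"] snoc.prems by simp
qed

text \<open>A shuffle of \<open>rev u\<close> and \<open>v\<close> ends in the last letter of
  \<open>v\<close> or in the first letter of \<open>u\<close>. These are the letters that the two
  terms of \<open>dynkin_op\<close> freeze at the end when the word is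
  \<open>u @ a # v\<close>.\<close>

lemma rev_shuf_sum_step:
  fixes x :: "'b list \<Rightarrow> 'a::comm_ring_1"
  assumes "distinct (u @ a # v)" "u @ v \<noteq> []"
  shows "rev_shuf_sum x u a v =
    (if v = [] then 0 else rev_shuf_sum (\<lambda>t. x (t @ [last v])) u a (butlast v)) +
    (if u = [] then 0 else rev_shuf_sum (\<lambda>t. x (t @ [hd u])) (tl u) a v)"
proof -
  have r: "butlast (rev u) = rev (tl u)" "u \<noteq> [] \<Longrightarrow> last (rev u) = hd u" by (simp_all add: butlast_rev last_rev)
  have "rev_shuf_sum x u a v = (\<Sum>i | i < length [rev u, v] \<and> [rev u, v] ! i \<noteq> [].
     \<Sum>t\<in>shuf ([rev u, v][i := butlast ([rev u, v] ! i)]). x (a # t @ [last ([rev u, v] ! i)]))"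
    unfolding rev_shuf_sum_def by (rule sum_shuf_back) (use assms in auto)
  then show ?thesis using assms r by (auto simp: Collect_less_2_eq rev_shuf_sum_def add.commute)
qed

text \<open>The index i is the position of the letter that comes to stand first after all other
  letters have been frozen at the end. Splitting each shuffle at its last letter reproduces the
  recursion; in the term that freezes the first letter positions drop by one, which accounts for the
  minus sign.\<close>

lemma dynkin_op_eq_sum:
  fixes x :: "'b list \<Rightarrow> 'a::comm_ring_1"
  shows "distinct w \<Longrightarrow> w \<noteq> [] \<Longrightarrow>
    dynkin_op x w = (\<Sum>i<length w. (-1) ^ i * rev_shuf_sum x (take i w) (w ! i) (drop (Suc i) w))"
proof (induction x w rule: dynkin_op.induct)
  case (1 x w)
  show ?case
  proof (cases "length w \<le> 1")
    case True
    then have "length w = 1" using 1(4) by (cases w) auto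
    then obtain a where "w = [a]" by (auto simp: length_Suc_conv)
    then show ?thesis by (simp add: dynkin_op.simps rev_shuf_sum_def shuf_empty)
  next
    case False
    let ?n = "length w - 1"
    have n: "length w = Suc ?n" "?n > 0" using False by auto
    define F where "F = (\<lambda>x i. rev_shuf_sum x (take i w) (w ! i) (drop (Suc i) w))"
    let ?A = "\<lambda>i. (-1) ^ i * rev_shuf_sum (\<lambda>t. x (t @ [last w])) (take i w) (w ! i) (butlast (drop (Suc i) w))"
    let ?B = "\<lambda>i. (-1) ^ i * rev_shuf_sum (\<lambda>t. x (t @ [hd w])) (tl (take i w)) (w ! i) (drop (Suc i) w)"
    have IH1: "dynkin_op (\<lambda>t. x (t @ [last w])) (butlast w) = (\<Sum>i<?n. ?A i)"
    proof -
      have "dynkin_op (\<lambda>t. x (t @ [last w])) (butlast w) = (\<Sum>i<length (butlast w). (-1) ^ i *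
        rev_shuf_sum (\<lambda>t. x (t @ [last w])) (take i (butlast w)) (butlast w ! i) (drop (Suc i) (butlast w)))"
        using 1(3,4) False by (intro 1(1)) (auto simp: distinct_butlast simp flip: length_greater_0_conv)
      also have "\<dots> = (\<Sum>i<?n. ?A i)"
        by (rule sum.cong) (auto simp: nth_butlast take_butlast drop_butlast)
      finally show ?thesis .
    qed
    have IH2: "- dynkin_op (\<lambda>t. x (t @ [hd w])) (tl w) = (\<Sum>i<?n. ?B (Suc i))"
    proof -
      have "dynkin_op (\<lambda>t. x (t @ [hd w])) (tl w) = (\<Sum>i<length (tl w). (-1) ^ i *
        rev_shuf_sum (\<lambda>t. x (t @ [hd w])) (take i (tl w)) (tl w ! i) (drop (Suc i) (tl w)))"
        using 1(3,4) False by (intro 1(2)) (auto simp: distinct_tl simp flip: length_greater_0_conv)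
      also have "- \<dots> = (\<Sum>i<?n. ?B (Suc i))"
        unfolding sum_negf[symmetric]
        by (rule sum.cong) (use 1(4) in \<open>auto simp: nth_tl take_Suc drop_Suc tl_drop\<close>)
      finally show ?thesis .
    qed
    have "(\<Sum>i<length w. (-1) ^ i * rev_shuf_sum x (take i w) (w ! i) (drop (Suc i) w)) =
      (\<Sum>i<length w. (if i < ?n then ?A i else 0) + (if i = 0 then 0 else ?B i))"
    proof (rule sum.cong[OF refl])
      fix i assume "i \<in> {..<length w}"
      then have i: "i < length w" by simp
      have w: "w = take i w @ w ! i # drop (Suc i) w" using i by (rule id_take_nth_drop)
      have 0: "rev_shuf_sum x (take i w) (w ! i) (drop (Suc i) w) =
        (if drop (Suc i) w = [] then 0 else rev_shuf_sum (\<lambda>t. x (t @ [last (drop (Suc i) w)])) (take i w) (w ! i) (butlast (drop (Suc i) w))) +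
        (if take i w = [] then 0 else rev_shuf_sum (\<lambda>t. x (t @ [hd (take i w)])) (tl (take i w)) (w ! i) (drop (Suc i) w))"
      proof (rule rev_shuf_sum_step)
        show "distinct (take i w @ w ! i # drop (Suc i) w)" using w 1(3) by simp
        show "take i w @ drop (Suc i) w \<noteq> []" using i False by auto
      qed
      \<comment> \<open>At \<open>i = ?n\<close> no letter follows and at \<open>i = 0\<close> none
        precedes, so one of the two terms is missing there.\<close>
      have "drop (Suc i) w = [] \<longleftrightarrow> \<not> i < ?n" "drop (Suc i) w \<noteq> [] \<Longrightarrow> last (drop (Suc i) w) = last w"
        "take i w = [] \<longleftrightarrow> i = 0" "i \<noteq> 0 \<Longrightarrow> hd (take i w) = hd w" using 1(4) i by (auto simp: last_drop)
      with 0 show "(-1) ^ i * rev_shuf_sum x (take i w) (w ! i) (drop (Suc i) w) =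
        (if i < ?n then ?A i else 0) + (if i = 0 then 0 else ?B i)" by (simp add: distrib_left)
    qed
    also have "\<dots> = (\<Sum>i<?n. ?A i) + (\<Sum>i<?n. ?B (Suc i))"
    proof -
      have "(\<Sum>i<length w. (if i < ?n then ?A i else 0)) = (\<Sum>i<?n. ?A i)"
        using n(2) by (subst n(1)) simp
      moreover have "(\<Sum>i<length w. (if i = 0 then 0 else ?B i)) = (\<Sum>i<?n. ?B (Suc i))"
        by (subst n(1), subst sum.lessThan_Suc_shift) simp
      ultimately show ?thesis by (simp only: sum.distrib)
    qed
    also have "\<dots> = dynkin_op x w"
      unfolding IH1[symmetric] IH2[symmetric] using False by (subst (3) dynkin_op.simps) simp
    finally show ?thesis by simp
  qed
qed

text \<open>The Dynkin-Specht-Wever identity \<omega>_k \<omega>_k = k \<omega>_k in terms of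
  coefficients. As \<open>lie_coeff\<close> vanishes on shuffles of two non-empty words, each of the
  \<open>length w\<close> summands of the expansion equals \<open>lie_coeff w\<close>.\<close>

lemma dynkin_op_lie_coeff:
  assumes "distinct w" "w \<noteq> []"
  shows "dynkin_op lie_coeff w = of_nat (length w) * (lie_coeff w :: 'a::comm_ring_1)"
proof -
  have lie: "(\<Sum>t\<in>shuf [s, w]. lie_coeff t) = (0 :: 'a)" if "s \<noteq> []" "w \<noteq> []" "distinct (s @ w)" for s w
    by (rule sum_shuf_lie_coeff[of _ 0 1]) (use that in auto)
  have "dynkin_op lie_coeff w = (\<Sum>i<length w. (-1) ^ i * rev_shuf_sum lie_coeff (take i w) (w ! i) (drop (Suc i) w) :: 'a)"
    by (rule dynkin_op_eq_sum[OF assms])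
  also have "\<dots> = (\<Sum>i<length w. lie_coeff w)"
  proof (rule sum.cong[OF refl])
    fix i assume "i \<in> {..<length w}"
    then have i: "i < length w" by simp
    then have w: "w = take i w @ w ! i # drop (Suc i) w" by (rule id_take_nth_drop)
    have "(-1) ^ length (take i w) * rev_shuf_sum lie_coeff (take i w) (w ! i) (drop (Suc i) w) =
      (lie_coeff (take i w @ w ! i # drop (Suc i) w) :: 'a)"
      by (rule rev_shuf_sum_lie[OF lie]) (use w assms in auto)
    then show "(-1) ^ i * rev_shuf_sum lie_coeff (take i w) (w ! i) (drop (Suc i) w) = (lie_coeff w :: 'a)"
      using i w by simp
  qed
  finally show ?thesis by simp
qed

section \<open>The group algebra as functions on words\<close>

lemma finite_perms: "finite (perms n)"
  unfolding perms_def by (rule finite_permutations) simp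

lemma id_perms: "id \<in> perms n"
  by (simp add: perms_def permutes_id)

lemma comp_perms: "\<sigma> \<in> perms n \<Longrightarrow> \<tau> \<in> perms n \<Longrightarrow> \<tau> \<circ> \<sigma> \<in> perms n"
  by (simp add: perms_def permutes_compose)

lemma inv_perms: "\<sigma> \<in> perms n \<Longrightarrow> inv \<sigma> \<in> perms n"
  by (simp add: perms_def permutes_inv)

lemma perms_inv_o: "\<sigma> \<in> perms n \<Longrightarrow> inv \<sigma> \<circ> \<sigma> = id" "\<sigma> \<in> perms n \<Longrightarrow> \<sigma> \<circ> inv \<sigma> = id"
  by (auto simp: perms_def permutes_inv_o)

lemma perms_inv_o_left:
  "\<sigma> \<in> perms n \<Longrightarrow> inv \<sigma> \<circ> (\<sigma> \<circ> f) = f" "\<sigma> \<in> perms n \<Longrightarrow> \<sigma> \<circ> (inv \<sigma> \<circ> f) = f"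
  "\<sigma> \<in> perms n \<Longrightarrow> (f \<circ> inv \<sigma>) \<circ> \<sigma> = f" "\<sigma> \<in> perms n \<Longrightarrow> (f \<circ> \<sigma>) \<circ> inv \<sigma> = f"
  using perms_inv_o by (metis comp_assoc comp_id id_comp)+

lemma gmul_apply:
  assumes "\<pi> \<in> perms n"
  shows "gmul n x y \<pi> = (\<Sum>\<tau>\<in>perms n. x (inv \<tau> \<circ> \<pi>) * y \<tau>)"
proof -
  have "gmul n x y \<pi> = (\<Sum>\<tau>\<in>perms n. \<Sum>\<sigma>\<in>perms n. if \<tau> \<circ> \<sigma> = \<pi> then x \<sigma> * y \<tau> else 0)"
    unfolding gmul_def by (rule sum.swap)
  also have "\<dots> = (\<Sum>\<tau>\<in>perms n. \<Sum>\<sigma>\<in>perms n. if \<sigma> = inv \<tau> \<circ> \<pi> then x \<sigma> * y \<tau> else 0)"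
  proof (intro sum.cong refl)
    fix \<tau> \<sigma> assume "\<tau> \<in> perms n" "\<sigma> \<in> perms n"
    then have "\<tau> \<circ> \<sigma> = \<pi> \<longleftrightarrow> \<sigma> = inv \<tau> \<circ> \<pi>" using perms_inv_o_left by metis
    then show "(if \<tau> \<circ> \<sigma> = \<pi> then x \<sigma> * y \<tau> else 0) = (if \<sigma> = inv \<tau> \<circ> \<pi> then x \<sigma> * y \<tau> else 0)" by simp
  qed
  also have "\<dots> = (\<Sum>\<tau>\<in>perms n. x (inv \<tau> \<circ> \<pi>) * y \<tau>)"
    by (intro sum.cong refl) (simp add: finite_perms comp_perms inv_perms assms)
  finally show ?thesis .
qed

text \<open>A left factor acts through \<open>\<pi> \<circ> inv \<sigma>\<close>: it permutes the
  positions of the word of \<pi> and keeps its letters. Left multiplication is therefore an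
  operation on functions of words.\<close>

lemma gmul_apply':
  assumes "\<pi> \<in> perms n"
  shows "gmul n x y \<pi> = (\<Sum>\<sigma>\<in>perms n. x \<sigma> * y (\<pi> \<circ> inv \<sigma>))"
proof -
  have "gmul n x y \<pi> = (\<Sum>\<sigma>\<in>perms n. \<Sum>\<tau>\<in>perms n. if \<tau> = \<pi> \<circ> inv \<sigma> then x \<sigma> * y \<tau> else 0)"
    unfolding gmul_def
  proof (intro sum.cong refl)
    fix \<tau> \<sigma> assume "\<tau> \<in> perms n" "\<sigma> \<in> perms n"
    then have "\<tau> \<circ> \<sigma> = \<pi> \<longleftrightarrow> \<tau> = \<pi> \<circ> inv \<sigma>" using perms_inv_o_left by metis
    then show "(if \<tau> \<circ> \<sigma> = \<pi> then x \<sigma> * y \<tau> else 0) = (if \<tau> = \<pi> \<circ> inv \<sigma> then x \<sigma> * y \<tau> else 0)" by simp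
  qed
  also have "\<dots> = (\<Sum>\<sigma>\<in>perms n. x \<sigma> * y (\<pi> \<circ> inv \<sigma>))"
    by (intro sum.cong refl) (simp add: finite_perms comp_perms inv_perms assms)
  finally show ?thesis .
qed

lemma gmul_outside: "\<pi> \<notin> perms n \<Longrightarrow> gmul n x y \<pi> = 0"
  unfolding gmul_def by (intro sum.neutral ballI) (auto simp: comp_perms)

lemma gmul_galg: "gmul n x y \<in> galg n"
  by (simp add: galg_def gmul_outside)

lemma gmul_eqI:
  "(\<And>\<pi>. \<pi> \<in> perms n \<Longrightarrow> gmul n x y \<pi> = z \<pi>) \<Longrightarrow> z \<in> galg n \<Longrightarrow> gmul n x y = z"
  by (rule ext) (metis (mono_tags, lifting) galg_def gmul_outside mem_Collect_eq)

lemma gmul_assoc: "gmul n (gmul n x y) z = gmul n x (gmul n y z)"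
proof (rule gmul_eqI)
  fix \<pi> assume \<pi>: "\<pi> \<in> perms n"
  have "gmul n (gmul n x y) z \<pi> = (\<Sum>\<tau>\<in>perms n. (\<Sum>\<sigma>\<in>perms n. x \<sigma> * y ((inv \<tau> \<circ> \<pi>) \<circ> inv \<sigma>)) * z \<tau>)"
    unfolding gmul_apply[OF \<pi>]
  proof (rule sum.cong[OF refl])
    fix \<tau> assume "\<tau> \<in> perms n"
    then have "inv \<tau> \<circ> \<pi> \<in> perms n" by (simp add: comp_perms inv_perms \<pi>)
    then show "gmul n x y (inv \<tau> \<circ> \<pi>) * z \<tau> = (\<Sum>\<sigma>\<in>perms n. x \<sigma> * y ((inv \<tau> \<circ> \<pi>) \<circ> inv \<sigma>)) * z \<tau>"
      by (simp only: gmul_apply')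
  qed
  also have "\<dots> = (\<Sum>\<sigma>\<in>perms n. \<Sum>\<tau>\<in>perms n. x \<sigma> * y (inv \<tau> \<circ> \<pi> \<circ> inv \<sigma>) * z \<tau>)"
    by (subst sum.swap) (simp add: sum_distrib_right)
  also have "\<dots> = (\<Sum>\<sigma>\<in>perms n. x \<sigma> * (\<Sum>\<tau>\<in>perms n. y (inv \<tau> \<circ> (\<pi> \<circ> inv \<sigma>)) * z \<tau>))"
    by (simp add: sum_distrib_left mult.assoc comp_assoc)
  also have "\<dots> = (\<Sum>\<sigma>\<in>perms n. x \<sigma> * gmul n y z (\<pi> \<circ> inv \<sigma>))"
  proof (rule sum.cong[OF refl])
    fix \<sigma> assume "\<sigma> \<in> perms n"
    then have "\<pi> \<circ> inv \<sigma> \<in> perms n" by (simp add: comp_perms inv_perms \<pi>)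
    then show "x \<sigma> * (\<Sum>\<tau>\<in>perms n. y (inv \<tau> \<circ> (\<pi> \<circ> inv \<sigma>)) * z \<tau>) = x \<sigma> * gmul n y z (\<pi> \<circ> inv \<sigma>)"
      by (simp only: gmul_apply)
  qed
  also have "\<dots> = gmul n x (gmul n y z) \<pi>" by (rule gmul_apply'[OF \<pi>, symmetric])
  finally show "gmul n (gmul n x y) z \<pi> = gmul n x (gmul n y z) \<pi>" .
qed (rule gmul_galg)

lemma galg_add: "x \<in> galg n \<Longrightarrow> y \<in> galg n \<Longrightarrow> x + y \<in> galg n" for x y :: "'a::comm_ring_1 grp"
  by (simp add: galg_def)

lemma galg_diff: "x \<in> galg n \<Longrightarrow> y \<in> galg n \<Longrightarrow> x - y \<in> galg (n::nat)" for x y :: "'a::comm_ring_1 grp"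
  by (simp add: galg_def)

lemma galg_zero: "0 \<in> galg n"
  by (simp add: galg_def)

lemma galg_gsc: "x \<in> galg n \<Longrightarrow> gsc c x \<in> galg n"
  by (simp add: galg_def gsc_def)

lemma galg_gbas: "\<sigma> \<in> perms n \<Longrightarrow> gbas \<sigma> \<in> galg n"
  by (auto simp: galg_def gbas_def)

lemma gmul_linear_simps:
  "gmul n (x + x') y = gmul n x y + gmul n x' y"
  "gmul n x (y + y') = gmul n x y + gmul n x y'"
  "gmul n (x - x') y = gmul n x y - gmul n x' y"
  "gmul n x (y - y') = gmul n x y - gmul n x y'"
  "gmul n (gsc c x) y = gsc c (gmul n x y)"
  "gmul n x (gsc c y) = gsc c (gmul n x y)"
  "gmul n 0 y = 0" "gmul n x 0 = 0"
proof -
  have *: "(\<And>\<pi>. \<pi> \<in> perms n \<Longrightarrow> gmul n x y \<pi> = z \<pi>) \<Longrightarrow> z \<in> galg n \<Longrightarrow> gmul n x y = z" for x y z :: "'a grp"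
    by (rule gmul_eqI)
  show "gmul n (x + x') y = gmul n x y + gmul n x' y"
    by (rule *) (auto simp: gmul_apply gmul_galg galg_add distrib_right sum.distrib)
  show "gmul n x (y + y') = gmul n x y + gmul n x y'"
    by (rule *) (auto simp: gmul_apply gmul_galg galg_add distrib_left sum.distrib)
  show "gmul n (x - x') y = gmul n x y - gmul n x' y"
    by (rule *) (auto simp: gmul_apply gmul_galg galg_diff left_diff_distrib sum_subtractf)
  show "gmul n x (y - y') = gmul n x y - gmul n x y'"
    by (rule *) (auto simp: gmul_apply gmul_galg galg_diff right_diff_distrib sum_subtractf)
  show "gmul n (gsc c x) y = gsc c (gmul n x y)"
    by (rule *) (auto simp: gmul_apply gmul_galg galg_gsc, auto simp: gsc_def gmul_apply sum_distrib_left mult.assoc)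
  show "gmul n x (gsc c y) = gsc c (gmul n x y)"
    by (rule *) (auto simp: gmul_apply gmul_galg galg_gsc, auto simp: gsc_def gmul_apply sum_distrib_left mult_ac)
  show "gmul n 0 y = 0" "gmul n x 0 = 0"
    by (rule *; auto simp: gmul_apply galg_zero)+
qed

lemma gmul_sum_left: "gmul n (\<Sum>i\<in>I. f i) y = (\<Sum>i\<in>I. gmul n (f i) y)"
  by (induction I rule: infinite_finite_induct)
    (simp_all only: gmul_linear_simps sum.infinite sum.empty sum.insert if_False not_False_eq_True)

lemma gmul_sum_right: "gmul n x (\<Sum>i\<in>I. f i) = (\<Sum>i\<in>I. gmul n x (f i))"
  by (induction I rule: infinite_finite_induct)
    (simp_all only: gmul_linear_simps sum.infinite sum.empty sum.insert if_False not_False_eq_True)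

lemma gmul_gbas_apply:
  assumes "\<sigma> \<in> perms n" "\<pi> \<in> perms n"
  shows "gmul n (gbas \<sigma>) y \<pi> = y (\<pi> \<circ> inv \<sigma>)"
proof -
  have "gmul n (gbas \<sigma>) y \<pi> = (\<Sum>\<rho>\<in>perms n. if \<rho> = \<sigma> then y (\<pi> \<circ> inv \<sigma>) else 0)"
    unfolding gmul_apply'[OF assms(2)] by (intro sum.cong) (auto simp: gbas_def)
  then show ?thesis using assms finite_perms by simp
qed

lemma gmul_gone_left: "x \<in> galg n \<Longrightarrow> gmul n gone x = x"
  by (rule gmul_eqI) (auto simp: gone_def gmul_gbas_apply id_perms)

section \<open>Words of permutations and left multiplication by \<Xi>\<close>

definition word :: "nat \<Rightarrow> (nat \<Rightarrow> nat) \<Rightarrow> nat list" where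
  "word n \<pi> = map \<pi> [1..<Suc n]"

definition words :: "nat \<Rightarrow> nat list set" where
  "words n = {w. distinct w \<and> set w = {1..n}}"

definition on_words :: "nat \<Rightarrow> (nat list \<Rightarrow> 'a::comm_ring_1) \<Rightarrow> 'a grp" where
  "on_words n f = (\<lambda>\<pi>. if \<pi> \<in> perms n then f (word n \<pi>) else 0)"

lemma word_nth: "i < n \<Longrightarrow> word n \<pi> ! i = \<pi> (Suc i)"
  by (simp add: word_def del: upt_Suc)

lemma length_word: "length (word n \<pi>) = n"
  by (simp add: word_def)

lemma set_upt_Suc: "set [1..<Suc n] = {1..n}" by auto

lemma word_mem_words: "\<pi> \<in> perms n \<Longrightarrow> word n \<pi> \<in> words n"
  unfolding words_def word_def perms_def mem_Collect_eq set_map distinct_map set_upt_Suc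
  by (simp only: permutes_image permutes_inj_on distinct_upt simp_thms)

lemma words_length: "w \<in> words n \<Longrightarrow> length w = n"
  using distinct_card[of w] by (simp add: words_def)

lemma bij_betw_word: "bij_betw (word n) (perms n) (words n)"
proof (rule bij_betwI')
  fix \<pi> \<rho> assume h: "\<pi> \<in> perms n" "\<rho> \<in> perms n"
  show "word n \<pi> = word n \<rho> \<longleftrightarrow> \<pi> = \<rho>"
  proof
    assume eq: "word n \<pi> = word n \<rho>"
    show "\<pi> = \<rho>"
    proof
      fix i
      show "\<pi> i = \<rho> i"
      proof (cases "i \<in> {1..n}")
        case True
        then show ?thesis using eq unfolding word_def map_eq_conv set_upt_Suc by blast
      next
        case False
        then show ?thesis using h unfolding perms_def by (metis mem_Collect_eq permutes_not_in)
      qed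
    qed
  qed simp
next
  fix w assume w: "w \<in> words n"
  let ?p = "\<lambda>i. if i \<in> {1..n} then w ! (i - 1) else i"
  have l: "length w = n" by (rule words_length[OF w])
  have dw: "distinct w" "set w = {1..n}" using w by (auto simp: words_def)
  have inj: "inj_on ?p {1..n}"
    using dw(1) l by (auto simp: inj_on_def nth_eq_iff_index_eq)
  have "?p ` {1..n} \<subseteq> {1..n}"
  proof
    fix x assume "x \<in> ?p ` {1..n}"
    then obtain i where "i \<in> {1..n}" "x = w ! (i - 1)" by auto
    then have "x \<in> set w" using l by auto
    then show "x \<in> {1..n}" using dw by simp
  qed
  then have "bij_betw ?p {1..n} {1..n}"
    using inj endo_inj_surj[of "{1..n}" ?p] unfolding bij_betw_def by blast
  then have "?p permutes {1..n}" by (rule bij_imp_permutes) auto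
  moreover have "w = word n ?p" using l by (intro nth_equalityI) (auto simp: word_nth length_word)
  ultimately show "\<exists>\<pi>\<in>perms n. w = word n \<pi>" by (auto simp: perms_def)
qed (rule word_mem_words)

lemma on_words_galg: "on_words n f \<in> galg n"
  by (simp add: on_words_def galg_def)

lemma on_words_cong: "(\<And>w. w \<in> words n \<Longrightarrow> f w = g w) \<Longrightarrow> on_words n f = on_words n g"
  by (auto simp: on_words_def word_mem_words)

lemma gmul_on_words_eqI:
  assumes "\<And>\<pi>. \<pi> \<in> perms n \<Longrightarrow> gmul n x y \<pi> = f (word n \<pi>)"
  shows "gmul n x y = on_words n f"
  by (rule gmul_eqI) (auto simp: assms on_words_galg, simp add: on_words_def)

lemma psum_Cons: "psum (a # q) ` {1..length (a # q)} = insert a ((+) a ` psum q ` {1..length q})"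
proof -
  have "{1..length (a # q)} = insert 1 (Suc ` {1..length q})"
    by (auto simp: image_iff)
  moreover have "psum (a # q) (Suc j) = a + psum q j" "psum (a # q) 1 = a" for j by (simp_all add: psum_def)
  ultimately show ?thesis by (simp only: image_insert image_image)
qed

text \<open>A zero-based index \<open>i\<close> with \<open>w ! i < w ! (i - 1)\<close> is the
  one-based position of a descent, so the right-hand side matches the condition in
  \<open>Xi\<close>.\<close>

lemma chunks_sorted_iff:
  fixes w :: "nat list"
  assumes "distinct w" "length w = sum_list q"
  shows "(\<forall>u\<in>set (chunks q w). sorted u) \<longleftrightarrow>
    {i. 0 < i \<and> i < length w \<and> w ! i < w ! (i - 1)} \<subseteq> psum q ` {1..length q}"
  using assms
proof (induction q arbitrary: w)
  case (Cons a q)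
  let ?D = "\<lambda>w. {i. 0 < i \<and> i < length w \<and> w ! i < w ! (i - 1)}"
  let ?P = "psum q ` {1..length q}"
  have a: "a \<le> length w" using Cons.prems by simp
  have "sorted (take a w) \<longleftrightarrow> (\<forall>i\<in>?D w. \<not> i < a)"
  proof -
    have "sorted (take a w) \<longleftrightarrow> (\<forall>i. Suc i < a \<longrightarrow> w ! i < w ! Suc i)"
      using sorted_distinct_iff_nth_Suc[of "take a w"] Cons.prems(1) a by simp
    also have "\<dots> \<longleftrightarrow> (\<forall>i. Suc i < a \<longrightarrow> \<not> w ! Suc i < w ! i)"
    proof -
      have "w ! i \<noteq> w ! Suc i" if "Suc i < a" for i
        using that a Cons.prems(1) by (simp add: nth_eq_iff_index_eq)
      then show ?thesis by (meson linorder_neqE_nat not_less_iff_gr_or_eq)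
    qed
    also have "\<dots> \<longleftrightarrow> (\<forall>i\<in>?D w. \<not> i < a)"
    proof
      assume h: "\<forall>i. Suc i < a \<longrightarrow> \<not> w ! Suc i < w ! i"
      show "\<forall>i\<in>?D w. \<not> i < a"
      proof (intro ballI notI)
        fix i assume "i \<in> ?D w" "i < a"
        then show False using h[rule_format, of "i - 1"] by simp
      qed
    next
      assume h: "\<forall>i\<in>?D w. \<not> i < a"
      show "\<forall>i. Suc i < a \<longrightarrow> \<not> w ! Suc i < w ! i"
      proof (intro allI impI notI)
        fix i assume "Suc i < a" "w ! Suc i < w ! i"
        then show False using h[rule_format, of "Suc i"] a by simp
      qed
    qed
    finally show ?thesis .
  qed
  moreover have "(\<forall>u\<in>set (chunks q (drop a w)). sorted u) \<longleftrightarrow> ?D (drop a w) \<subseteq> ?P"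
    using Cons.prems by (intro Cons.IH) auto
  moreover have "?D (drop a w) = {i. 0 < i \<and> a + i \<in> ?D w}"
    using a by (auto simp: nth_append)
  \<comment> \<open>Descents inside the first block are excluded, one at its end is free, and later
    ones are shifted by \<open>a\<close>.\<close>
  moreover have "(\<forall>i\<in>?D w. \<not> i < a) \<and> {i. 0 < i \<and> a + i \<in> ?D w} \<subseteq> ?P \<longleftrightarrow> ?D w \<subseteq> insert a ((+) a ` ?P)"
  proof
    assume h: "(\<forall>i\<in>?D w. \<not> i < a) \<and> {i. 0 < i \<and> a + i \<in> ?D w} \<subseteq> ?P"
    show "?D w \<subseteq> insert a ((+) a ` ?P)"
    proof
      fix i assume i: "i \<in> ?D w"
      then have "i = a \<or> (0 < i - a \<and> i = a + (i - a))" using h by (metis linorder_neqE_nat le_add_diff_inverse less_imp_le_nat zero_less_diff)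
      then show "i \<in> insert a ((+) a ` ?P)"
      proof
        assume "0 < i - a \<and> i = a + (i - a)"
        then have "0 < i - a" "a + (i - a) \<in> ?D w" "i = a + (i - a)" using i by simp_all
        then have "i - a \<in> ?P" using h by blast
        then show ?thesis using \<open>i = a + (i - a)\<close> by blast
      qed simp
    qed
  next
    assume h: "?D w \<subseteq> insert a ((+) a ` ?P)"
    have "\<not> i < a" if "i \<in> ?D w" for i
    proof -
      have "i \<in> insert a ((+) a ` ?P)" using h that by blast
      then show ?thesis by auto
    qed
    moreover have "i \<in> ?P" if "0 < i" "a + i \<in> ?D w" for i
    proof -
      have "a + i \<in> insert a ((+) a ` ?P)" using h that by blast
      then show ?thesis using that(1) by auto
    qed
    ultimately show "(\<forall>i\<in>?D w. \<not> i < a) \<and> {i. 0 < i \<and> a + i \<in> ?D w} \<subseteq> ?P" by blast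
  qed
  ultimately show ?case unfolding psum_Cons chunks.simps list.set(2) ball_simps(7) by (simp only:)
qed simp

lemma block_prod_sorted_ind:
  "block_prod sorted_ind q w = (if \<forall>u\<in>set (chunks q w). sorted u then 1 else 0)"
  by (induction q arbitrary: w) (auto simp: sorted_ind_def)

lemma Xi_eq_on_words:
  assumes "is_comp n q"
  shows "Xi n q = on_words n (block_prod sorted_ind q)"
proof
  fix \<pi>
  show "Xi n q \<pi> = on_words n (block_prod sorted_ind q) \<pi>"
  proof (cases "\<pi> \<in> perms n")
    case True
    have w: "word n \<pi> \<in> words n" using True by (rule word_mem_words)
    have "descents n \<pi> = {i. 0 < i \<and> i < length (word n \<pi>) \<and> word n \<pi> ! i < word n \<pi> ! (i - 1)}"
      by (auto simp: descents_def length_word word_nth)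
    moreover have "{psum q j | j. 1 \<le> j \<and> j \<le> length q} = psum q ` {1..length q}" by auto
    moreover have "(\<forall>u\<in>set (chunks q (word n \<pi>)). sorted u) \<longleftrightarrow>
        {i. 0 < i \<and> i < length (word n \<pi>) \<and> word n \<pi> ! i < word n \<pi> ! (i - 1)} \<subseteq> psum q ` {1..length q}"
      by (rule chunks_sorted_iff) (use w assms in \<open>auto simp: words_def is_comp_def length_word\<close>)
    ultimately have "descents n \<pi> \<subseteq> {psum q j | j. 1 \<le> j \<and> j \<le> length q} \<longleftrightarrow> (\<forall>u\<in>set (chunks q (word n \<pi>)). sorted u)"
      by (simp only:)
    then show ?thesis using True unfolding Xi_def on_words_def block_prod_sorted_ind by (simp only: simp_thms if_True)
  qed (simp add: Xi_def on_words_def)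
qed

lemma chunks_map: "chunks q (map f w) = map (map f) (chunks q w)"
  by (induction q arbitrary: w) (auto simp: take_map drop_map)

text \<open>The word \<open>map (inv \<tau>) u\<close> lists the positions of the letters of
  \<open>u\<close> in the word of \<tau>; these increase exactly when the letters stand there in the
  order of \<open>u\<close>.\<close>

lemma sorted_map_inv_iff:
  assumes \<tau>: "\<tau> \<in> perms n" and u: "distinct u" "set u \<subseteq> {1..n}"
  shows "sorted (map (inv \<tau>) u) \<longleftrightarrow> filter (\<lambda>a. a \<in> set u) (word n \<tau>) = u"
proof -
  let ?v = "filter (\<lambda>a. a \<in> set u) (word n \<tau>)"
  have w: "distinct (word n \<tau>)" "set (word n \<tau>) = {1..n}" using word_mem_words[OF \<tau>] by (auto simp: words_def)
  have inj: "inj (inv \<tau>)" using \<tau> permutes_inj[OF permutes_inv] unfolding perms_def by blast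
  have "map (inv \<tau>) (word n \<tau>) = map (inv \<tau> \<circ> \<tau>) [1..<Suc n]" by (simp add: word_def del: upt_Suc)
  then have "map (inv \<tau>) (word n \<tau>) = [1..<Suc n]" by (simp only: perms_inv_o[OF \<tau>] list.map_id)
  then have "sorted (map (inv \<tau>) (word n \<tau>))" by (simp only: sorted_upt)
  then have sv: "sorted (map (inv \<tau>) ?v)" by (rule sorted_filter)
  show ?thesis
  proof
    assume "sorted (map (inv \<tau>) u)"
    then have "map (inv \<tau>) ?v = map (inv \<tau>) u"
      using sv w u inj by (intro sorted_distinct_set_unique) (auto simp: distinct_map inj_on_def inj_def)
    then show "?v = u" using inj by (simp add: inj_map_eq_map)
  next
    assume "?v = u" then show "sorted (map (inv \<tau>) u)" using sv by simp
  qed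
qed

text \<open>The coefficient at \<pi> collects \<open>f (word n \<tau>)\<close> over those \<tau> for
  which \<open>inv \<tau> \<circ> \<pi>\<close> increases on every block. Its values are the
  positions in the word of \<tau> of the letters of the word of \<pi>, so the condition says that
  the word of \<tau> shuffles the blocks of \<pi>.\<close>

lemma gmul_Xi_on_words:
  assumes q: "is_comp n r"
  shows "gmul n (Xi n r) (on_words n f) = on_words n (\<lambda>w. \<Sum>t\<in>shuf (chunks r w). f t)"
proof (rule gmul_on_words_eqI)
  fix \<pi> assume \<pi>: "\<pi> \<in> perms n"
  let ?w = "word n \<pi>"
  have w: "distinct ?w" "set ?w = {1..n}" "length ?w = n"
    using word_mem_words[OF \<pi>] by (auto simp: words_def length_word)
  have cc: "concat (chunks r ?w) = ?w" using q w by (simp add: concat_chunks is_comp_def)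
  have sub: "shuf (chunks r ?w) \<subseteq> words n" unfolding shuf_def words_def cc using w by auto
  have Xi: "Xi n r (inv \<tau> \<circ> \<pi>) = (if word n \<tau> \<in> shuf (chunks r ?w) then 1 else 0 :: 'a)" if \<tau>: "\<tau> \<in> perms n" for \<tau>
  proof -
    have p: "inv \<tau> \<circ> \<pi> \<in> perms n" using \<tau> \<pi> by (simp add: comp_perms inv_perms)
    have "word n (inv \<tau> \<circ> \<pi>) = map (inv \<tau>) ?w" by (simp add: word_def del: upt_Suc)
    then have "Xi n r (inv \<tau> \<circ> \<pi>) = (if \<forall>u\<in>set (chunks r ?w). sorted (map (inv \<tau>) u) then 1 else 0 :: 'a)"
      using p unfolding Xi_eq_on_words[OF q] on_words_def block_prod_sorted_ind by (simp add: chunks_map)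
    moreover have "sorted (map (inv \<tau>) u) \<longleftrightarrow> filter (\<lambda>a. a \<in> set u) (word n \<tau>) = u" if u: "u \<in> set (chunks r ?w)" for u
    proof (rule sorted_map_inv_iff[OF \<tau>])
      have "distinct (concat (chunks r ?w))" using cc w by simp
      then show "distinct u" using u by (simp add: distinct_concat_iff)
      have "set u \<subseteq> set (concat (chunks r ?w))" using u by auto
      then show "set u \<subseteq> {1..n}" using cc w by simp
    qed
    moreover have "distinct (word n \<tau>) \<and> set (word n \<tau>) = set (concat (chunks r ?w))"
      using word_mem_words[OF \<tau>] w cc by (simp add: words_def)
    ultimately show ?thesis unfolding shuf_def by simp
  qed
  have "gmul n (Xi n r) (on_words n f) \<pi> =
     (\<Sum>\<tau>\<in>perms n. if word n \<tau> \<in> shuf (chunks r ?w) then f (word n \<tau>) else 0)"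
    unfolding gmul_apply[OF \<pi>] by (intro sum.cong refl) (simp add: Xi on_words_def)
  also have "\<dots> = (\<Sum>t\<in>words n. if t \<in> shuf (chunks r ?w) then f t else 0)"
    by (rule sum.reindex_bij_betw[OF bij_betw_word])
  also have "\<dots> = (\<Sum>t\<in>shuf (chunks r ?w). f t)"
    using sub bij_betw_finite[OF bij_betw_word[of n]] finite_perms by (simp add: sum.If_cases Int_absorb1)
  finally show "gmul n (Xi n r) (on_words n f) \<pi> = (\<Sum>t\<in>shuf (chunks r ?w). f t)" .
qed

section \<open>The elements omega\<close>

lemma words_distinct: "w \<in> words n \<Longrightarrow> distinct w"
  by (simp add: words_def)

lemma cyc_inverse:
  fixes r i :: nat
  defines "d \<equiv> (\<lambda>k. if k = r + i then r + 1 else if r + 1 \<le> k \<and> k < r + i then k + 1 else k)"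
  assumes "1 \<le> i" "r + i \<le> n"
  shows "cyc r i \<in> perms n" "inv (cyc r i) = d"
proof -
  have 1: "cyc r i \<circ> d = id" using assms(2) by (auto simp: fun_eq_iff cyc_def d_def)
  have 2: "d \<circ> cyc r i = id" using assms(2) by (auto simp: fun_eq_iff cyc_def d_def)
  have "bij (cyc r i)" using 2 1 by (rule o_bij)
  then show "cyc r i \<in> perms n" unfolding perms_def permutes_def mem_Collect_eq bij_iff
    using assms(2,3) by (auto simp: cyc_def)
  show "inv (cyc r i) = d" using 1 2 by (rule inv_unique_comp)
qed

text \<open>The inverse cycle sends the last position of the block to its first and raises the other
  positions by one, so the first letter of the block turns up at its end.\<close>

lemma word_comp_inv_cyc:
  assumes "1 \<le> i" "r + i \<le> n" and b: "b = take i (drop r (word n \<pi>))"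
  shows "word n (\<pi> \<circ> inv (cyc r i)) = take r (word n \<pi>) @ tl b @ hd b # drop (r + i) (word n \<pi>)"
proof (rule nth_equalityI)
  have lb: "length b = i" using assms by (simp add: length_word)
  then have bne: "b \<noteq> []" using assms by auto
  show "length (word n (\<pi> \<circ> inv (cyc r i))) = length (take r (word n \<pi>) @ tl b @ hd b # drop (r + i) (word n \<pi>))"
    using assms lb by (simp add: length_word)
  fix k assume "k < length (word n (\<pi> \<circ> inv (cyc r i)))"
  then have k: "k < n" by (simp add: length_word)
  have bn: "b ! l = \<pi> (Suc (r + l))" if "l < i" for l using that assms by (simp add: length_word word_nth)
  note inv = cyc_inverse(2)[OF assms(1,2)]
  consider "k < r" | "r \<le> k" "Suc k < r + i" | "Suc k = r + i" | "r + i \<le> k" by linarith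
  then show "word n (\<pi> \<circ> inv (cyc r i)) ! k = (take r (word n \<pi>) @ tl b @ hd b # drop (r + i) (word n \<pi>)) ! k"
  proof cases
    case 1
    then show ?thesis unfolding inv using k assms by (simp add: nth_append length_word word_nth)
  next
    case 2
    then have "k - r < i - 1" by linarith
    then have "(take r (word n \<pi>) @ tl b @ hd b # drop (r + i) (word n \<pi>)) ! k = b ! Suc (k - r)"
      using 2 k assms(1,2) lb bne by (simp add: nth_append length_word nth_tl)
    also have "\<dots> = \<pi> (Suc (Suc k))" using 2 bn[of "Suc (k - r)"] by simp
    finally show ?thesis unfolding inv using 2 k by (simp add: word_nth)
  next
    case 3
    then have "\<not> k - r < i - 1" "k - r = i - 1" "r \<le> k" using assms(1) by linarith+
    then have "(take r (word n \<pi>) @ tl b @ hd b # drop (r + i) (word n \<pi>)) ! k = hd b"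
      using k assms(1,2) lb bne by (simp add: nth_append length_word)
    also have "\<dots> = \<pi> (Suc r)" using bn[of 0] assms(1) bne by (simp add: hd_conv_nth)
    finally show ?thesis unfolding inv using 3 k by (simp add: word_nth)
  next
    case 4
    then have "\<not> k - r < i - 1" "k - r - (i - 1) = Suc (k - (r + i))" "r \<le> k" using assms(1) by linarith+
    then have "(take r (word n \<pi>) @ tl b @ hd b # drop (r + i) (word n \<pi>)) ! k = word n \<pi> ! k"
      using k assms(1,2) lb bne 4 by (simp add: nth_append length_word)
    then show ?thesis unfolding inv using 4 k by (simp add: word_nth)
  qed
qed

lemma gmul_one_minus_cyc:
  assumes "1 \<le> i" "r + i \<le> n"
  shows "gmul n (gone - gbas (cyc r i)) (on_words n f) = on_words n (\<lambda>w. f w -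
    f (take r w @ tl (take i (drop r w)) @ hd (take i (drop r w)) # drop (r + i) w))"
proof (rule gmul_on_words_eqI)
  fix \<pi> assume \<pi>: "\<pi> \<in> perms n"
  have c: "cyc r i \<in> perms n" by (rule cyc_inverse(1)[OF assms])
  have "gmul n (gone - gbas (cyc r i)) (on_words n f) \<pi> = on_words n f \<pi> - on_words n f (\<pi> \<circ> inv (cyc r i))"
    using \<pi> c by (simp add: gmul_linear_simps gmul_gone_left on_words_galg gmul_gbas_apply)
  also have "\<dots> = f (word n \<pi>) - f (word n (\<pi> \<circ> inv (cyc r i)))"
    using \<pi> c comp_perms[OF inv_perms[OF c] \<pi>] by (simp add: on_words_def)
  finally show "gmul n (gone - gbas (cyc r i)) (on_words n f) \<pi> = f (word n \<pi>) -
    f (take r (word n \<pi>) @ tl (take i (drop r (word n \<pi>))) @ hd (take i (drop r (word n \<pi>))) # drop (r + i) (word n \<pi>))"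
    using word_comp_inv_cyc[OF assms refl, of \<pi>] by simp
qed

text \<open>The leftmost factor 1 - c_j is applied after the others: it compares the block with the
  block whose first letter has been moved to the end, and the remaining factors act on the first j -
  1 letters. This is the recursion of \<open>dynkin_op\<close>.\<close>

lemma gmul_omega_shift:
  fixes f :: "nat list \<Rightarrow> 'a::comm_ring_1"
  assumes "r + j \<le> n"
  shows "gmul n (omega_shift n r j) (on_words n f) =
    on_words n (\<lambda>w. dynkin_op (\<lambda>t. f (take r w @ t @ drop (r + j) w)) (take j (drop r w)))"
  using assms
proof (induction j)
  \<comment> \<open>For \<open>j \<le> 1\<close> the product has no factors, and
    \<open>dynkin_op\<close> stops.\<close>
  have base: "gmul n (omega_shift n r j) (on_words n f) =
    on_words n (\<lambda>w. dynkin_op (\<lambda>t. f (take r w @ t @ drop (r + j) w)) (take j (drop r w)))"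
    if "j \<le> 1" "r + j \<le> n" for j
  proof -
    have "omega_shift n r j = (gone :: 'a grp)" using that by (simp add: omega_shift_def gprod_def)
    moreover have "dynkin_op (\<lambda>t. f (take r w @ t @ drop (r + j) w)) (take j (drop r w)) = f w" for w
    proof -
      have "length (take j (drop r w)) \<le> 1" using that by simp
      moreover have "take r w @ take j (drop r w) @ drop (r + j) w = w"
        by (metis append_take_drop_id append.assoc take_add)
      ultimately show ?thesis by (simp add: dynkin_op.simps)
    qed
    ultimately show ?thesis by (simp add: gmul_gone_left on_words_galg)
  qed
  {
    case 0
    then show ?case using base[of 0] by simp
  next
    case (Suc j)
    show ?case
    proof (cases "j = 0")
      case True
      then show ?thesis using base[of "Suc j"] Suc.prems by simp
    next
      case False
      let ?h = "\<lambda>w. dynkin_op (\<lambda>t. f (take r w @ t @ drop (r + j) w)) (take j (drop r w))"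
      have "rev [2..<Suc (Suc j)] = Suc j # rev [2..<Suc j]" using False by simp
      then have "omega_shift n r (Suc j) = gmul n (gone - gbas (cyc r (Suc j))) (omega_shift n r j :: 'a grp)"
        unfolding omega_shift_def gprod_def by simp
      then have "gmul n (omega_shift n r (Suc j)) (on_words n f) =
          gmul n (gone - gbas (cyc r (Suc j))) (on_words n ?h)"
        using Suc by (simp add: gmul_assoc)
      also have "\<dots> = on_words n (\<lambda>w. ?h w - ?h (take r w @ tl (take (Suc j) (drop r w)) @
          hd (take (Suc j) (drop r w)) # drop (r + Suc j) w))"
        using Suc.prems by (intro gmul_one_minus_cyc) auto
      also have "\<dots> = on_words n (\<lambda>w. dynkin_op (\<lambda>t. f (take r w @ t @ drop (r + Suc j) w)) (take (Suc j) (drop r w)))"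
      proof (rule on_words_cong)
        fix w assume "w \<in> words n"
        then have lw: "length w = n" by (rule words_length)
        define b where "b = take (Suc j) (drop r w)"
        define z where "z = drop (r + Suc j) w"
        have lb: "length b = Suc j" using Suc.prems lw by (simp add: b_def)
        then have bne: "b \<noteq> []" by auto
        have w: "w = take r w @ b @ z" unfolding b_def z_def
          by (metis append_take_drop_id append.assoc take_add)
        have lr: "length (take r w) = r" using Suc.prems lw by simp
        have b': "b = butlast b @ [last b]" using bne by simp
        have 1: "take j (drop r w) = butlast b" by (simp add: b_def butlast_take lw Suc.prems min_def)
          (use Suc.prems lw in \<open>auto simp: butlast_take\<close>)
        \<comment> \<open>Seen from the shorter block, the last letter of \<open>b\<close> belongs
          to the untouched rest of the word and stays frozen.\<close>
        have 2: "drop (r + j) w = last b # z"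
        proof -
          have "(take r w @ butlast b) @ last b # z = take r w @ b @ z" by (subst (2) b') simp
          then have "w = (take r w @ butlast b) @ last b # z" using w by simp
          moreover have "length (take r w @ butlast b) = r + j" using lr lb by simp
          ultimately show ?thesis by (metis append_eq_conv_conj)
        qed
        let ?w = "take r w @ tl b @ hd b # z"
        have 3: "take r ?w = take r w" using lr by simp
        have 4: "take j (drop r ?w) = tl b" using lr lb by simp
        have 5: "drop (r + j) ?w = hd b # z" using lr lb by simp
        have "?h w - ?h ?w = dynkin_op (\<lambda>t. f (take r w @ t @ last b # z)) (butlast b)
          - dynkin_op (\<lambda>t. f (take r w @ t @ hd b # z)) (tl b)"
          unfolding 1 2 3 4 5 ..
        also have "\<dots> = dynkin_op (\<lambda>t. f (take r w @ t @ z)) b"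
          using lb False by (subst (3) dynkin_op.simps) simp
        finally show "?h w - ?h (take r w @ tl (take (Suc j) (drop r w)) @
          hd (take (Suc j) (drop r w)) # drop (r + Suc j) w) =
          dynkin_op (\<lambda>t. f (take r w @ t @ drop (r + Suc j) w)) (take (Suc j) (drop r w))"
          unfolding b_def z_def .
      qed
      finally show ?thesis .
    qed
  }
qed

lemma gmul_gprod_Cons: "gmul n (gprod n (x # xs)) y = gmul n x (gmul n (gprod n xs) y)"
  by (simp add: gprod_def gmul_assoc)

text \<open>Induction over the blocks needs a factor \<alpha> for the letters before them: while the
  later blocks are treated, the value of g at the present block is carried along inside
  \<alpha>.\<close>

lemma gmul_gprod_omega_shift:
  fixes \<alpha> g :: "nat list \<Rightarrow> 'a::comm_ring_1"
  assumes "r + sum_list q \<le> n"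
  shows "gmul n (gprod n (map (\<lambda>j. omega_shift n (r + psum q j) (q ! j)) [0..<length q]))
      (on_words n (\<lambda>w. \<alpha> (take r w) * block_prod g q (drop r w))) =
    on_words n (\<lambda>w. \<alpha> (take r w) * block_prod (dynkin_op g) q (drop r w))"
  using assms
proof (induction q arbitrary: r \<alpha>)
  case Nil
  have "gprod n [] = (gone :: 'a grp)" by (simp add: gprod_def)
  then show ?case by (simp add: gmul_gone_left on_words_galg)
next
  case (Cons a q)
  let ?\<alpha> = "\<lambda>u. \<alpha> (take r u) * g (drop r u)"
  have m: "map (\<lambda>j. omega_shift n (r + psum (a # q) j) ((a # q) ! j)) [0..<length (a # q)] =
     (omega_shift n r a :: 'a grp) # map (\<lambda>j. omega_shift n (r + a + psum q j) (q ! j)) [0..<length q]"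
    unfolding length_Cons map_upt_Suc by (simp add: psum_def add.assoc)
  have F: "\<alpha> (take r w) * block_prod g (a # q) (drop r w) = ?\<alpha> (take (r + a) w) * block_prod g q (drop (r + a) w)" for w
    by (simp add: drop_take add.commute mult.assoc min_def)
  have "gmul n (gprod n (map (\<lambda>j. omega_shift n (r + psum (a # q) j) ((a # q) ! j)) [0..<length (a # q)]))
      (on_words n (\<lambda>w. \<alpha> (take r w) * block_prod g (a # q) (drop r w))) =
    gmul n (omega_shift n r a) (on_words n (\<lambda>w. ?\<alpha> (take (r + a) w) * block_prod (dynkin_op g) q (drop (r + a) w)))"
    unfolding m gmul_gprod_Cons F using Cons.prems by (subst Cons.IH) auto
  also have "\<dots> = on_words n (\<lambda>w. \<alpha> (take r w) * block_prod (dynkin_op g) (a # q) (drop r w))"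
    (is "_ = on_words n ?R")
  proof (subst gmul_omega_shift)
    show "r + a \<le> n" using Cons.prems by simp
    show "on_words n (\<lambda>w. dynkin_op (\<lambda>t. ?\<alpha> (take (r + a) (take r w @ t @ drop (r + a) w)) *
       block_prod (dynkin_op g) q (drop (r + a) (take r w @ t @ drop (r + a) w))) (take a (drop r w))) = on_words n ?R"
      (is "on_words n ?L = _")
    proof (rule on_words_cong)
      fix w assume "w \<in> words n"
      then have lw: "length w = n" by (rule words_length)
      \<comment> \<open>Only rearrangements \<open>t\<close> of the block occur, all of length
        \<open>a\<close>, so cutting the reassembled word at \<open>r\<close> and
        \<open>r + a\<close> recovers the three pieces.\<close>
      have "?L w =
        dynkin_op (\<lambda>t. \<alpha> (take r w) * g t * block_prod (dynkin_op g) q (drop (r + a) w)) (take a (drop r w))"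
      proof (rule dynkin_op_cong)
        fix t assume "mset t = mset (take a (drop r w))"
        then have "length t = length (take a (drop r w))" by (metis size_mset)
        then have lt: "length t = a" using Cons.prems lw by simp
        have lr: "length (take r w) = r" using Cons.prems lw by simp
        have 1: "take (r + a) (take r w @ t @ drop (r + a) w) = take r w @ t" using lr lt by simp
        have 2: "drop (r + a) (take r w @ t @ drop (r + a) w) = drop (r + a) w" using lr lt by simp
        have 3: "take r (take r w @ t) = take r w" "drop r (take r w @ t) = t" using lr by simp_all
        show "?\<alpha> (take (r + a) (take r w @ t @ drop (r + a) w)) *
         block_prod (dynkin_op g) q (drop (r + a) (take r w @ t @ drop (r + a) w)) =
         \<alpha> (take r w) * g t * block_prod (dynkin_op g) q (drop (r + a) w)"
          unfolding 1 2 3 ..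
      qed
      also have "\<dots> = ?R w" unfolding dynkin_op_scale by (simp add: mult.assoc add.commute)
      finally show "?L w = ?R w" .
    qed
  qed
  finally show ?case .
qed

lemma gmul_omega_up:
  assumes "is_comp n q"
  shows "gmul n (omega_up n q) (on_words n (block_prod g q)) = on_words n (block_prod (dynkin_op g) q)"
  using gmul_gprod_omega_shift[of 0 q n "\<lambda>_. 1" g] assms by (simp add: omega_up_def is_comp_def)

lemma block_prod_dynkin_sorted:
  "distinct w \<Longrightarrow> sum_list q \<le> length w \<Longrightarrow> \<forall>a\<in>set q. 0 < a \<Longrightarrow>
   block_prod (dynkin_op sorted_ind) q w = (block_prod lie_coeff q w :: 'a::comm_ring_1)"
proof (induction q arbitrary: w)
  case (Cons a q)
  have "dynkin_op sorted_ind (take a w) = (lie_coeff (take a w) :: 'a)"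
    using Cons.prems by (intro dynkin_op_sorted_ind) auto
  moreover have "block_prod (dynkin_op sorted_ind) q (drop a w) = (block_prod lie_coeff q (drop a w) :: 'a)"
    using Cons.prems by (intro Cons.IH) auto
  ultimately show ?case by simp
qed simp

lemma block_prod_dynkin_lie_coeff:
  "distinct w \<Longrightarrow> sum_list q \<le> length w \<Longrightarrow> \<forall>a\<in>set q. 0 < a \<Longrightarrow>
   block_prod (dynkin_op lie_coeff) q w = of_nat (prod_list q) * (block_prod lie_coeff q w :: 'a::comm_ring_1)"
proof (induction q arbitrary: w)
  case (Cons a q)
  have "dynkin_op lie_coeff (take a w) = of_nat (length (take a w)) * (lie_coeff (take a w) :: 'a)"
    using Cons.prems by (intro dynkin_op_lie_coeff) auto
  moreover have "block_prod (dynkin_op lie_coeff) q (drop a w) = of_nat (prod_list q) * (block_prod lie_coeff q (drop a w) :: 'a)"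
    using Cons.prems by (intro Cons.IH) auto
  moreover have "length (take a w) = a" using Cons.prems by simp
  ultimately show ?case by (simp add: mult_ac)
qed simp

lemma on_words_gsc: "gsc c (on_words n f) = on_words n (\<lambda>w. c * f w)"
  by (auto simp: gsc_def on_words_def)

text \<open>On each block \<Xi>^q has the indicator of increasing words, which the factor of
  \<omega>^q for that block turns into the Dynkin coefficient.\<close>

lemma omega_low_eq_on_words:
  assumes "is_comp n q"
  shows "omega_low n q = on_words n (block_prod lie_coeff q)"
proof -
  have "omega_low n q = on_words n (block_prod (dynkin_op sorted_ind) q)"
    unfolding omega_low_def Xi_eq_on_words[OF assms] by (rule gmul_omega_up[OF assms])
  also have "\<dots> = on_words n (block_prod lie_coeff q)"
    using assms by (intro on_words_cong block_prod_dynkin_sorted) (auto simp: words_length words_distinct is_comp_def)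
  finally show ?thesis .
qed

lemma gmul_omega_up_omega_low:
  assumes "is_comp n q"
  shows "gmul n (omega_up n q) (omega_low n q) = gsc (of_nat (prod_list q)) (omega_low n q)"
  unfolding omega_low_eq_on_words[OF assms] gmul_omega_up[OF assms] on_words_gsc
  using assms by (intro on_words_cong block_prod_dynkin_lie_coeff) (auto simp: words_length words_distinct is_comp_def)

lemma gmul_Xi_omega_low:
  assumes "is_comp n r" "is_comp n q" "mset r = mset q"
  shows "gmul n (Xi n r) (omega_low n q) = gsc (of_nat (brfact (mset q))) (omega_low n r)"
  unfolding omega_low_eq_on_words[OF assms(1)] omega_low_eq_on_words[OF assms(2)] gmul_Xi_on_words[OF assms(1)] on_words_gsc
  using assms by (intro on_words_cong sum_shuf_chunks_lie_coeff) (auto simp: words_length words_distinct is_comp_def)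

lemma gmul_Xi_omega_low_eq_0:
  assumes "is_comp n r" "is_comp n q" "length q < length r"
  shows "gmul n (Xi n r) (omega_low n q) = 0"
proof -
  have "gmul n (Xi n r) (omega_low n q) = on_words n (\<lambda>_. 0)"
    unfolding omega_low_eq_on_words[OF assms(2)] gmul_Xi_on_words[OF assms(1)]
    using assms by (intro on_words_cong sum_shuf_chunks_lie_coeff_eq_0) (auto simp: words_length words_distinct is_comp_def)
  also have "\<dots> = 0" by (auto simp: on_words_def)
  finally show ?thesis .
qed

text \<open>The two factors of \<lambda>? have different origins: the product of the parts comes
  from \<omega>^q \<omega>_q, the factorials come from \<Xi>^q \<omega>_q.\<close>

lemma lam_q_eq: "lam_q (mset q) = prod_list q * brfact (mset q)"
proof -
  have "prod_list q = (\<Prod>x\<in>set_mset (mset q). x ^ count (mset q) x)"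
    by (metis prod_mset_multiplicity prod_mset_prod_list)
  then show ?thesis unfolding lam_q_def brfact_def prod.distrib by (simp only:)
qed

lemma gsc_gsc: "gsc a (gsc b x) = gsc (a * b) x"
  by (simp add: gsc_def mult.assoc)

lemma omega_low_square:
  assumes "is_comp n q"
  shows "gmul n (omega_low n q) (omega_low n q) = gsc (of_nat (lam_q (mset q))) (omega_low n q)"
proof -
  have "gmul n (omega_low n q) (omega_low n q) = gmul n (omega_up n q) (gmul n (Xi n q) (omega_low n q))"
    by (subst (1) omega_low_def) (rule gmul_assoc)
  also have "\<dots> = gsc (of_nat (brfact (mset q))) (gmul n (omega_up n q) (omega_low n q))"
    by (simp add: gmul_Xi_omega_low[OF assms assms] gmul_linear_simps)
  finally show ?thesis by (simp add: gmul_omega_up_omega_low[OF assms] gsc_gsc lam_q_eq mult.commute)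
qed

section \<open>The descent algebra\<close>

lemma length_le_sum_list: "\<forall>x\<in>set q. 0 < x \<Longrightarrow> length q \<le> sum_list (q :: nat list)"
  by (induction q) auto

lemma finite_comps: "finite (comps n)"
proof (rule finite_subset)
  show "comps n \<subseteq> {xs. set xs \<subseteq> {..n} \<and> length xs \<le> n}"
    using length_le_sum_list member_le_sum_list by (fastforce simp: comps_def is_comp_def)
  show "finite {xs. set xs \<subseteq> {..n} \<and> length xs \<le> n}" by (rule finite_lists_length_le) simp
qed

lemma gsc_add_left: "gsc (a + b) x = gsc a x + gsc b x"
  by (simp add: gsc_def fun_eq_iff distrib_right)

lemma gsc_add_right: "gsc a (x + y) = gsc a x + gsc a y"
  by (simp add: gsc_def fun_eq_iff distrib_left)

lemma gsc_zero_left: "gsc 0 x = 0"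
  by (simp add: gsc_def fun_eq_iff)

lemma gsc_zero_right: "gsc a 0 = 0"
  by (simp add: gsc_def fun_eq_iff)

lemma gsc_one: "gsc 1 x = x"
  by (simp add: gsc_def)

lemma gsc_sum: "gsc a (\<Sum>i\<in>I. f i) = (\<Sum>i\<in>I. gsc a (f i))"
  by (induction I rule: infinite_finite_induct)
    (simp_all only: gsc_add_right gsc_zero_right sum.infinite sum.empty sum.insert if_False not_False_eq_True)

lemma desc_alg_zero: "0 \<in> desc_alg n"
  unfolding desc_alg_def mem_Collect_eq by (rule exI[of _ "\<lambda>_. 0"]) (simp only: gsc_zero_left sum.neutral_const)

lemma desc_alg_add: "x \<in> desc_alg n \<Longrightarrow> y \<in> desc_alg n \<Longrightarrow> x + y \<in> desc_alg n"
proof -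
  assume "x \<in> desc_alg n" "y \<in> desc_alg n"
  then obtain c d where "x = (\<Sum>r\<in>comps n. gsc (c r) (Xi n r))" "y = (\<Sum>r\<in>comps n. gsc (d r) (Xi n r))"
    unfolding desc_alg_def by blast
  then have "x + y = (\<Sum>r\<in>comps n. gsc (c r + d r) (Xi n r))" by (simp only: gsc_add_left sum.distrib)
  then show ?thesis unfolding desc_alg_def mem_Collect_eq by (intro exI[of _ "\<lambda>r. c r + d r"]) simp
qed

lemma desc_alg_gsc: "x \<in> desc_alg n \<Longrightarrow> gsc a x \<in> desc_alg n"
proof -
  assume "x \<in> desc_alg n"
  then obtain c where "x = (\<Sum>r\<in>comps n. gsc (c r) (Xi n r))" unfolding desc_alg_def by blast
  then have "gsc a x = (\<Sum>r\<in>comps n. gsc (a * c r) (Xi n r))" by (simp only: gsc_sum gsc_gsc)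
  then show ?thesis unfolding desc_alg_def mem_Collect_eq by (intro exI[of _ "\<lambda>r. a * c r"]) simp
qed

lemma desc_alg_diff: "x \<in> desc_alg n \<Longrightarrow> y \<in> desc_alg n \<Longrightarrow> x - y \<in> desc_alg n"
proof -
  assume "x \<in> desc_alg n" "y \<in> desc_alg n"
  then have "x + gsc (-1) y \<in> desc_alg n" by (intro desc_alg_add desc_alg_gsc)
  moreover have "x + gsc (-1) y = x - y" by (simp add: gsc_def fun_eq_iff)
  ultimately show ?thesis by simp
qed

lemma desc_alg_sum: "(\<And>i. i \<in> I \<Longrightarrow> f i \<in> desc_alg n) \<Longrightarrow> (\<Sum>i\<in>I. f i) \<in> desc_alg n"
proof (induction I rule: infinite_finite_induct)
  case (insert i I)
  then show ?case unfolding sum.insert[OF insert(1,2)] by (intro desc_alg_add) auto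
qed (simp_all only: sum.infinite sum.empty desc_alg_zero not_False_eq_True)

lemma Xi_desc_alg:
  assumes "is_comp n q"
  shows "Xi n q \<in> (desc_alg n :: 'a::comm_ring_1 grp set)"
proof -
  have q: "q \<in> comps n" using assms by (simp add: comps_def)
  let ?c = "\<lambda>r. if r = q then 1 else 0 :: 'a"
  have "gsc (?c r) (Xi n r) = (if r = q then Xi n q else 0)" for r
    by (cases "r = q") (simp_all only: gsc_one gsc_zero_left if_True if_False simp_thms)
  then have "(\<Sum>r\<in>comps n. gsc (?c r) (Xi n r)) = Xi n q"
    using sum.delta[OF finite_comps[of n], of q "\<lambda>_. Xi n q"] q by (simp only: if_True)
  then show ?thesis unfolding desc_alg_def mem_Collect_eq by (intro exI[of _ ?c]) simp
qed

lemma desc_alg_galg: "x \<in> desc_alg n \<Longrightarrow> x \<in> galg n"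
proof -
  assume "x \<in> desc_alg n"
  then obtain c where "x = (\<Sum>r\<in>comps n. gsc (c r) (Xi n r))" unfolding desc_alg_def by blast
  moreover have "(\<Sum>r\<in>A. gsc (c r) (Xi n r)) \<in> galg n" for A
  proof (induction A rule: infinite_finite_induct)
    case (insert i I)
    have "gsc (c i) (Xi n i) \<in> galg n" by (rule galg_gsc) (simp add: galg_def Xi_def)
    then show ?case unfolding sum.insert[OF insert(1,2)] by (intro galg_add insert)
  qed (simp_all only: sum.infinite sum.empty galg_zero not_False_eq_True)
  ultimately show ?thesis by simp
qed

text \<open>The last partial sum is n, which is never a descent; hence the intersection with
  \<open>{1..<n}\<close>. The composition arises from one of m, the largest element of S, by
  appending the part n - m.\<close>

lemma ex_comp_psum:
  "S \<subseteq> {1..<n} \<Longrightarrow> \<exists>q. is_comp n q \<and> psum q ` {1..length q} \<inter> {1..<n} = S"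
proof (induction n arbitrary: S rule: less_induct)
  case (less n)
  show ?case
  proof (cases "S = {}")
    case True
    show ?thesis
    proof (cases "n = 0")
      case True
      then show ?thesis using \<open>S = {}\<close> by (intro exI[of _ "[]"]) (simp add: is_comp_def)
    next
      case False
      then show ?thesis using \<open>S = {}\<close> by (intro exI[of _ "[n]"]) (auto simp: is_comp_def psum_def)
    qed
  next
    case False
    have fS: "finite S" using less.prems by (rule finite_subset) simp
    define m where "m = Max S"
    have m: "m \<in> S" "\<forall>x\<in>S. x \<le> m" unfolding m_def using False fS by auto
    then have m1: "1 \<le> m" "m < n" using less.prems by auto
    have "S - {m} \<subseteq> {1..<m}" using m less.prems by force
    from less.IH[OF m1(2) this] obtain q where
      q: "is_comp m q" "psum q ` {1..length q} \<inter> {1..<m} = S - {m}" by blast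
    have ps: "psum (q @ [n - m]) j = psum q j" if "j \<le> length q" for j using that by (simp add: psum_def)
    have psl: "psum q (length q) = m" "psum (q @ [n - m]) (Suc (length q)) = n"
      using q m1 by (simp_all add: psum_def is_comp_def)
    have ple: "psum q j \<le> m" for j
    proof -
      have "sum_list (take j q) + sum_list (drop j q) = sum_list q" by (simp flip: sum_list_append)
      then show ?thesis using q(1) by (simp add: psum_def is_comp_def)
    qed
    have lq: "1 \<le> length q" using q(1) m1 by (cases q) (auto simp: is_comp_def)
    have "{1..length (q @ [n - m])} = insert (Suc (length q)) {1..length q}" by auto
    moreover have "psum (q @ [n - m]) ` {1..length q} = psum q ` {1..length q}"
      by (intro image_cong refl ps) auto
    ultimately have "psum (q @ [n - m]) ` {1..length (q @ [n - m])} = insert n (psum q ` {1..length q})"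
      using psl by (simp only: image_insert)
    moreover have "insert n (psum q ` {1..length q}) \<inter> {1..<n} = S"
    proof
      show "insert n (psum q ` {1..length q}) \<inter> {1..<n} \<subseteq> S"
      proof
        fix x assume x: "x \<in> insert n (psum q ` {1..length q}) \<inter> {1..<n}"
        then have "x \<in> psum q ` {1..length q}" by auto
        moreover have "x \<le> m" using calculation ple by auto
        ultimately have "x = m \<or> x \<in> psum q ` {1..length q} \<inter> {1..<m}" using x by simp linarith
        then show "x \<in> S" using q(2) m(1) by blast
      qed
      show "S \<subseteq> insert n (psum q ` {1..length q}) \<inter> {1..<n}"
      proof
        fix x assume x: "x \<in> S"
        then have "x \<in> psum q ` {1..length q}"
        proof (cases "x = m")
          case True
          then show ?thesis using psl(1) lq by (intro image_eqI[of _ _ "length q"]) auto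
        next
          case False
          then show ?thesis using x q(2) by blast
        qed
        then show "x \<in> insert n (psum q ` {1..length q}) \<inter> {1..<n}" using x less.prems by blast
      qed
    qed
    moreover have "is_comp n (q @ [n - m])" using q m1 by (auto simp: is_comp_def)
    ultimately show ?thesis by (intro exI[of _ "q @ [n - m]"]) simp
  qed
qed

definition word_desc :: "nat list \<Rightarrow> nat set" where
  "word_desc w = {i. 0 < i \<and> i < length w \<and> w ! i < w ! (i - 1)}"

lemma sum_apply: "(\<Sum>i\<in>I. f i) x = (\<Sum>i\<in>I. f i x :: 'a::comm_ring_1)"
  by (induction I rule: infinite_finite_induct) auto

text \<open>\<Xi>^q is the sum of the indicators of all descent sets contained in S; solving for the
  top one is Moebius inversion, done by induction on \<open>card S\<close>.\<close>

lemma word_desc_ind_desc_alg: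
  "S \<subseteq> {1..<n} \<Longrightarrow> on_words n (\<lambda>w. if word_desc w = S then 1 else 0) \<in> desc_alg n"
proof (induction "card S" arbitrary: S rule: less_induct)
  case less
  let ?ind = "\<lambda>S. on_words n (\<lambda>w. if word_desc w = S then 1 else 0) :: 'a grp"
  obtain q where q: "is_comp n q" "psum q ` {1..length q} \<inter> {1..<n} = S"
    using ex_comp_psum[OF less.prems] by blast
  have fS: "finite S" using less.prems by (rule finite_subset) simp
  have "Xi n q = (\<Sum>T\<in>Pow S. ?ind T)"
  proof
    fix \<pi>
    show "Xi n q \<pi> = (\<Sum>T\<in>Pow S. ?ind T) \<pi>"
    proof (cases "\<pi> \<in> perms n")
      case True
      have "descents n \<pi> = word_desc (word n \<pi>)"
        by (auto simp: descents_def word_desc_def length_word word_nth)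
      moreover have "{psum q j | j. 1 \<le> j \<and> j \<le> length q} = psum q ` {1..length q}" by auto
      moreover have sub: "word_desc (word n \<pi>) \<subseteq> {1..<n}" by (auto simp: word_desc_def length_word)
      ultimately have "Xi n q \<pi> = (if word_desc (word n \<pi>) \<subseteq> S then 1 else 0 :: 'a)"
        using True q(2) unfolding Xi_def by auto
      also have "\<dots> = (\<Sum>T\<in>Pow S. if word_desc (word n \<pi>) = T then 1 else 0)"
        using fS by (simp add: sum.delta')
      also have "\<dots> = (\<Sum>T\<in>Pow S. ?ind T) \<pi>" using True by (simp add: sum_apply on_words_def)
      finally show ?thesis .
    qed (simp add: sum_apply on_words_def Xi_def)
  qed
  also have "\<dots> = ?ind S + (\<Sum>T\<in>Pow S - {S}. ?ind T)" using fS by (intro sum.remove) auto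
  finally have "?ind S = Xi n q - (\<Sum>T\<in>Pow S - {S}. ?ind T)" by (simp only: add_diff_cancel_right')
  moreover have "(\<Sum>T\<in>Pow S - {S}. ?ind T) \<in> desc_alg n"
  proof (rule desc_alg_sum)
    fix T assume T: "T \<in> Pow S - {S}"
    then have "card T < card S" using fS by (intro psubset_card_mono) auto
    then show "?ind T \<in> desc_alg n" using T less.prems by (intro less.hyps) auto
  qed
  ultimately show ?case using Xi_desc_alg[OF q(1)] desc_alg_diff by metis
qed

lemma on_words_desc_alg:
  fixes f :: "nat list \<Rightarrow> 'a::comm_ring_1"
  assumes "\<And>w w'. w \<in> words n \<Longrightarrow> w' \<in> words n \<Longrightarrow> same_desc w w' \<Longrightarrow> f w = f w'"
  shows "on_words n f \<in> desc_alg n"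
proof -
  let ?ind = "\<lambda>S. on_words n (\<lambda>w. if word_desc w = S then 1 else 0) :: 'a grp"
  \<comment> \<open>A value of \<open>f\<close> on the descent class of \<open>S\<close>; were the
    class empty, the choice would be arbitrary but would multiply the zero function.\<close>
  define v where "v S = f (SOME w. w \<in> words n \<and> word_desc w = S)" for S
  have v: "v (word_desc w) = f w" if w: "w \<in> words n" for w
  proof -
    let ?w = "SOME w'. w' \<in> words n \<and> word_desc w' = word_desc w"
    have w': "?w \<in> words n \<and> word_desc ?w = word_desc w" by (rule someI[of _ w]) (simp add: w)
    have "same_desc ?w w"
      unfolding same_desc_def
    proof (intro conjI allI impI)
      show len: "length ?w = length w" using w w' by (simp add: words_length)
      fix i assume i: "Suc i < length ?w"
      have neq: "u ! i \<noteq> u ! Suc i" if "u \<in> words n" "Suc i < length u" for u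
        using words_distinct[OF that(1)] that(2) by (simp add: nth_eq_iff_index_eq)
      have "Suc i \<in> word_desc ?w \<longleftrightarrow> Suc i \<in> word_desc w" using w' by simp
      then have "?w ! Suc i < ?w ! i \<longleftrightarrow> w ! Suc i < w ! i" using i len by (simp add: word_desc_def)
      then show "?w ! i < ?w ! Suc i \<longleftrightarrow> w ! i < w ! Suc i"
        using neq[of ?w] neq[of w] w w' i len by linarith
    qed
    then show ?thesis unfolding v_def using assms w w' by blast
  qed
  have "on_words n f = (\<Sum>S\<in>Pow {1..<n}. gsc (v S) (?ind S))"
  proof
    fix \<pi>
    show "on_words n f \<pi> = (\<Sum>S\<in>Pow {1..<n}. gsc (v S) (?ind S)) \<pi>"
    proof (cases "\<pi> \<in> perms n")
      case True
      then have w: "word n \<pi> \<in> words n" by (rule word_mem_words)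
      have sub: "word_desc (word n \<pi>) \<in> Pow {1..<n}" by (auto simp: word_desc_def length_word)
      have "(\<Sum>S\<in>Pow {1..<n}. gsc (v S) (?ind S)) \<pi> =
        (\<Sum>S\<in>Pow {1..<n}. if word_desc (word n \<pi>) = S then v S else 0)"
        unfolding sum_apply using True by (intro sum.cong refl) (simp add: gsc_def on_words_def)
      also have "\<dots> = v (word_desc (word n \<pi>))"
        using sub sum.delta'[of "Pow {1..<n}" "word_desc (word n \<pi>)" v] by simp
      finally show ?thesis using True v[OF w] by (simp add: on_words_def)
    qed (simp add: sum_apply on_words_def gsc_def)
  qed
  moreover have "(\<Sum>S\<in>Pow {1..<n}. gsc (v S) (?ind S)) \<in> desc_alg n"
    by (intro desc_alg_sum desc_alg_gsc word_desc_ind_desc_alg) blast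
  ultimately show ?thesis by (simp only:)
qed

lemma omega_low_desc_alg:
  assumes "is_comp n q"
  shows "omega_low n q \<in> desc_alg n"
  unfolding omega_low_eq_on_words[OF assms]
  by (intro on_words_desc_alg same_desc_block_prod_lie_coeff) (auto simp: words_distinct)

text \<open>Solomon's theorem. The coefficient of \<Xi>^r \<Xi>^q at a word is a sum over the
  shuffles of its r-blocks, and this sum depends only on the descents inside these blocks.\<close>

lemma desc_alg_gmul:
  assumes "x \<in> desc_alg n" "y \<in> desc_alg n"
  shows "gmul n x y \<in> desc_alg n"
proof -
  have XX: "gmul n (Xi n r) (Xi n q) \<in> desc_alg n" if r: "is_comp n r" and q: "is_comp n q" for r q
    unfolding Xi_eq_on_words[OF q] gmul_Xi_on_words[OF r]
  proof (rule on_words_desc_alg)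
    fix w w' assume w: "w \<in> words n" "w' \<in> words n" "same_desc w w'"
    have cc: "concat (chunks r u) = u" if "u \<in> words n" for u
      using that r by (simp add: concat_chunks is_comp_def words_length)
    show "(sum (block_prod sorted_ind q) (shuf (chunks r w))) = (sum (block_prod sorted_ind q) (shuf (chunks r w')))"
      using w q by (intro sum_shuf_block_prod_sorted_same_desc same_desc_chunks)
        (simp_all add: cc words_distinct words_length is_comp_def)
  qed
  obtain c d where x: "x = (\<Sum>r\<in>comps n. gsc (c r) (Xi n r))" and y: "y = (\<Sum>r\<in>comps n. gsc (d r) (Xi n r))"
    using assms unfolding desc_alg_def by blast
  show ?thesis unfolding x y gmul_sum_left gmul_sum_right gmul_linear_simps
    by (intro desc_alg_sum desc_alg_gsc XX) (auto simp: comps_def)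
qed

section \<open>The refinement order and the idempotents e_\<lambda>\<close>

lemma length_concat_ge:
  assumes "length rs = length q" "\<forall>j<length q. is_comp (q ! j) (rs ! j)" "\<forall>a\<in>set q. 0 < a"
  shows "length q \<le> length (concat rs) \<and> (length (concat rs) = length q \<longrightarrow> concat rs = q)"
  using assms
proof (induction rs q rule: list_induct2)
  case (Cons x rs a q)
  have x: "is_comp a x" using Cons.prems(1) by auto
  have "\<forall>j<length q. is_comp (q ! j) (rs ! j)" using Cons.prems(1) by auto
  then have IH: "length q \<le> length (concat rs)" "length (concat rs) = length q \<Longrightarrow> concat rs = q"
    using Cons.IH Cons.prems by auto
  have "x \<noteq> []" using x Cons.prems(2) by (auto simp: is_comp_def)
  then have l: "1 \<le> length x" by (simp add: Suc_le_eq)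
  moreover have "concat (x # rs) = a # q" if "length (concat (x # rs)) = length (a # q)"
  proof -
    have "length x = 1" "length (concat rs) = length q" using that l IH(1) by auto
    moreover from this obtain y where "x = [y]" by (auto simp: length_Suc_conv)
    ultimately show ?thesis using IH(2) x by (simp add: is_comp_def)
  qed
  ultimately show ?case using IH(1) by auto
qed simp

text \<open>Translates the refinement order into the number of parts, by which \<Xi>^\<xi>
  annihilates \<omega>_q: a refinement with no more parts leaves every part undivided and is a
  rearrangement.\<close>

lemma srefines_length:
  assumes "srefines \<xi> q" "\<forall>a\<in>set q. 0 < a"
  shows "length q < length \<xi>"
proof -
  obtain rs where rs: "length rs = length q" "\<forall>j<length q. is_comp (q ! j) (rs ! j)" "mset (concat rs) = mset \<xi>"
    using assms(1) unfolding srefines_def refines_def by blast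
  have "length (concat rs) = length \<xi>" using rs(3) by (metis size_mset)
  moreover have "concat rs \<noteq> q" using rs(3) assms(1) by (auto simp: srefines_def)
  ultimately show ?thesis using length_concat_ge[OF rs(1,2) assms(2)] by auto
qed

lemma block_prod_lie_coeff_sorted:
  "sorted w \<Longrightarrow> sum_list q \<le> length w \<Longrightarrow> \<forall>a\<in>set q. 0 < a \<Longrightarrow> block_prod lie_coeff q w = (1 :: 'a::comm_ring_1)"
proof (induction q arbitrary: w)
  case (Cons a q)
  have "lie_coeff (take a w) = (1 :: 'a)"
    using Cons.prems by (intro lie_coeff_sorted) (auto simp: sorted_wrt_take)
  moreover have "block_prod lie_coeff q (drop a w) = (1 :: 'a)"
    using Cons.prems by (intro Cons.IH) (auto simp: sorted_wrt_drop)
  ultimately show ?case by simp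
qed simp

text \<open>The word of the identity is increasing, so all its Dynkin coefficients are 1. This value
  gives both \<omega>_q \<noteq> 0 and the diagonal of its multiplication matrix.\<close>

lemma omega_low_id:
  assumes "is_comp n q"
  shows "omega_low n q id = 1"
  unfolding omega_low_eq_on_words[OF assms] on_words_def using assms
  by (simp add: id_perms word_def is_comp_def block_prod_lie_coeff_sorted del: upt_Suc)

text \<open>The triangular form of e_\<lambda> refers to the arrangement
  \<open>part_comp lam\<close>, so q is that arrangement here; others are reached later through
  \<Xi>^q. The last two identities make e_\<lambda> and \<omega>_q generate the same right
  ideal.\<close>

lemma e_family_omega_low:
  fixes e :: "nat multiset \<Rightarrow> ('a::field) grp"
  assumes ef: "is_e_family p n e" and lam: "lam \<in> pres_parts p n"
    and N: "of_nat (lam_q lam) \<noteq> (0::'a)" and q: "q = part_comp lam"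
  shows "is_comp n q" "mset q = lam" "e lam \<in> galg n"
    "gmul n (e lam) (omega_low n q) = omega_low n q"
    "gmul n (omega_low n q) (e lam) = gsc (of_nat (lam_q lam)) (e lam)"
proof -
  show mq: "mset q = lam" using q by (simp add: part_comp_def)
  show cq: "is_comp n q" using lam mq unfolding is_comp_def pres_parts_def
    by (metis (mono_tags, lifting) gr0I mem_Collect_eq set_mset_mset sum_mset_sum_list)
  have B: "of_nat (brfact lam) \<noteq> (0::'a)" using N unfolding mq[symmetric] lam_q_eq by simp
  have prim: "primitive_idem_in n (desc_alg n) (e lam)" using ef lam unfolding is_e_family_def by blast
  then have eD: "e lam \<in> desc_alg n" and ee: "gmul n (e lam) (e lam) = e lam"
    unfolding primitive_idem_in_def is_idem_def by blast+
  show "e lam \<in> galg n" using eD by (rule desc_alg_galg)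
  let ?w = "omega_low n q :: 'a grp"
  obtain c where c: "e lam = gsc (1 / of_nat (brfact lam)) (Xi n q)
        + (\<Sum>\<xi>\<in>{\<xi>\<in>comps n. srefines \<xi> q}. gsc (c \<xi>) (Xi n \<xi>))"
    using ef lam q unfolding is_e_family_def by blast
  \<comment> \<open>Proper refinements have more parts than \<open>q\<close>, so only the leading
    term acts, and its coefficient 1/[\<lambda>]! cancels the factor from \<Xi>^q
    \<omega>_q.\<close>
  have "gmul n (Xi n \<xi>) ?w = 0" if "\<xi> \<in> {\<xi>\<in>comps n. srefines \<xi> q}" for \<xi>
    using that cq by (intro gmul_Xi_omega_low_eq_0 srefines_length) (auto simp: comps_def is_comp_def)
  then have "(\<Sum>\<xi>\<in>{\<xi>\<in>comps n. srefines \<xi> q}. gsc (c \<xi>) (gmul n (Xi n \<xi>) ?w)) = 0"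
    by (intro sum.neutral ballI) (simp only: gsc_zero_right)
  then have "gmul n (e lam) ?w = gsc (1 / of_nat (brfact lam)) (gmul n (Xi n q) ?w)"
    unfolding c gmul_linear_simps gmul_sum_left by (simp only: add_0_right)
  also have "\<dots> = ?w" using B mq by (simp add: gmul_Xi_omega_low[OF cq cq] gsc_gsc gsc_one)
  finally show ew: "gmul n (e lam) ?w = ?w" .
  let ?N = "of_nat (lam_q lam) :: 'a"
  define \<nu> where "\<nu> = gsc (1 / ?N) ?w"
  define f where "f = gmul n \<nu> (e lam)"
  have ww: "gmul n ?w ?w = gsc ?N ?w" using omega_low_square[OF cq] mq by simp
  have \<nu>\<nu>: "gmul n \<nu> \<nu> = \<nu>" unfolding \<nu>_def gmul_linear_simps ww gsc_gsc using N by simp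
  have e\<nu>: "gmul n (e lam) \<nu> = \<nu>" unfolding \<nu>_def gmul_linear_simps ew ..
  have ef': "gmul n (e lam) f = f" unfolding f_def gmul_assoc[symmetric] e\<nu> ..
  have fe: "gmul n f (e lam) = f" unfolding f_def gmul_assoc ee ..
  have ff: "gmul n f f = f"
  proof -
    have "gmul n f f = gmul n \<nu> (gmul n (e lam) f)" unfolding f_def by (simp only: gmul_assoc)
    also have "\<dots> = f" unfolding ef' unfolding f_def gmul_assoc[symmetric] \<nu>\<nu> ..
    finally show ?thesis .
  qed
  have fD: "f \<in> desc_alg n" unfolding f_def \<nu>_def
    by (intro desc_alg_gmul desc_alg_gsc omega_low_desc_alg cq eD)
  \<comment> \<open>An element that fixes the non-zero \<omega>_q cannot be zero.\<close>
  have "gmul n f ?w = ?w"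
  proof -
    have "gmul n f ?w = gmul n \<nu> ?w" unfolding f_def gmul_assoc ew ..
    also have "\<dots> = ?w" unfolding \<nu>_def gmul_linear_simps ww gsc_gsc using N by (simp add: gsc_one)
    finally show ?thesis .
  qed
  moreover have "?w \<noteq> 0" using omega_low_id[OF cq, where 'a='a] by (metis zero_fun_apply zero_neq_one)
  ultimately have f0: "f \<noteq> 0" using gmul_linear_simps(7)[of n ?w] by metis
  \<comment> \<open>As \<open>f\<close> absorbs e_\<lambda> on both sides, \<open>f\<close> and
    \<open>?g\<close> are orthogonal idempotents of the descent algebra with sum e_\<lambda>;
    primitivity leaves no room for the second.\<close>
  let ?g = "e lam - f"
  have gD: "?g \<in> desc_alg n" by (intro desc_alg_diff eD fD)
  have fg: "gmul n f ?g = 0" "gmul n ?g f = 0" "gmul n ?g ?g = ?g"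
    unfolding gmul_linear_simps fe ff ef' ee by simp_all
  have sum: "e lam = f + ?g" by simp
  have "?g = 0"
    using prim fD gD ff fg f0 sum unfolding primitive_idem_in_def is_idem_def by blast
  then have "f = e lam" by simp
  then have "gsc ?N f = gsc ?N (e lam)" by simp
  moreover have "gsc ?N f = gmul n ?w (e lam)"
    unfolding f_def \<nu>_def gmul_linear_simps gsc_gsc using N by (simp add: gsc_one)
  ultimately show "gmul n ?w (e lam) = gsc ?N (e lam)" by simp
qed

section \<open>Rank of an integral quasi-idempotent matrix\<close>

lemma common_denominator:
  fixes a :: "'i \<Rightarrow> rat"
  assumes "finite J"
  shows "\<exists>D::int. D > 0 \<and> (\<forall>j\<in>J. \<exists>k::int. of_int k = of_int D * a j)"
  using assms
proof (induction J)
  case empty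
  then show ?case by (intro exI[of _ 1]) simp
next
  case (insert j J)
  then obtain D :: int where D: "D > 0" "\<forall>j\<in>J. \<exists>k::int. of_int k = of_int D * a j" by blast
  obtain u v where uv: "quotient_of (a j) = (u, v)" by (cases "quotient_of (a j)")
  then have v: "v > 0" "a j = of_int u / of_int v" by (simp_all add: quotient_of_denom_pos quotient_of_div)
  have "\<exists>k::int. of_int k = of_int (D * v) * a i" if i: "i \<in> insert j J" for i
  proof (cases "i = j")
    case True
    then show ?thesis using v by (intro exI[of _ "D * u"]) simp
  next
    case False
    then obtain k :: int where "of_int k = of_int D * a i" using D i by blast
    then show ?thesis by (intro exI[of _ "v * k"]) simp
  qed
  then show ?case using D v by (intro exI[of _ "D * v"]) auto
qed

text \<open>
  A rational relation, scaled to a primitive integral one, survives reduction modulo \<open>p\<close>.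
\<close>

lemma rat_indep_if_indep_char_p:
  fixes M :: "'i \<Rightarrow> 'i \<Rightarrow> int" and a :: "'i \<Rightarrow> rat"
  assumes fin: "finite J" and p: "CHAR('a::field) > 0"
    and indep: "\<And>b :: 'i \<Rightarrow> 'a. (\<forall>x\<in>X. (\<Sum>j\<in>J. b j * of_int (M x j)) = 0) \<Longrightarrow> \<forall>j\<in>J. b j = 0"
    and rel: "\<forall>x\<in>X. (\<Sum>j\<in>J. a j * of_int (M x j)) = 0"
  shows "\<forall>j\<in>J. a j = 0"
proof (rule ccontr)
  assume "\<not> (\<forall>j\<in>J. a j = 0)"
  then obtain i where i: "i \<in> J" "a i \<noteq> 0" by blast
  obtain D :: int where D: "D > 0" "\<forall>j\<in>J. \<exists>k::int. of_int k = of_int D * a j"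
    using common_denominator[OF fin, of a] by blast
  then obtain k :: "'i \<Rightarrow> int" where k: "\<And>j. j \<in> J \<Longrightarrow> of_int (k j) = of_int D * a j" by metis
  have ki: "k i \<noteq> 0" using k[OF i(1)] i(2) D(1) by auto
  define g where "g = Gcd (k ` J)"
  have g0: "g \<noteq> 0" using ki i(1) unfolding g_def by (auto simp: Gcd_0_iff)
  have "\<forall>j\<in>J. g dvd k j" unfolding g_def by auto
  then obtain m where m: "\<And>j. j \<in> J \<Longrightarrow> k j = g * m j" unfolding dvd_def by metis
  have rel_int: "(\<Sum>j\<in>J. m j * M x j) = 0" if x: "x \<in> X" for x
  proof -
    have "(of_int (\<Sum>j\<in>J. k j * M x j) :: rat) = of_int D * (\<Sum>j\<in>J. a j * of_int (M x j))"
      by (simp add: sum_distrib_left k mult.assoc)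
    then have "(of_int (\<Sum>j\<in>J. k j * M x j) :: rat) = 0" using rel x by simp
    then have "(\<Sum>j\<in>J. k j * M x j) = 0" by (simp only: of_int_eq_0_iff)
    then have "g * (\<Sum>j\<in>J. m j * M x j) = 0" by (simp add: sum_distrib_left m mult.assoc)
    then show ?thesis using g0 by simp
  qed
  have "\<forall>x\<in>X. (\<Sum>j\<in>J. of_int (m j) * of_int (M x j)) = (0 :: 'a)"
  proof
    fix x assume "x \<in> X"
    then have "(of_int (\<Sum>j\<in>J. m j * M x j) :: 'a) = 0" by (simp only: rel_int of_int_0)
    then show "(\<Sum>j\<in>J. of_int (m j) * of_int (M x j)) = (0 :: 'a)" by simp
  qed
  then have "\<forall>j\<in>J. of_int (m j) = (0 :: 'a)" by (rule indep)
  then have pm: "\<forall>j\<in>J. int CHAR('a) dvd m j" by (simp add: of_int_eq_0_iff_char_dvd)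
  \<comment> \<open>If p divided every \<open>m j\<close>, then p times \<open>g\<close> would be a
    common divisor of the \<open>k j\<close>, impossible for their non-zero greatest common divisor
    \<open>g\<close>.\<close>
  have "int CHAR('a) * g dvd Gcd (k ` J)"
  proof (rule Gcd_greatest)
    fix z assume "z \<in> k ` J"
    then obtain j where j: "j \<in> J" "z = k j" by blast
    have "g * int CHAR('a) dvd g * m j" using pm j(1) by (intro mult_dvd_mono) auto
    then show "int CHAR('a) * g dvd z" unfolding j(2) m[OF j(1)] by (simp only: mult.commute)
  qed
  then have "int CHAR('a) * g dvd g" unfolding g_def[symmetric] .
  then have "int CHAR('a) dvd 1" using g0 by (metis dvd_times_right_cancel_iff mult_1)
  then have "CHAR('a) = 1" using p by simp
  then show False using CHAR_not_1[where ?'a='a] by simp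
qed

lemma vector_space_fun: "vector_space (\<lambda>(c::'k::field) (v::'i \<Rightarrow> 'k) x. c * v x)"
  unfolding vector_space_def by (intro conjI allI ext) (simp_all add: distrib_left distrib_right mult.assoc)

text \<open>A rational matrix with M M = c M acts as c on its column space, so its trace is c times
  its rank, and independent columns number at most the rank. In matrix form: if the columns of B are
  a basis of the column space and M = B \<Phi>, then \<Phi> B = c, and M has the trace of \<Phi>
  B.\<close>

lemma card_indep_columns_le_trace:
  fixes M :: "'i \<Rightarrow> 'i \<Rightarrow> int" and c :: int
  assumes X: "finite X" and J: "J \<subseteq> X" and c: "c > 0"
    and sq: "\<And>x z. x \<in> X \<Longrightarrow> z \<in> X \<Longrightarrow> (\<Sum>y\<in>X. M x y * M y z) = c * M x z"
    and indep: "\<And>a :: 'i \<Rightarrow> rat. (\<forall>x\<in>X. (\<Sum>j\<in>J. a j * of_int (M x j)) = 0) \<Longrightarrow> \<forall>j\<in>J. a j = 0"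
  shows "c * int (card J) \<le> (\<Sum>x\<in>X. M x x)"
proof -
  interpret fun_vs: vector_space "\<lambda>(c::rat) (v::'i \<Rightarrow> rat) x. c * v x" by (rule vector_space_fun)
  \<comment> \<open>Entries outside \<open>X\<close> are set to 0, so that a column is determined by
    its entries in \<open>X\<close>.\<close>
  define col :: "'i \<Rightarrow> 'i \<Rightarrow> rat" where "col y = (\<lambda>x. if x \<in> X then of_int (M x y) else 0)" for y
  have finJ: "finite J" using J X by (rule finite_subset)
  have rel0: "\<forall>j\<in>J. a j = 0" if "(\<Sum>j\<in>J. (\<lambda>x. a j * col j x)) = 0" for a
  proof (rule indep, intro ballI)
    fix x assume x: "x \<in> X"
    have "(\<Sum>j\<in>J. (\<lambda>x. a j * col j x)) x = 0" using that by simp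
    then show "(\<Sum>j\<in>J. a j * of_int (M x j)) = 0" using x by (simp add: sum_apply col_def)
  qed
  have inj: "inj_on col J"
  proof (rule inj_onI, rule ccontr)
    fix i j assume ij: "i \<in> J" "j \<in> J" "col i = col j" "i \<noteq> j"
    \<comment> \<open>Equal columns at two indices would satisfy the relation with coefficients 1
      and -1.\<close>
    define a :: "'i \<Rightarrow> rat" where "a l = (if l = i then 1 else if l = j then -1 else 0)" for l
    have "(\<Sum>l\<in>J. (\<lambda>x. a l * col l x)) = 0"
    proof
      fix x
      have "(\<Sum>l\<in>J. a l * col l x) = (\<Sum>l\<in>{i, j}. a l * col l x)"
        using ij finJ by (intro sum.mono_neutral_right) (auto simp: a_def)
      also have "\<dots> = 0" using ij by (simp add: a_def)
      finally show "(\<Sum>l\<in>J. (\<lambda>x. a l * col l x)) x = 0 x" by (simp add: sum_apply)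
    qed
    then have "a i = 0" using rel0 ij by blast
    then show False by (simp add: a_def)
  qed
  have indJ: "fun_vs.independent (col ` J)"
  proof (rule fun_vs.independent_if_scalars_zero)
    fix f v assume h: "(\<Sum>v\<in>col ` J. (\<lambda>x. f v * v x)) = 0" "v \<in> col ` J"
    have "(\<Sum>j\<in>J. (\<lambda>x. f (col j) * col j x)) = 0" using h(1) by (simp add: sum.reindex[OF inj] o_def)
    then have "\<forall>j\<in>J. f (col j) = 0" by (rule rel0)
    then show "f v = 0" using h(2) by blast
  qed (simp add: finJ)
  obtain B where B: "B \<subseteq> col ` X" "fun_vs.independent B" "col ` X \<subseteq> fun_vs.span B"
    using fun_vs.maximal_independent_subset[of "col ` X"] by metis
  have finB: "finite B" using B(1) X by (meson finite_imageI finite_subset)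
  have "card J \<le> card B"
  proof -
    have "card (col ` J) \<le> card B"
      using fun_vs.independent_span_bound[OF finB indJ] J B(3) by blast
    then show ?thesis by (simp add: card_image[OF inj])
  qed
  moreover have "of_int (\<Sum>x\<in>X. M x x) = (of_int (c * int (card B)) :: rat)"
  proof -
    have "\<exists>\<phi>. col y = (\<Sum>b\<in>B. (\<lambda>x. \<phi> b * b x))" if "y \<in> X" for y
    proof -
      have "col y \<in> fun_vs.span B" using B(3) that by blast
      then show ?thesis unfolding fun_vs.span_finite[OF finB] by blast
    qed
    then obtain \<phi> where \<phi>: "\<And>y. y \<in> X \<Longrightarrow> col y = (\<Sum>b\<in>B. (\<lambda>x. \<phi> y b * b x))" by metis
    \<comment> \<open>The vectors of \<open>B\<close> are columns of \<open>M\<close>, so M M = c M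
      makes them eigenvectors.\<close>
    have eig: "(\<Sum>y\<in>X. b y * col y x) = of_int c * b x" if b: "b \<in> B" for b x
    proof -
      obtain z where z: "z \<in> X" "b = col z" using b B(1) by blast
      show ?thesis
      proof (cases "x \<in> X")
        case True
        have "(\<Sum>y\<in>X. b y * col y x) = of_int (\<Sum>y\<in>X. M x y * M y z)"
          using True z by (simp add: col_def mult.commute)
        then show ?thesis using sq[OF True z(1)] True z by (simp add: col_def)
      qed (simp add: col_def z)
    qed
    \<comment> \<open>Expanding the eigenvector equation in the basis \<open>B\<close> and comparing
      coefficients gives \<Phi> B = c.\<close>
    have coef: "(\<Sum>y\<in>X. b y * \<phi> y b') = (if b' = b then of_int c else 0)" if b: "b \<in> B" "b' \<in> B" for b b'
    proof -
      let ?f = "\<lambda>b'. (\<Sum>y\<in>X. b y * \<phi> y b') - (if b' = b then of_int c else 0)"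
      have "(\<Sum>b'\<in>B. (\<lambda>x. ?f b' * b' x)) = 0"
      proof
        fix x
        have "(\<Sum>b'\<in>B. ?f b' * b' x) = (\<Sum>b'\<in>B. (\<Sum>y\<in>X. b y * \<phi> y b') * b' x) - (\<Sum>b'\<in>B. if b' = b then of_int c * b x else 0)"
          unfolding sum_subtractf[symmetric] by (intro sum.cong) (auto simp: left_diff_distrib)
        also have "(\<Sum>b'\<in>B. if b' = b then of_int c * b x else 0) = of_int c * b x"
          using b(1) finB by simp
        also have "(\<Sum>b'\<in>B. (\<Sum>y\<in>X. b y * \<phi> y b') * b' x) = (\<Sum>y\<in>X. b y * (\<Sum>b'\<in>B. \<phi> y b' * b' x))"
          unfolding sum_distrib_left sum_distrib_right by (subst sum.swap) (simp add: mult.assoc)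
        also have "\<dots> = (\<Sum>y\<in>X. b y * col y x)"
          by (intro sum.cong refl) (simp add: \<phi> sum_apply)
        also have "\<dots> = of_int c * b x" by (rule eig[OF b(1)])
        finally show "(\<Sum>b'\<in>B. (\<lambda>x. ?f b' * b' x)) x = 0 x" by (simp add: sum_apply)
      qed
      then have "?f b' = 0" by (rule fun_vs.independentD[OF B(2) finB order_refl _ b(2)])
      then show ?thesis by simp
    qed
    have "of_int (\<Sum>x\<in>X. M x x) = (\<Sum>y\<in>X. col y y)" by (simp add: col_def)
    also have "\<dots> = (\<Sum>y\<in>X. \<Sum>b\<in>B. b y * \<phi> y b)"
      by (intro sum.cong refl) (simp add: \<phi> sum_apply mult.commute)
    also have "\<dots> = (\<Sum>b\<in>B. \<Sum>y\<in>X. b y * \<phi> y b)" by (rule sum.swap)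
    also have "\<dots> = (\<Sum>b\<in>B. of_int c)" by (intro sum.cong refl) (simp add: coef)
    finally show ?thesis by simp
  qed
  ultimately show ?thesis using c by (metis mult_le_cancel_left_pos of_int_eq_iff of_nat_le_iff)
qed

text \<open>
  Reduction modulo \<open>p\<close> can only lower the ranks of \<open>M\<close> and of \<open>c - M\<close>. Over the rationals these ranks add up
  to \<open>card X\<close>, and over the given field their sum is at least that, so neither drops.
\<close>

lemma (in vector_space) ex_column_basis:
  fixes M :: "'i \<Rightarrow> 'i \<Rightarrow> int" and c :: int and d :: "'i \<Rightarrow> 'b"
  assumes X: "finite X" and d: "inj_on d X" "independent (d ` X)"
    and p: "CHAR('a) > 0" and c: "c > 0" "of_int c \<noteq> (0::'a)"
    and sq: "\<And>x z. x \<in> X \<Longrightarrow> z \<in> X \<Longrightarrow> (\<Sum>y\<in>X. M x y * M y z) = c * M x z"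
    and col: "\<And>y. y \<in> X \<Longrightarrow> col y = (\<Sum>x\<in>X. scale (of_int (M x y)) (d x))"
  shows "\<exists>B\<subseteq>col ` X. independent B \<and> col ` X \<subseteq> span B \<and> c * int (card B) = (\<Sum>x\<in>X. M x x)"
proof -
  have bound: "\<exists>B\<subseteq>cl ` X. independent B \<and> cl ` X \<subseteq> span B \<and> finite B \<and> c * int (card B) \<le> (\<Sum>x\<in>X. N x x)"
    if sqN: "\<And>x z. x \<in> X \<Longrightarrow> z \<in> X \<Longrightarrow> (\<Sum>y\<in>X. N x y * N y z) = c * N x z"
      and cl: "\<And>y. y \<in> X \<Longrightarrow> cl y = (\<Sum>x\<in>X. scale (of_int (N x y)) (d x))"
    for N :: "'i \<Rightarrow> 'i \<Rightarrow> int" and cl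
  proof -
    obtain B where B: "B \<subseteq> cl ` X" "independent B" "cl ` X \<subseteq> span B"
      using maximal_independent_subset[of "cl ` X"] by metis
    \<comment> \<open>One column index is chosen for each basis vector, so that a relation among
      indexed columns is one among vectors of \<open>B\<close>.\<close>
    obtain J where J: "J \<subseteq> X" "inj_on cl J" "B = cl ` J" using B(1) by (meson subset_image_inj)
    have finJ: "finite J" using J(1) X by (rule finite_subset)
    have indF: "\<forall>j\<in>J. b j = 0" if rel: "\<forall>x\<in>X. (\<Sum>j\<in>J. b j * of_int (N x j)) = 0" for b :: "'i \<Rightarrow> 'a"
    proof -
      have "(\<Sum>j\<in>J. scale (b j) (cl j)) = (\<Sum>j\<in>J. \<Sum>x\<in>X. scale (b j * of_int (N x j)) (d x))"
        using J(1) by (intro sum.cong refl) (auto simp: cl scale_sum_right)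
      also have "\<dots> = (\<Sum>x\<in>X. \<Sum>j\<in>J. scale (b j * of_int (N x j)) (d x))" by (rule sum.swap)
      also have "\<dots> = (\<Sum>x\<in>X. scale (\<Sum>j\<in>J. b j * of_int (N x j)) (d x))" by (simp add: scale_sum_left)
      also have "\<dots> = 0" using rel by simp
      finally have 0: "(\<Sum>v\<in>B. scale (b (the_inv_into J cl v)) v) = 0"
        unfolding J(3) by (simp add: sum.reindex[OF J(2)] the_inv_into_f_f[OF J(2)])
      show ?thesis
      proof
        fix j assume j: "j \<in> J"
        have "b (the_inv_into J cl (cl j)) = 0"
          using independentD[OF B(2) _ order_refl 0, of "cl j"] J(3) finJ j by simp
        then show "b j = 0" using the_inv_into_f_f[OF J(2) j] by simp
      qed
    qed
    have "c * int (card J) \<le> (\<Sum>x\<in>X. N x x)"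
    proof (rule card_indep_columns_le_trace[OF X J(1) c(1) sqN])
      fix a :: "'i \<Rightarrow> rat" assume rel: "\<forall>x\<in>X. (\<Sum>j\<in>J. a j * of_int (N x j)) = 0"
      show "\<forall>j\<in>J. a j = 0"
      proof (rule rat_indep_if_indep_char_p[OF finJ p _ rel])
        fix b :: "'i \<Rightarrow> 'a" assume "\<forall>x\<in>X. (\<Sum>j\<in>J. b j * of_int (N x j)) = 0"
        then show "\<forall>j\<in>J. b j = 0" by (rule indF)
      qed
    qed
    then show ?thesis using B J finJ by (intro exI[of _ B]) (auto simp: card_image)
  qed
  obtain B where B: "B \<subseteq> col ` X" "independent B" "col ` X \<subseteq> span B" "finite B"
    "c * int (card B) \<le> (\<Sum>x\<in>X. M x x)" using bound[OF sq col] by blast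
  \<comment> \<open>The complementary matrix satisfies the same relation: (c - M)(c - M) = c (c -
    M).\<close>
  define N where "N x y = (if x = y then c else 0) - M x y" for x y
  define cl where "cl y = (\<Sum>x\<in>X. scale (of_int (N x y)) (d x))" for y
  have sqN: "(\<Sum>y\<in>X. N x y * N y z) = c * N x z" if "x \<in> X" "z \<in> X" for x z
  proof -
    have "(\<Sum>y\<in>X. N x y * N y z) = (\<Sum>y\<in>X. (if x = y then c * N y z else 0) - (if y = z then M x y * c else 0) + M x y * M y z)"
      by (intro sum.cong refl) (auto simp: N_def algebra_simps)
    also have "\<dots> = c * N x z - M x z * c + c * M x z"
      using that X by (simp add: sum.distrib sum_subtractf sq)
    finally show ?thesis by simp
  qed
  obtain B' where B': "cl ` X \<subseteq> span B'" "finite B'" "c * int (card B') \<le> (\<Sum>x\<in>X. N x x)"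
    using bound[of N cl, OF sqN cl_def] by blast
  \<comment> \<open>The multiple of \<open>d y\<close> by c is the sum of a column of M and a column
    of c - M, and c is invertible in the field.\<close>
  have "d ` X \<subseteq> span (B \<union> B')"
  proof
    fix v assume "v \<in> d ` X"
    then obtain y where y: "y \<in> X" "v = d y" by blast
    have "col y + cl y = (\<Sum>x\<in>X. if x = y then scale (of_int c) (d y) else 0)"
      unfolding col[OF y(1)] cl_def sum.distrib[symmetric] scale_left_distrib[symmetric] of_int_add[symmetric]
      by (intro sum.cong refl) (auto simp: N_def)
    then have "col y + cl y = scale (of_int c) (d y)" using y X by simp
    then have "scale (1 / of_int c) (col y + cl y) = d y" using c(2) by simp
    moreover have "col y \<in> span (B \<union> B')" "cl y \<in> span (B \<union> B')"
      using B(3) B'(1) y span_mono[of B "B \<union> B'"] span_mono[of B' "B \<union> B'"] by auto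
    ultimately show "v \<in> span (B \<union> B')" using y by (metis span_add span_scale)
  qed
  then have "card (d ` X) \<le> card (B \<union> B')"
    using independent_span_bound[OF _ d(2), of "B \<union> B'"] B(4) B'(2) by simp
  then have "card X \<le> card B + card B'" using card_Un_le[of B B'] by (simp add: card_image[OF d(1)])
  then have "c * int (card X) \<le> c * int (card B) + c * int (card B')"
    using c(1) by (metis distrib_left mult_left_mono of_nat_add of_nat_le_iff order_less_imp_le)
  moreover have "(\<Sum>x\<in>X. N x x) = c * int (card X) - (\<Sum>x\<in>X. M x x)"
    by (simp add: N_def sum_subtractf)
  ultimately have "c * int (card B) = (\<Sum>x\<in>X. M x x)" using B(5) B'(3) by linarith
  then show ?thesis using B by blast
qed

section \<open>Permutations of given cycle type\<close>

definition orbits_on :: "'b set \<Rightarrow> ('b \<Rightarrow> 'b) \<Rightarrow> 'b set set" where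
  "orbits_on S f = orbit f ` S"

definition cycle_type_on :: "'b set \<Rightarrow> ('b \<Rightarrow> 'b) \<Rightarrow> nat multiset" where
  "cycle_type_on S f = image_mset card (mset_set (orbits_on S f))"

text \<open>\<open>orbit_of\<close> starts with the zeroth power and \<open>orbit\<close> with the
  first; for a permutation of a finite set both give the cycle through the point.\<close>

lemma cycle_type_eq:
  assumes "f \<in> perms n"
  shows "cycle_type n f = cycle_type_on {1..n} f"
proof -
  have "permutation f" using assms by (intro permutes_imp_permutation[of "{1..n}"]) (auto simp: perms_def)
  then have "orbit_of f i = orbit f i" for i unfolding orbit_of_def by (simp add: orbit_altdef_permutation)
  then have "{orbit_of f i | i. i \<in> {1..n}} = orbit f ` {1..n}" by (simp only:) blast
  then show ?thesis unfolding cycle_type_def cycle_type_on_def orbits_on_def by (simp only:)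
qed

lemma orbit_eq_if_mem:
  assumes "permutation f" "s \<in> orbit f t"
  shows "orbit f s = orbit f t"
proof
  have "t \<in> orbit f s" using orbit_swap[OF permutation_self_in_orbit[OF assms(1)] assms(2)] .
  then show "orbit f t \<subseteq> orbit f s" by (auto intro: orbit_trans)
  show "orbit f s \<subseteq> orbit f t" using assms(2) by (auto intro: orbit_trans)
qed

section \<open>Inserting a new point into a cycle\<close>

context
  fixes S :: "'b set" and f :: "'b \<Rightarrow> 'b" and a b :: 'b
  assumes fin: "finite S" and f: "f permutes S" and a: "a \<notin> S" and b: "b \<in> S"
begin

lemma permutation_base: "permutation f"
  using f fin by (rule permutes_imp_permutation[rotated])

lemma permutation_insert: "permutation (transpose a b \<circ> f)"
  by (intro permutation_compose permutation_base permutation_swap_id)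

text \<open>The composition inserts a into the cycle of b directly before b: the predecessor of b
  now goes to a, and a goes to b.\<close>

lemma transpose_comp_apply:
  "(transpose a b \<circ> f) a = b"
  "x \<in> S \<Longrightarrow> (transpose a b \<circ> f) x = (if f x = b then a else f x)"
proof -
  have "f a = a" using f a by (rule permutes_not_in)
  then show "(transpose a b \<circ> f) a = b" by simp
  assume "x \<in> S"
  then have "f x \<in> S" using f by (simp add: permutes_in_image)
  then show "(transpose a b \<circ> f) x = (if f x = b then a else f x)" using a by (auto simp: transpose_def)
qed

lemma orbit_insert_b: "orbit (transpose a b \<circ> f) b = insert a (orbit f b)"
proof -
  let ?g = "transpose a b \<circ> f"
  have OS: "orbit f b \<subseteq> S" by (rule permutes_orbit_subset[OF f b])
  have self: "b \<in> orbit f b" "b \<in> orbit ?g b"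
    by (rule permutation_self_in_orbit, rule permutation_base permutation_insert)+
  have closed: "?g x \<in> insert a (orbit f b)" if "x \<in> insert a (orbit f b)" for x
  proof (cases "x = a")
    case True
    then show ?thesis using transpose_comp_apply(1) self by simp
  next
    case False
    then have x: "x \<in> orbit f b" "x \<in> S" using that OS by auto
    show ?thesis unfolding transpose_comp_apply(2)[OF x(2)] using orbit.step[OF x(1)] by auto
  qed
  have sub1: "x \<in> insert a (orbit f b)" if "x \<in> orbit ?g b" for x
    using that by induction (use closed self in blast)+
  have closed': "f y \<in> orbit ?g b" if "y \<in> S" "y \<in> orbit ?g b" for y
    using orbit.step[OF that(2)] transpose_comp_apply(2)[OF that(1)] self(2) by (cases "f y = b") auto
  have sub2: "x \<in> orbit ?g b \<and> x \<in> S" if "x \<in> orbit f b" for x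
    using that
  proof induction
    case base
    then show ?case using closed'[OF b self(2)] permutes_in_image[OF f, of b] b by blast
  next
    case (step y)
    then show ?case using closed' permutes_in_image[OF f, of y] by blast
  qed
  \<comment> \<open>The predecessor of \<open>b\<close> in its cycle, which the new permutation
    sends to \<open>a\<close>.\<close>
  obtain y where y: "y \<in> orbit f b" "f y = b"
    using self(1) by (cases rule: orbit.cases) (use self in auto)
  have "?g y = a" using transpose_comp_apply(2)[of y] y sub2 by auto
  then have "a \<in> orbit ?g b" using orbit.step[of y ?g b] sub2[OF y(1)] by simp
  then show ?thesis using sub1 sub2 by blast
qed

lemma orbit_insert_other:
  assumes i: "i \<in> S" "i \<notin> orbit f b"
  shows "orbit (transpose a b \<circ> f) i = orbit f i"
proof (rule orbit_cong)
  show "i \<in> orbit f i" by (rule permutation_self_in_orbit[OF permutation_base])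
  fix s assume s: "s \<in> orbit f i"
  then have sS: "s \<in> S" using permutes_orbit_subset[OF f i(1)] by blast
  have "f s \<noteq> b"
  proof
    assume "f s = b"
    then have "b \<in> orbit f i" using orbit.step[OF s] by simp
    then have "orbit f b = orbit f i" by (rule orbit_eq_if_mem[OF permutation_base])
    then show False using i(2) permutation_self_in_orbit[OF permutation_base, of i] by simp
  qed
  then show "(transpose a b \<circ> f) s = f s" using transpose_comp_apply(2)[OF sS] by simp
qed

lemma orbits_on_insert:
  "orbits_on (insert a S) (transpose a b \<circ> f) = insert (insert a (orbit f b)) (orbits_on S f - {orbit f b})"
proof -
  let ?g = "transpose a b \<circ> f"
  have OS: "orbit f b \<subseteq> S" by (rule permutes_orbit_subset[OF f b])
  have in': "orbit ?g i = insert a (orbit f b)" if "i \<in> insert a (orbit f b)" for i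
    using orbit_eq_if_mem[OF permutation_insert, of i b] that unfolding orbit_insert_b by blast
  have self: "i \<in> orbit f i" for i by (rule permutation_self_in_orbit[OF permutation_base])
  have iff: "orbit f i = orbit f b \<longleftrightarrow> i \<in> orbit f b" for i
    using orbit_eq_if_mem[OF permutation_base] self by blast
  have "insert a S = insert a (orbit f b) \<union> (S - orbit f b)" using OS by blast
  then have "orbits_on (insert a S) ?g = orbit ?g ` insert a (orbit f b) \<union> orbit ?g ` (S - orbit f b)"
    unfolding orbits_on_def by (simp only: image_Un)
  also have "orbit ?g ` insert a (orbit f b) = {insert a (orbit f b)}" using in' by blast
  also have "orbit ?g ` (S - orbit f b) = orbit f ` (S - orbit f b)"
    using orbit_insert_other by (intro image_cong) auto
  also have "orbit f ` (S - orbit f b) = orbits_on S f - {orbit f b}"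
    unfolding orbits_on_def using iff by blast
  finally show ?thesis by (simp only: Un_insert_left Un_empty_left)
qed

text \<open>Only the cycle of b changes, growing by one. Adding its old length on the left avoids a
  subtraction of multisets.\<close>

lemma cycle_type_on_insert:
  "add_mset (card (orbit f b)) (cycle_type_on (insert a S) (transpose a b \<circ> f)) =
    add_mset (Suc (card (orbit f b))) (cycle_type_on S f)"
proof -
  have OS: "orbit f b \<subseteq> S" by (rule permutes_orbit_subset[OF f b])
  have fo: "finite (orbits_on S f)" using fin by (simp add: orbits_on_def)
  have mem: "orbit f b \<in> orbits_on S f" using b by (simp add: orbits_on_def)
  have nin: "insert a (orbit f b) \<notin> orbits_on S f - {orbit f b}"
    using permutes_orbit_subset[OF f] a by (auto simp: orbits_on_def)
  have "a \<notin> orbit f b" using OS a by blast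
  moreover have "finite (orbit f b)" using OS fin by (rule finite_subset)
  ultimately have "card (insert a (orbit f b)) = Suc (card (orbit f b))" by simp
  then have "cycle_type_on (insert a S) (transpose a b \<circ> f) =
    add_mset (Suc (card (orbit f b))) (image_mset card (mset_set (orbits_on S f - {orbit f b})))"
    unfolding cycle_type_on_def orbits_on_insert using fo nin by simp
  moreover have "cycle_type_on S f = add_mset (card (orbit f b)) (image_mset card (mset_set (orbits_on S f - {orbit f b})))"
    unfolding cycle_type_on_def using fo mem by (subst mset_set.remove[of _ "orbit f b"]) auto
  ultimately show ?thesis by (simp add: add_mset_commute)
qed

end

lemma cycle_type_on_insert_fixed:
  assumes fin: "finite S" and f: "f permutes S" and a: "a \<notin> S"
  shows "cycle_type_on (insert a S) f = add_mset 1 (cycle_type_on S f)"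
proof -
  have "f a = a" using f a by (rule permutes_not_in)
  have "x = a" if "x \<in> orbit f a" for x using that by induction (simp_all add: \<open>f a = a\<close>)
  then have "orbit f a = {a}" using orbit_nonempty[of f a] by blast
  moreover have "{a} \<notin> orbits_on S f" using permutes_orbit_subset[OF f] a by (auto simp: orbits_on_def)
  ultimately show ?thesis using fin unfolding cycle_type_on_def by (simp add: orbits_on_def)
qed

text \<open>Counts the points at which an insertion lengthens a cycle of length i: the cycles of
  this length are disjoint and have i points each.\<close>

lemma card_orbit_size:
  assumes fin: "finite S" and f: "f permutes S"
  shows "card {b\<in>S. card (orbit f b) = i} = i * count (cycle_type_on S f) i"
proof -
  have perm: "permutation f" using f fin by (rule permutes_imp_permutation[rotated])
  let ?O = "{A \<in> orbits_on S f. card A = i}"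
  have fo: "finite (orbits_on S f)" using fin by (simp add: orbits_on_def)
  have self: "j \<in> orbit f j" for j by (rule permutation_self_in_orbit[OF perm])
  have "{b\<in>S. card (orbit f b) = i} = \<Union> ?O"
  proof (intro set_eqI iffI)
    fix x assume "x \<in> {b\<in>S. card (orbit f b) = i}"
    then show "x \<in> \<Union> ?O" using self[of x] by (auto simp: orbits_on_def)
  next
    fix x assume "x \<in> \<Union> ?O"
    then obtain j where j: "j \<in> S" "card (orbit f j) = i" "x \<in> orbit f j" by (auto simp: orbits_on_def)
    then show "x \<in> {b\<in>S. card (orbit f b) = i}"
      using permutes_orbit_subset[OF f j(1)] orbit_eq_if_mem[OF perm j(3)] by auto
  qed
  also have "card (\<Union> ?O) = (\<Sum>A\<in>?O. card A)"
  proof (rule card_Union_disjoint)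
    show "pairwise disjnt ?O"
    proof (rule pairwiseI)
      fix A B assume "A \<in> ?O" "B \<in> ?O" "A \<noteq> B"
      moreover from this obtain j k where "A = orbit f j" "B = orbit f k" by (auto simp: orbits_on_def)
      ultimately show "disjnt A B" using orbit_eq_if_mem[OF perm] unfolding disjnt_def by blast
    qed
    fix A assume "A \<in> ?O"
    then have "A \<subseteq> S" using permutes_orbit_subset[OF f] by (auto simp: orbits_on_def)
    then show "finite A" using fin by (rule finite_subset)
  qed
  also have "\<dots> = i * card ?O" by simp
  also have "card ?O = count (cycle_type_on S f) i"
  proof -
    have "count (cycle_type_on S f) i = size (filter_mset (\<lambda>A. card A = i) (mset_set (orbits_on S f)))"
      unfolding cycle_type_on_def by (rule size_filter_mset_eq[symmetric])
    then show ?thesis using fo by simp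
  qed
  finally show ?thesis .
qed

definition perms_of_type :: "'b set \<Rightarrow> nat multiset \<Rightarrow> ('b \<Rightarrow> 'b) set" where
  "perms_of_type S lam = {f. f permutes S \<and> cycle_type_on S f = lam}"

lemma finite_perms_of_type: "finite S \<Longrightarrow> finite (perms_of_type S lam)"
  unfolding perms_of_type_def by (rule finite_subset[OF _ finite_permutations]) auto

text \<open>Each permutation of the larger set is \<open>transpose a b \<circ> f\<close> for a
  unique f on S and a unique b, namely the image of a; the case b = a is that of a fixed
  point.\<close>

lemma card_permutes_insert:
  assumes fin: "finite S" and a: "a \<notin> S"
  shows "card {g. g permutes insert a S \<and> P g} =
    (\<Sum>b\<in>insert a S. card {f. f permutes S \<and> P (transpose a b \<circ> f)})"
proof -
  let ?F = "\<lambda>(b, f). transpose a b \<circ> f"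
  let ?D = "Sigma (insert a S) (\<lambda>b. {f. f permutes S \<and> P (transpose a b \<circ> f)})"
  have "{g. g permutes insert a S \<and> P g} = ?F ` ?D"
    using permutes_insert[of a S] by (auto simp: set_eq_iff image_iff)
  moreover have "inj_on ?F ?D"
  proof (rule inj_onI)
    fix u v assume uv: "u \<in> ?D" "v \<in> ?D" "?F u = ?F v"
    obtain b f where u: "u = (b, f)" "f permutes S" using uv(1) by auto
    obtain c h where v: "v = (c, h)" "h permutes S" using uv(2) by auto
    have eq: "transpose a b \<circ> f = transpose a c \<circ> h" using uv(3) u v by simp
    have "f a = a" "h a = a" using u v a by (auto intro: permutes_not_in)
    then have bc: "b = c" using fun_cong[OF eq, of a] by simp
    have "transpose a b \<circ> (transpose a b \<circ> f) = transpose a b \<circ> (transpose a b \<circ> h)" using eq bc by simp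
    then have "f = h" by (simp add: comp_assoc[symmetric])
    then show "u = v" using u v bc by simp
  qed
  ultimately have "card {g. g permutes insert a S \<and> P g} = card ?D" by (simp add: card_image)
  also have "\<dots> = (\<Sum>b\<in>insert a S. card {f. f permutes S \<and> P (transpose a b \<circ> f)})"
    using fin by (intro card_SigmaI) (auto intro: finite_subset[OF _ finite_permutations[OF fin]])
  finally show ?thesis .
qed

lemma lam_q_add_mset: "lam_q (add_mset j R) = j * Suc (count R j) * lam_q R"
proof -
  obtain q where q: "mset q = R" using ex_mset by blast
  have "lam_q (mset (j # q)) = j * prod_list q * (Suc (count R j) * brfact R)"
    unfolding lam_q_eq using q by (simp add: brfact_add_mset)
  then show ?thesis using lam_q_eq[of q] q by (simp add: algebra_simps)
qed

text \<open>Classifies by the length j of the cycle through a. For j > 1, deleting a leaves a cycle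
  of length j - 1; conversely, a can be inserted before any point that lies in a cycle of length j -
  1 of the smaller permutation.\<close>

lemma card_perms_of_type_insert:
  assumes fin: "finite S" and a: "a \<notin> S" and lam: "0 \<notin># lam"
  shows "card (perms_of_type (insert a S) lam) =
    (\<Sum>j\<in>set_mset lam. if j = 1 then card (perms_of_type S (lam - {#1#}))
      else card (perms_of_type S (add_mset (j - 1) (lam - {#j#}))) * ((j - 1) * count (add_mset (j - 1) (lam - {#j#})) (j - 1)))"
proof -
  let ?\<mu> = "\<lambda>j. add_mset (j - 1) (lam - {#j#})"
  let ?T = "\<lambda>b. {f. f permutes S \<and> cycle_type_on (insert a S) (transpose a b \<circ> f) = lam}"
  have finP: "finite {f. f permutes S \<and> Q f}" for Q
    by (rule finite_subset[OF _ finite_permutations[OF fin]]) auto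
  have "card (perms_of_type (insert a S) lam) =
    (\<Sum>b\<in>insert a S. card (?T b))"
    unfolding perms_of_type_def by (rule card_permutes_insert[OF fin a])
  also have "\<dots> = card {f. f permutes S \<and> cycle_type_on (insert a S) f = lam} +
    (\<Sum>b\<in>S. card (?T b))"
    using fin a by simp
  also have "card {f. f permutes S \<and> cycle_type_on (insert a S) f = lam} =
     (if 1 \<in># lam then card (perms_of_type S (lam - {#1#})) else 0)"
  proof -
    have "f permutes S \<and> cycle_type_on (insert a S) f = lam \<longleftrightarrow>
      f permutes S \<and> 1 \<in># lam \<and> cycle_type_on S f = lam - {#1#}" for f
      using cycle_type_on_insert_fixed[OF fin _ a, of f] by (auto simp: insert_DiffM)
    then show ?thesis by (auto simp: perms_of_type_def)
  qed
  also have "(\<Sum>b\<in>S. card (?T b)) =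
    (\<Sum>b\<in>S. \<Sum>j\<in>set_mset lam - {1}. card {f\<in>perms_of_type S (?\<mu> j). card (orbit f b) = j - 1})"
  proof (rule sum.cong[OF refl])
    fix b assume b: "b \<in> S"
    let ?A = "\<lambda>j. {f\<in>perms_of_type S (?\<mu> j). card (orbit f b) = j - 1}"
    have "?T b = (\<Union>j\<in>set_mset lam - {1}. ?A j)"
    proof (intro set_eqI iffI)
      fix f assume "f \<in> ?T b"
      then have f: "f permutes S" and t: "cycle_type_on (insert a S) (transpose a b \<circ> f) = lam" by auto
      let ?i = "card (orbit f b)"
      have e: "add_mset ?i lam = add_mset (Suc ?i) (cycle_type_on S f)"
        using cycle_type_on_insert[OF fin f a b] t by simp
      have "Suc ?i \<in># add_mset ?i lam" unfolding e by simp
      then have j: "Suc ?i \<in># lam" by simp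
      have "lam = add_mset (Suc ?i) (lam - {#Suc ?i#})" using j by simp
      then have "add_mset (Suc ?i) (add_mset ?i (lam - {#Suc ?i#})) = add_mset (Suc ?i) (cycle_type_on S f)"
        using e by (metis add_mset_commute)
      then have ct: "cycle_type_on S f = ?\<mu> (Suc ?i)" by simp
      have "finite (orbit f b)" using permutes_orbit_subset[OF f b] fin by (rule finite_subset)
      then have "?i \<noteq> 0" using orbit_nonempty[of f b] by simp
      then show "f \<in> (\<Union>j\<in>set_mset lam - {1}. ?A j)"
        using j ct f by (intro UN_I[of "Suc ?i"]) (auto simp: perms_of_type_def)
    next
      fix f assume "f \<in> (\<Union>j\<in>set_mset lam - {1}. ?A j)"
      then obtain j where j: "j \<in># lam" "j \<noteq> 1" and f: "f permutes S" and t: "cycle_type_on S f = ?\<mu> j"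
        and c: "card (orbit f b) = j - 1" by (auto simp: perms_of_type_def)
      \<comment> \<open>Parts are positive, so j - 1 is not truncated.\<close>
      have "j \<noteq> 0" using j lam by metis
      then have S: "Suc (j - 1) = j" by simp
      have "add_mset (j - 1) (cycle_type_on (insert a S) (transpose a b \<circ> f)) = add_mset j (?\<mu> j)"
        using cycle_type_on_insert[OF fin f a b] c S t by simp
      also have "\<dots> = add_mset (j - 1) lam" using j(1) by (simp add: add_mset_commute[of j])
      finally show "f \<in> ?T b" using f by simp
    qed
    moreover have "card (\<Union>j\<in>set_mset lam - {1}. ?A j) = (\<Sum>j\<in>set_mset lam - {1}. card (?A j))"
    proof (rule card_UN_disjoint)
      show "\<forall>i\<in>set_mset lam - {1}. \<forall>j\<in>set_mset lam - {1}. i \<noteq> j \<longrightarrow> ?A i \<inter> ?A j = {}"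
      proof (intro ballI impI)
        fix i j assume ij: "i \<in> set_mset lam - {1}" "j \<in> set_mset lam - {1}" "i \<noteq> j"
        then have "i \<noteq> 0" "j \<noteq> 0" using lam by (metis DiffD1)+
        then have "i - 1 \<noteq> j - 1" using ij(3) by linarith
        then show "?A i \<inter> ?A j = {}" by auto
      qed
    qed (auto intro: finite_subset[OF _ finite_perms_of_type[OF fin]])
    ultimately show "card (?T b) =
      (\<Sum>j\<in>set_mset lam - {1}. card (?A j))" by simp
  qed
  \<comment> \<open>Pairs of a permutation and a point are counted in two ways; for each permutation
    the number of admissible points depends only on its cycle type.\<close>
  also have "\<dots> = (\<Sum>j\<in>set_mset lam - {1}. card (perms_of_type S (?\<mu> j)) * ((j - 1) * count (?\<mu> j) (j - 1)))"
  proof (subst sum.swap, rule sum.cong[OF refl])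
    fix j
    have "(\<Sum>b\<in>S. card {f\<in>perms_of_type S (?\<mu> j). card (orbit f b) = j - 1}) =
      (\<Sum>b\<in>S. \<Sum>f\<in>perms_of_type S (?\<mu> j). if card (orbit f b) = j - 1 then 1 else 0)"
      by (intro sum.cong refl) (simp add: sum.If_cases finite_perms_of_type[OF fin] Int_def)
    also have "\<dots> = (\<Sum>f\<in>perms_of_type S (?\<mu> j). \<Sum>b\<in>S. if card (orbit f b) = j - 1 then 1 else 0)" by (rule sum.swap)
    also have "\<dots> = (\<Sum>f\<in>perms_of_type S (?\<mu> j). (j - 1) * count (?\<mu> j) (j - 1))"
    proof (rule sum.cong[OF refl])
      fix f assume "f \<in> perms_of_type S (?\<mu> j)"
      then have f: "f permutes S" "cycle_type_on S f = ?\<mu> j" by (auto simp: perms_of_type_def)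
      have "(\<Sum>b\<in>S. if card (orbit f b) = j - 1 then 1 else 0) = card {b\<in>S. card (orbit f b) = j - 1}"
        using fin by (simp add: sum.If_cases Int_def)
      then show "(\<Sum>b\<in>S. if card (orbit f b) = j - 1 then 1 else 0) = (j - 1) * count (?\<mu> j) (j - 1)"
        using card_orbit_size[OF fin f(1), of "j - 1"] f(2) by (simp only:)
    qed
    finally show "(\<Sum>b\<in>S. card {f\<in>perms_of_type S (?\<mu> j). card (orbit f b) = j - 1}) =
      card (perms_of_type S (?\<mu> j)) * ((j - 1) * count (?\<mu> j) (j - 1))" by simp
  qed
  finally have total: "card (perms_of_type (insert a S) lam) = (if 1 \<in># lam then card (perms_of_type S (lam - {#1#})) else 0) +
    (\<Sum>j\<in>set_mset lam - {1}. card (perms_of_type S (?\<mu> j)) * ((j - 1) * count (?\<mu> j) (j - 1)))" .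
  let ?G = "\<lambda>j. if j = 1 then card (perms_of_type S (lam - {#1#}))
      else card (perms_of_type S (?\<mu> j)) * ((j - 1) * count (?\<mu> j) (j - 1))"
  have rest: "(\<Sum>j\<in>set_mset lam - {1}. ?G j) =
    (\<Sum>j\<in>set_mset lam - {1}. card (perms_of_type S (?\<mu> j)) * ((j - 1) * count (?\<mu> j) (j - 1)))"
    by (rule sum.cong) auto
  have "(\<Sum>j\<in>set_mset lam. ?G j) = (if 1 \<in># lam then ?G 1 else 0) + (\<Sum>j\<in>set_mset lam - {1}. ?G j)"
  proof (cases "1 \<in># lam")
    case True
    then show ?thesis using sum.remove[of "set_mset lam" 1 ?G] by (simp only: if_True finite_set_mset)
  next
    case False
    then have "set_mset lam - {1} = set_mset lam" by blast
    then show ?thesis using False by (simp only: if_False add_0)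
  qed
  then show ?thesis unfolding total rest by simp
qed

lemma sum_count_mult:
  "finite S \<Longrightarrow> set_mset M \<subseteq> S \<Longrightarrow> (\<Sum>j\<in>S. count M j * j) = sum_mset (M :: nat multiset)"
proof (induction M)
  case (add x M)
  have "(\<Sum>j\<in>S. count (add_mset x M) j * j) = (\<Sum>j\<in>S. count M j * j + (if j = x then j else 0))"
    by (rule sum.cong) auto
  also have "\<dots> = sum_mset M + x" using add by (simp add: sum.distrib)
  finally show ?case by simp
qed simp

text \<open>Multiplied by \<lambda>?, the summand for cycle length j becomes j m_j times the
  factorial of the size of the smaller set, by induction; the sum of all j m_j is the size of the
  enlarged set.\<close>

lemma card_perms_of_type:
  fixes S :: "'b set"
  assumes "finite S" "0 \<notin># lam" "sum_mset lam = card S"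
  shows "lam_q lam * card (perms_of_type S lam) = fact (card S)"
  using assms
proof (induction S arbitrary: lam rule: finite_induct)
  case empty
  then have "lam = {#}" by (metis card.empty multiset_nonemptyE sum_mset_0_iff union_single_eq_member)
  moreover have "perms_of_type ({} :: 'b set) {#} = {id}" by (auto simp: perms_of_type_def cycle_type_on_def orbits_on_def)
  ultimately show ?case by (simp add: lam_q_def)
next
  case (insert a S)
  have summand: "lam_q lam * (if j = 1 then card (perms_of_type S (lam - {#1#}))
      else card (perms_of_type S (add_mset (j - 1) (lam - {#j#}))) * ((j - 1) * count (add_mset (j - 1) (lam - {#j#})) (j - 1)))
      = j * count lam j * fact (card S)" if j: "j \<in># lam" for j
  proof -
    define R where "R = lam - {#j#}"
    have lam: "lam = add_mset j R" using j by (simp add: R_def)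
    have lq: "lam_q lam = j * count lam j * lam_q R" unfolding lam lam_q_add_mset by simp
    have R0: "0 \<notin># R" using insert.prems(1) lam by simp
    have j0: "j \<noteq> 0" using j insert.prems(1) by metis
    have sum: "j + sum_mset R = Suc (card S)" using insert.prems(2) insert.hyps unfolding lam by simp
    show ?thesis
    proof (cases "j = 1")
      case True
      have "lam_q R * card (perms_of_type S R) = fact (card S)" using R0 sum True by (intro insert.IH) auto
      then show ?thesis using True lq unfolding R_def by (simp add: mult.assoc)
    next
      case False
      let ?\<mu> = "add_mset (j - 1) R"
      have "lam_q ?\<mu> * card (perms_of_type S ?\<mu>) = fact (card S)"
        using R0 sum False j0 by (intro insert.IH) auto
      moreover have "lam_q ?\<mu> = (j - 1) * count ?\<mu> (j - 1) * lam_q R" unfolding lam_q_add_mset by simp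
      ultimately have IH: "(j - 1) * count ?\<mu> (j - 1) * lam_q R * card (perms_of_type S ?\<mu>) = fact (card S)" by simp
      have "lam_q lam * (card (perms_of_type S ?\<mu>) * ((j - 1) * count ?\<mu> (j - 1))) =
        j * count lam j * ((j - 1) * count ?\<mu> (j - 1) * lam_q R * card (perms_of_type S ?\<mu>))"
        unfolding lq by (simp only: mult_ac)
      also have "\<dots> = j * count lam j * fact (card S)" unfolding IH ..
      finally show ?thesis using False unfolding R_def by (simp only: if_False)
    qed
  qed
  have "lam_q lam * card (perms_of_type (insert a S) lam) = (\<Sum>j\<in>set_mset lam. j * count lam j * fact (card S))"
    unfolding card_perms_of_type_insert[OF insert.hyps insert.prems(1)] sum_distrib_left
    by (rule sum.cong[OF refl summand])
  also have "\<dots> = fact (card S) * (\<Sum>j\<in>set_mset lam. count lam j * j)"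
    by (simp add: sum_distrib_left mult_ac)
  also have "(\<Sum>j\<in>set_mset lam. count lam j * j) = sum_mset lam"
    by (rule sum_count_mult) auto
  also have "fact (card S) * sum_mset lam = fact (card (insert a S))"
    using insert.prems(2) insert.hyps by (simp add: mult.commute)
  finally show ?case .
qed

section \<open>Right ideals\<close>

definition emb :: "('a::comm_ring_1) grp \<Rightarrow> 'a fmod" where
  "emb x = (\<lambda>i. if i = 0 then x else 0)"

lemma emb_add: "emb x + emb y = emb (x + y)"
  by (rule ext) (simp add: emb_def)

lemma emb_zero: "emb 0 = 0"
  by (rule ext) (simp add: emb_def)

lemma map_emb: "f 0 = 0 \<Longrightarrow> (\<lambda>i. f (emb x i)) = emb (f x)"
  by (rule ext) (simp add: emb_def)

lemma ract_emb: "ract n (emb x) a = emb (gmul n x a)"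
  unfolding ract_def by (rule map_emb) (rule gmul_linear_simps)

lemma rideal_emb: "rideal n x = {emb (gmul n x a) | a. a \<in> galg n}"
  unfolding rideal_def emb_def by simp

lemma rideal_memI: "a \<in> galg n \<Longrightarrow> emb (gmul n x a) \<in> rideal n x"
  unfolding rideal_emb by blast

lemma rideal_memE:
  assumes "v \<in> rideal n x"
  obtains a where "a \<in> galg n" "v = emb (gmul n x a)"
  using assms unfolding rideal_emb by blast

lemma emb_freemod: "x \<in> galg n \<Longrightarrow> emb x \<in> freemod n 1"
  by (auto simp: freemod_def emb_def galg_def)

lemma freemod_1E:
  assumes "v \<in> freemod n 1"
  obtains x where "x \<in> galg n" "v = emb x"
proof
  show "v 0 \<in> galg n" using assms by (simp add: freemod_def galg_def)
  show "v = emb (v 0)"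
  proof
    fix i
    show "v i = emb (v 0) i"
    proof (cases "i = 0")
      case False
      then have "v i \<sigma> = 0" for \<sigma> using assms by (simp add: freemod_def)
      then have "v i = 0" by (intro ext) simp
      then show ?thesis using False by (simp add: emb_def)
    qed (simp add: emb_def)
  qed
qed

lemma submod_freemod: "submod n 1 (freemod n 1 :: 'a::comm_ring_1 fmod set)"
  unfolding submod_def
proof (intro conjI ballI)
  show "0 \<in> (freemod n 1 :: 'a fmod set)" by (simp add: freemod_def)
  show "v + w \<in> freemod n 1" if "v \<in> freemod n 1" "w \<in> freemod n 1" for v w :: "'a fmod"
    using that by (simp add: freemod_def)
  fix v :: "'a fmod" and a :: "'a grp" assume "v \<in> freemod n 1"
  then obtain x where "v = emb x" by (elim freemod_1E)
  then show "ract n v a \<in> freemod n 1" by (simp only: ract_emb emb_freemod gmul_galg)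
qed simp

lemma submod_rideal: "submod n 1 (rideal n x)" for x :: "'a::comm_ring_1 grp"
  unfolding submod_def
proof (intro conjI ballI)
  show "rideal n x \<subseteq> freemod n 1"
  proof
    fix v assume "v \<in> rideal n x"
    then obtain a where "v = emb (gmul n x a)" by (elim rideal_memE)
    then show "v \<in> freemod n 1" by (simp only: emb_freemod gmul_galg)
  qed
  have "emb (gmul n x 0) \<in> rideal n x" by (rule rideal_memI[OF galg_zero])
  then show "0 \<in> rideal n x" unfolding gmul_linear_simps emb_zero .
next
  fix v w :: "'a fmod" assume "v \<in> rideal n x" "w \<in> rideal n x"
  then obtain a b where "a \<in> galg n" "b \<in> galg n" "v = emb (gmul n x a)" "w = emb (gmul n x b)"
    by (elim rideal_memE)
  then show "v + w \<in> rideal n x"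
    using rideal_memI[OF galg_add, of a n b x] unfolding gmul_linear_simps emb_add[symmetric] by simp
next
  fix v :: "'a fmod" and a :: "'a grp" assume "v \<in> rideal n x" "a \<in> galg n"
  then obtain b where "b \<in> galg n" "v = emb (gmul n x b)" by (elim rideal_memE)
  then show "ract n v a \<in> rideal n x"
    using rideal_memI[OF gmul_galg, of n x b a] by (simp add: ract_emb gmul_assoc)
qed

lemma rideal_mono: "x = gmul n y b \<Longrightarrow> rideal n x \<subseteq> rideal n y"
proof
  fix v assume x: "x = gmul n y b" and "v \<in> rideal n x"
  then obtain a where "v = emb (gmul n y (gmul n b a))" by (elim rideal_memE) (simp add: gmul_assoc)
  then show "v \<in> rideal n y" by (simp add: rideal_memI gmul_galg)
qed

lemma mod_iso_refl: "submod n k S \<Longrightarrow> mod_iso n S S"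
proof -
  assume S: "submod n k S"
  have "bij_betw (\<lambda>v. v) S S" by (simp add: bij_betw_def)
  then have "bij_betw (\<lambda>v. v) S S \<and> (\<forall>v\<in>S. \<forall>w\<in>S. v + w = v + w)
      \<and> (\<forall>v\<in>S. \<forall>a\<in>galg n. ract n v a = ract n v a)" by blast
  then show ?thesis unfolding mod_iso_def using S by blast
qed

text \<open>Left multiplication commutes with the right action, and the multiplications by y and z
  are mutually inverse on the ideals because they are so on the generators.\<close>

lemma mod_iso_rideal:
  fixes x x' y z :: "'a::comm_ring_1 grp"
  assumes y: "gmul n y x = x'" and z: "gmul n z x' = x"
  shows "mod_iso n (rideal n x) (rideal n x')"
proof -
  define F :: "'a grp \<Rightarrow> 'a fmod \<Rightarrow> 'a fmod" where "F y v = (\<lambda>i. gmul n y (v i))" for y v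
  have fe: "F y (emb u) = emb (gmul n y u)" for y u
    unfolding F_def by (rule map_emb) (rule gmul_linear_simps)
  have fx: "F y (emb (gmul n x a)) = emb (gmul n x' a)" for a
    unfolding fe using gmul_assoc[of n y x a] y by simp
  have gx: "F z (emb (gmul n x' a)) = emb (gmul n x a)" for a
    unfolding fe using gmul_assoc[of n z x' a] z by simp
  have "bij_betw (F y) (rideal n x) (rideal n x')"
  proof (rule bij_betwI[where g = "F z"])
    show "F y \<in> rideal n x \<rightarrow> rideal n x'"
    proof
      fix v assume "v \<in> rideal n x"
      then obtain a where a: "a \<in> galg n" "v = emb (gmul n x a)" by (elim rideal_memE)
      show "F y v \<in> rideal n x'" unfolding a(2) fx by (rule rideal_memI[OF a(1)])
    qed
    show "F z \<in> rideal n x' \<rightarrow> rideal n x"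
    proof
      fix v assume "v \<in> rideal n x'"
      then obtain a where a: "a \<in> galg n" "v = emb (gmul n x' a)" by (elim rideal_memE)
      show "F z v \<in> rideal n x" unfolding a(2) gx by (rule rideal_memI[OF a(1)])
    qed
    show "F z (F y v) = v" if v: "v \<in> rideal n x" for v
    proof -
      obtain a where "v = emb (gmul n x a)" using v by (elim rideal_memE)
      then show ?thesis by (simp only: fx gx)
    qed
    show "F y (F z v) = v" if v: "v \<in> rideal n x'" for v
    proof -
      obtain a where "v = emb (gmul n x' a)" using v by (elim rideal_memE)
      then show ?thesis by (simp only: fx gx)
    qed
  qed
  moreover have "F y (v + w) = F y v + F y w" for v w :: "'a fmod"
    unfolding F_def by (rule ext) (simp only: plus_fun_apply gmul_linear_simps)
  moreover have "F y (ract n v a) = ract n (F y v) a" for v a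
    unfolding F_def by (rule ext) (simp only: ract_def gmul_assoc)
  ultimately show ?thesis unfolding mod_iso_def using submod_rideal by blast
qed

text \<open>The element w / c is idempotent, so it splits N into the ideal and the kernel of left
  multiplication by w on N.\<close>

lemma dsummand_rideal:
  fixes w :: "'a::field grp"
  assumes N: "submod n 1 N" and sub: "rideal n w \<subseteq> N"
    and ww: "gmul n w w = gsc c w" and c: "c \<noteq> 0"
  shows "dsummand n (rideal n w) N"
proof -
  define C where "C = {u \<in> N. gmul n w (u 0) = 0}"
  have NF: "N \<subseteq> freemod n 1" using N by (simp add: submod_def)
  have emb0: "emb x 0 = x" for x :: "'a grp" by (simp add: emb_def)
  have C: "submod n 1 C"
    unfolding submod_def
  proof (intro conjI ballI)
    show "C \<subseteq> freemod n 1" using NF by (auto simp: C_def)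
    show "0 \<in> C" using N unfolding C_def submod_def mem_Collect_eq zero_fun_apply gmul_linear_simps by blast
    show "u + v \<in> C" if "u \<in> C" "v \<in> C" for u v
    proof -
      have "u \<in> N" "v \<in> N" "gmul n w (u 0) = 0" "gmul n w (v 0) = 0" using that by (simp_all add: C_def)
      then have "u + v \<in> N" "gmul n w ((u + v) 0) = 0"
        using N unfolding submod_def by (blast, simp only: plus_fun_apply gmul_linear_simps add_0_right)
      then show ?thesis unfolding C_def by blast
    qed
    show "ract n u a \<in> C" if "u \<in> C" "a \<in> galg n" for u a
    proof -
      have "u \<in> N" "gmul n w (u 0) = 0" using that by (simp_all add: C_def)
      then have "ract n u a \<in> N" "gmul n w (ract n u a 0) = 0"
        using N that(2) unfolding submod_def
        by (blast, simp only: ract_def gmul_assoc[symmetric] gmul_linear_simps)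
      then show ?thesis unfolding C_def by blast
    qed
  qed
  have int: "rideal n w \<inter> C = {0}"
  proof
    show "rideal n w \<inter> C \<subseteq> {0}"
    proof
      fix v assume v: "v \<in> rideal n w \<inter> C"
      then obtain a where a: "v = emb (gmul n w a)" by (auto elim: rideal_memE)
      then have "gmul n w (gmul n w a) = 0" using v by (simp add: C_def emb0)
      then have "gsc c (gmul n w a) = 0" unfolding gmul_assoc[symmetric] ww gmul_linear_simps .
      then have "gsc (1 / c) (gsc c (gmul n w a)) = 0" by (simp only: gsc_zero_right)
      then have "gmul n w a = 0" using c by (simp add: gsc_gsc gsc_one)
      then show "v \<in> {0}" using a by (simp add: emb_zero)
    qed
    show "{0} \<subseteq> rideal n w \<inter> C" using C submod_rideal[of n w] by (simp add: submod_def)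
  qed
  have dec: "\<exists>m\<in>rideal n w. \<exists>d\<in>C. v = m + d" if v: "v \<in> N" for v
  proof -
    obtain x where x: "x \<in> galg n" "v = emb x" using v NF by (blast elim: freemod_1E)
    \<comment> \<open>The Peirce decomposition v = m + (v - m) with m = w v / c; \<open>?m'\<close>
      is -m, written as an element of the ideal so that closure of \<open>N\<close> under addition
      applies.\<close>
    let ?m = "gmul n w (gsc (1 / c) x)"
    let ?m' = "gmul n w (gsc (- 1 / c) x)"
    have m: "emb ?m \<in> rideal n w" "emb ?m' \<in> rideal n w"
      by (rule rideal_memI[OF galg_gsc[OF x(1)]])+
    have mm: "?m + ?m' = 0"
    proof -
      have "1 / c + - 1 / c = 0" by simp
      then show ?thesis unfolding gmul_linear_simps gsc_add_left[symmetric] by (simp only: gsc_zero_left)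
    qed
    have "v + emb ?m' \<in> N" using N v m(2) sub unfolding submod_def by blast
    moreover have "gmul n w ((v + emb ?m') 0) = 0"
    proof -
      have "(v + emb ?m') 0 = x + ?m'" unfolding x(2) emb_add emb0 ..
      moreover have "gmul n w (x + ?m') = 0"
      proof -
        have "gmul n w ?m' = gsc (- 1 / c * c) (gmul n w x)"
          by (simp only: gmul_linear_simps gmul_assoc[symmetric] ww gsc_gsc)
        then have "gmul n w (x + ?m') = gsc 1 (gmul n w x) + gsc (- 1) (gmul n w x)"
          using c by (simp only: gmul_linear_simps gsc_one) simp
        then show ?thesis by (simp only: gsc_add_left[symmetric] gsc_zero_left right_minus)
      qed
      ultimately show ?thesis by simp
    qed
    ultimately have "v + emb ?m' \<in> C" by (simp add: C_def)
    moreover have "v = emb ?m + (v + emb ?m')"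
    proof -
      have "emb ?m + (v + emb ?m') = v + emb (?m + ?m')" unfolding emb_add[symmetric] by (simp only: add.left_commute)
      then show ?thesis unfolding mm emb_zero by simp
    qed
    ultimately show ?thesis using m(1) by blast
  qed
  have CN: "C \<subseteq> N" by (auto simp: C_def)
  show ?thesis unfolding dsummand_def
    by (rule exI[of _ 1]) (intro conjI submod_rideal N sub exI[of _ C] C CN int ballI dec)
qed

section \<open>The dimension of the right ideal of \<omega>_q\<close>

lemma gmul_gbas_right:
  assumes "\<tau> \<in> perms n" "\<pi> \<in> perms n"
  shows "gmul n x (gbas \<tau>) \<pi> = x (inv \<tau> \<circ> \<pi>)"
proof -
  have "gmul n x (gbas \<tau>) \<pi> = (\<Sum>\<rho>\<in>perms n. if \<rho> = \<tau> then x (inv \<tau> \<circ> \<pi>) else 0)"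
    unfolding gmul_apply[OF assms(2)] by (intro sum.cong) (auto simp: gbas_def)
  then show ?thesis using assms finite_perms by simp
qed

lemma of_int_lie_coeff: "of_int (lie_coeff w) = (lie_coeff w :: 'a::comm_ring_1)"
  by (induction w rule: lie_coeff.induct) (simp_all del: sorted_simps sorted_wrt.simps)

lemma of_int_block_prod_lie_coeff:
  "of_int (block_prod lie_coeff q w) = (block_prod lie_coeff q w :: 'a::comm_ring_1)"
  by (induction q arbitrary: w) (simp_all add: of_int_lie_coeff)

text \<open>Exhibits \<omega>_q over F as the reduction of the integral \<omega>_q, which supplies
  the integer matrix for the rank argument.\<close>

lemma of_int_omega_low: "is_comp n q \<Longrightarrow> of_int (omega_low n q \<pi>) = (omega_low n q \<pi> :: 'a::comm_ring_1)"
  by (simp add: omega_low_eq_on_words on_words_def of_int_block_prod_lie_coeff)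

lemma vector_space_fmod: "vector_space (\<lambda>(c::'a::field) (v::'a fmod) i \<sigma>. c * v i \<sigma>)"
  unfolding vector_space_def by (intro conjI allI ext) (simp_all add: distrib_left distrib_right mult.assoc)

lemma fmod_sum_apply: "(\<Sum>x\<in>I. f x) i \<sigma> = (\<Sum>x\<in>I. f x i \<sigma> :: 'a::field)"
  by (induction I rule: infinite_finite_induct) auto

text \<open>In the basis S_n, left multiplication by \<omega>_q has an integral matrix M with M M =
  \<lambda>? M and all diagonal entries 1. Its columns span the ideal, so the dimension is the size
  of a basis of columns.\<close>

lemma fdim_rideal_omega_low:
  assumes q: "is_comp n q" and p: "CHAR('a::field) > 0" and N: "of_nat (lam_q (mset q)) \<noteq> (0::'a)"
  shows "lam_q (mset q) * fdim (rideal n (omega_low n q :: 'a grp)) = fact n"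
proof -
  let ?w = "omega_low n q :: 'a grp" and ?z = "omega_low n q :: int grp" and ?X = "perms n"
  let ?s = "\<lambda>(c::'a) (v::'a fmod) i \<sigma>. c * v i \<sigma>"
  interpret fmod_vs: vector_space ?s by (rule vector_space_fmod)
  define d :: "(nat \<Rightarrow> nat) \<Rightarrow> 'a fmod" where "d \<sigma> = emb (gbas \<sigma>)" for \<sigma>
  \<comment> \<open>The coefficient of x in the product of the integral \<omega>_q with y.\<close>
  define M :: "(nat \<Rightarrow> nat) \<Rightarrow> (nat \<Rightarrow> nat) \<Rightarrow> int" where "M x y = ?z (inv y \<circ> x)" for x y
  define col where "col y = emb (gmul n ?w (gbas y))" for y
  have dval: "d \<sigma> i \<pi> = (if i = 0 \<and> \<pi> = \<sigma> then 1 else 0)" for \<sigma> i \<pi>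
    by (simp add: d_def emb_def gbas_def)
  have inj: "inj_on d ?X"
  proof (rule inj_onI)
    fix x y assume "d x = d y"
    then have "d x 0 x = d y 0 x" by simp
    then show "x = y" by (simp add: dval split: if_splits)
  qed
  have ind: "fmod_vs.independent (d ` ?X)"
  proof (rule fmod_vs.independent_if_scalars_zero)
    show "finite (d ` ?X)" by (simp add: finite_perms)
    fix f v assume h: "(\<Sum>v\<in>d ` ?X. ?s (f v) v) = 0" "v \<in> d ` ?X"
    then obtain y where y: "y \<in> ?X" "v = d y" by blast
    have "0 = (\<Sum>v\<in>d ` ?X. ?s (f v) v) 0 y" unfolding h(1) by simp
    also have "\<dots> = (\<Sum>x\<in>?X. f (d x) * d x 0 y)" unfolding fmod_sum_apply by (simp add: sum.reindex[OF inj])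
    also have "\<dots> = (\<Sum>x\<in>?X. if x = y then f (d y) else 0)" by (intro sum.cong) (auto simp: dval)
    also have "\<dots> = f (d y)" using y finite_perms by simp
    finally show "f v = 0" using y by simp
  qed
  have colsum: "col y = (\<Sum>x\<in>?X. ?s (of_int (M x y)) (d x))" if y: "y \<in> ?X" for y
  proof (intro ext)
    fix i \<pi>
    have "(\<Sum>x\<in>?X. ?s (of_int (M x y)) (d x)) i \<pi> = (\<Sum>x\<in>?X. if x = \<pi> then (if i = 0 then of_int (M x y) else 0) else 0)"
      unfolding fmod_sum_apply by (intro sum.cong) (auto simp: dval)
    also have "\<dots> = (if i = 0 \<and> \<pi> \<in> ?X then of_int (M \<pi> y) else 0)"
      using finite_perms by simp
    also have "\<dots> = col y i \<pi>"
      using y by (auto simp: col_def emb_def M_def of_int_omega_low[OF q] gmul_gbas_right gmul_outside)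
    finally show "col y i \<pi> = (\<Sum>x\<in>?X. ?s (of_int (M x y)) (d x)) i \<pi>" by simp
  qed
  have sq: "(\<Sum>y\<in>?X. M x y * M y z) = int (lam_q (mset q)) * M x z" if xz: "x \<in> ?X" "z \<in> ?X" for x z
  proof -
    have "(\<Sum>y\<in>?X. M x y * M y z) = (\<Sum>y\<in>?X. ?z (inv y \<circ> x) * gmul n ?z (gbas z) y)"
      by (intro sum.cong refl) (simp add: M_def gmul_gbas_right xz)
    also have "\<dots> = gmul n ?z (gmul n ?z (gbas z)) x" by (rule gmul_apply[OF xz(1), symmetric])
    also have "\<dots> = gsc (int (lam_q (mset q))) (gmul n ?z (gbas z)) x"
      unfolding gmul_assoc[symmetric] omega_low_square[OF q] gmul_linear_simps by simp
    also have "\<dots> = int (lam_q (mset q)) * M x z" using xz by (simp add: gsc_def gmul_gbas_right M_def)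
    finally show ?thesis .
  qed
  have pos: "int (lam_q (mset q)) > 0" using N by (cases "lam_q (mset q)") auto
  obtain B where B: "B \<subseteq> col ` ?X" "fmod_vs.independent B" "col ` ?X \<subseteq> fmod_vs.span B"
    "int (lam_q (mset q)) * int (card B) = (\<Sum>x\<in>?X. M x x)"
    using fmod_vs.ex_column_basis[OF finite_perms inj ind p pos _ sq colsum] N by auto
  \<comment> \<open>On the diagonal \<open>inv x \<circ> x\<close> is the identity, so the trace is
    the order of S_n.\<close>
  have "M x x = 1" if "x \<in> ?X" for x
    using that omega_low_id[OF q, where 'a=int] by (simp add: M_def perms_inv_o)
  then have tr: "(\<Sum>x\<in>?X. M x x) = int (fact n)"
    using card_permutations[of "{1..n}" n] by (simp add: perms_def)
  have "fdim (rideal n ?w) = card B"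
    unfolding fdim_def
  proof (rule fmod_vs.dim_unique)
    have "col ` ?X \<subseteq> rideal n ?w" by (auto simp: col_def intro!: rideal_memI galg_gbas)
    then show "B \<subseteq> rideal n ?w" using B(1) by blast
    show "rideal n ?w \<subseteq> fmod_vs.span B"
    proof
      fix v assume "v \<in> rideal n ?w"
      then obtain a where a: "v = emb (gmul n ?w a)" by (elim rideal_memE)
      have "v = (\<Sum>y\<in>?X. ?s (a y) (col y))"
      proof (intro ext)
        fix i \<pi>
        show "v i \<pi> = (\<Sum>y\<in>?X. ?s (a y) (col y)) i \<pi>"
        proof (cases "i = 0 \<and> \<pi> \<in> ?X")
          case True
          then have i: "i = 0" and \<pi>: "\<pi> \<in> ?X" by auto
          have "v i \<pi> = (\<Sum>y\<in>?X. ?w (inv y \<circ> \<pi>) * a y)"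
            unfolding a emb_def gmul_apply[OF \<pi>, symmetric] using i by simp
          also have "\<dots> = (\<Sum>y\<in>?X. a y * col y i \<pi>)"
          proof (rule sum.cong[OF refl])
            fix y assume "y \<in> ?X"
            then have "col y i \<pi> = ?w (inv y \<circ> \<pi>)"
              unfolding col_def emb_def using i gmul_gbas_right[OF _ \<pi>] by simp
            then show "?w (inv y \<circ> \<pi>) * a y = a y * col y i \<pi>" by (simp only: mult.commute)
          qed
          finally show ?thesis unfolding fmod_sum_apply .
        next
          case False
          then show ?thesis unfolding fmod_sum_apply a by (auto simp: emb_def col_def gmul_outside)
        qed
      qed
      moreover have "(\<Sum>y\<in>?X. ?s (a y) (col y)) \<in> fmod_vs.span B"
        using B(3) by (intro fmod_vs.span_sum fmod_vs.span_scale) blast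
      ultimately show "v \<in> fmod_vs.span B" by simp
    qed
    show "fmod_vs.independent B" by (rule B(2))
  qed simp
  moreover have "lam_q (mset q) * card B = fact n"
    using B(4) tr by (metis of_nat_eq_iff of_nat_mult)
  ultimately show ?thesis by simp
qed

section \<open>Cycle types and p-equivalence\<close>

lemma pprime_type_eq_self:
  assumes "\<forall>m\<in>#\<mu>. multiplicity p m = 0"
  shows "pprime_type p \<mu> = \<mu>"
proof -
  have "image_mset (\<lambda>m. replicate_mset (p ^ multiplicity p m) (m div p ^ multiplicity p m)) \<mu> = image_mset (\<lambda>m. {#m#}) \<mu>"
    using assms by (intro image_mset_cong) simp
  then show ?thesis unfolding pprime_type_def by simp
qed

text \<open>A part p^a r with a > 0 would contribute p^a \<ge> p equal parts r to the p'-type,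
  against the bound on its multiplicities.\<close>

lemma pprime_type_small_counts:
  assumes p: "prime (p::nat)" and cnt: "\<forall>i. count (pprime_type p \<mu>) i < p"
  shows "pprime_type p \<mu> = \<mu>"
proof (rule pprime_type_eq_self, intro ballI, rule ccontr)
  fix m assume m: "m \<in># \<mu>" and k: "multiplicity p m \<noteq> 0"
  let ?f = "\<lambda>m. replicate_mset (p ^ multiplicity p m) (m div p ^ multiplicity p m)"
  have "pprime_type p \<mu> = ?f m + sum_mset (image_mset ?f (\<mu> - {#m#}))"
  proof -
    obtain R where "\<mu> = add_mset m R" using m by (blast dest: multi_member_split)
    then show ?thesis unfolding pprime_type_def by simp
  qed
  then have "p ^ multiplicity p m \<le> count (pprime_type p \<mu>) (m div p ^ multiplicity p m)" by simp
  moreover have "p \<le> p ^ multiplicity p m" using k prime_gt_0_nat[OF p] by (simp add: self_le_power)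
  ultimately show False using cnt by (metis leD le_trans)
qed

text \<open>With no part divisible by p the p'-type of \<lambda> is \<lambda> itself, and
  multiplicities below p prevent any other cycle type from having it.\<close>

lemma pconj_class_eq_conj_class:
  assumes p: "prime p" and lam: "\<forall>i. count lam i < p" "\<forall>x\<in>#lam. \<not> p dvd x"
  shows "pconj_class p n lam = conj_class n lam"
proof -
  have l: "pprime_type p lam = lam"
    using lam(2) by (intro pprime_type_eq_self) (simp add: not_dvd_imp_multiplicity_0)
  have "pprime_type p \<mu> = lam \<longleftrightarrow> \<mu> = lam" for \<mu>
    using pprime_type_small_counts[OF p, of \<mu>] lam(1) l by metis
  then show ?thesis unfolding pconj_class_def conj_class_def l by simp
qed

lemma conj_class_eq: "conj_class n lam = perms_of_type {1..n} lam"
proof -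
  have "\<sigma> \<in> perms n \<longleftrightarrow> \<sigma> permutes {1..n}" for \<sigma> by (simp only: perms_def mem_Collect_eq)
  then show ?thesis unfolding conj_class_def perms_of_type_def using cycle_type_eq
    by (intro Collect_cong) metis
qed

lemma lam_q_neq_0:
  assumes "CHAR('a::field) = p" "p > 0" "\<forall>x\<in>set q. \<not> p dvd x" "\<forall>i. count (mset q) i < p"
  shows "of_nat (lam_q (mset q)) \<noteq> (0::'a)" "of_nat (brfact (mset q)) \<noteq> (0::'a)"
proof -
  have pr: "prime p" using assms(1,2) prime_CHAR_semidom by blast
  have "\<not> p dvd brfact (mset q)"
    unfolding brfact_def using pr assms(4) by (auto simp: prime_dvd_prod_iff prime_dvd_fact_iff not_le)
  then show B: "of_nat (brfact (mset q)) \<noteq> (0::'a)" using assms(1) by (simp add: of_nat_eq_0_iff_char_dvd)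
  have "\<not> p dvd prod_list q" using assms(3)
    by (induction q) (use pr in \<open>auto simp: prime_dvd_mult_iff\<close>)
  then have "of_nat (prod_list q) \<noteq> (0::'a)" using assms(1) by (simp add: of_nat_eq_0_iff_char_dvd)
  then show "of_nat (lam_q (mset q)) \<noteq> (0::'a)" using B by (simp add: lam_q_eq)
qed

theorem mainTheorem19:
  fixes e :: "nat multiset \<Rightarrow> ('a::field) grp"
    and n p :: nat and q :: "nat list"
  assumes "infinite (UNIV :: 'a set)"
    and "CHAR('a) = p" and "p > 0"
    and "is_comp n q"
    and "\<forall>x\<in>set q. \<not> p dvd x"
    and "mset q \<in> pres_parts p n"
    and "is_e_family p n e"
  shows "mod_iso n (rideal n (gmul n (Xi n q) (e (mset q)))) (rideal n (omega_low n q))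
       \<and> mod_iso n (rideal n (omega_low n q)) (rideal n (e (mset q)))
       \<and> projective n (rideal n (gmul n (Xi n q) (e (mset q))))
       \<and> dsummand n (rideal n (gmul n (Xi n q) (e (mset q)))) (rideal n (Xi n q))
       \<and> fdim (rideal n (gmul n (Xi n q) (e (mset q)))) = card (pconj_class p n (mset q))
       \<and> card (pconj_class p n (mset q)) = card (conj_class n (mset q))
       \<and> card (conj_class n (mset q)) = fact n div lam_q (mset q)"
proof -
  note q = assms(4)
  have cnt: "\<forall>i. count (mset q) i < p" using assms(6) by (simp add: pres_parts_def)
  note nz = lam_q_neq_0[OF assms(2,3,5) cnt]
  \<comment> \<open>The weakly decreasing arrangement of \<open>q\<close>, for which the triangular
    form of e_\<lambda> is available.\<close>
  define l where "l = part_comp (mset q)"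
  note ef = e_family_omega_low[OF assms(7,6) nz(1) l_def]
  let ?N = "of_nat (lam_q (mset q)) :: 'a" and ?B = "of_nat (brfact (mset q)) :: 'a"
  let ?w = "omega_low n q :: 'a grp" and ?v = "omega_low n l :: 'a grp" and ?E = "e (mset q)"
  have Xw: "gmul n (Xi n q) ?w = gsc ?B ?w" by (rule gmul_Xi_omega_low[OF q q refl])
  have Xv: "gmul n (Xi n q) ?v = gsc ?B ?w" using gmul_Xi_omega_low[OF q ef(1)] ef(2) by simp
  have Yw: "gmul n (Xi n l) ?w = gsc ?B ?v" using gmul_Xi_omega_low[OF ef(1) q ef(2)] .
  have cancel: "gsc (1 / ?B) (gsc ?B x) = x" "gsc (1 / ?N) (gsc ?N x) = x" for x :: "'a grp"
    using nz by (simp_all add: gsc_gsc gsc_one)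
  have E_v: "?E = gmul n ?v (gsc (1 / ?N) ?E)" unfolding gmul_linear_simps ef(5) cancel ..
  have rE: "rideal n ?E = rideal n ?v"
    using rideal_mono[OF E_v] rideal_mono[OF ef(4)[symmetric]] by blast
  \<comment> \<open>\<Xi>^q carries \<omega>_l to a non-zero multiple of \<omega>_q; since
    e_\<lambda> lies in the ideal of \<omega>_l, its image lies in the ideal of \<omega>_q.\<close>
  have XE: "gmul n (Xi n q) ?E = gmul n ?w (gsc (?B / ?N) ?E)"
  proof -
    have "gmul n (Xi n q) ?E = gmul n (gmul n (Xi n q) ?v) (gsc (1 / ?N) ?E)"
      unfolding gmul_assoc E_v[symmetric] ..
    also have "\<dots> = gmul n ?w (gsc (?B / ?N) ?E)" unfolding Xv gmul_linear_simps gsc_gsc by simp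
    finally show ?thesis .
  qed
  have w_XE: "?w = gmul n (gmul n (Xi n q) ?E) (gsc (1 / ?B) ?v)"
    unfolding gmul_linear_simps gmul_assoc ef(4) Xv cancel ..
  \<comment> \<open>The two ideals coincide, so the first isomorphism is the identity.\<close>
  have rw: "rideal n (gmul n (Xi n q) ?E) = rideal n ?w"
    using rideal_mono[OF XE] rideal_mono[OF w_XE] by blast
  have w_X: "?w = gmul n (Xi n q) (gsc (1 / ?B) ?w)" unfolding gmul_linear_simps Xw cancel ..
  note ww = omega_low_square[OF q]
  have iso1: "mod_iso n (rideal n ?w) (rideal n ?w)" by (rule mod_iso_refl[OF submod_rideal])
  \<comment> \<open>\<Xi>^l and \<Xi>^q exchange \<omega>_q and \<omega>_l up to the invertible
    factor [\<lambda>]!; after rescaling, left multiplications by them are inverse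
    isomorphisms.\<close>
  have iso2: "mod_iso n (rideal n ?w) (rideal n ?E)"
    unfolding rE
  proof (rule mod_iso_rideal)
    show "gmul n (gsc (1 / ?B) (Xi n l)) ?w = ?v" unfolding gmul_linear_simps Yw cancel ..
    show "gmul n (gsc (1 / ?B) (Xi n q)) ?v = ?w" unfolding gmul_linear_simps Xv cancel ..
  qed
  have "rideal n ?w \<subseteq> freemod n 1" using submod_rideal[of n ?w] by (simp add: submod_def)
  then have "dsummand n (rideal n ?w) (freemod n 1)"
    by (rule dsummand_rideal[OF submod_freemod _ ww nz(1)])
  then have proj: "projective n (rideal n ?w)" unfolding projective_def using iso1 by blast
  \<comment> \<open>By \<open>w_X\<close> the ideal lies in that of \<Xi>^q, where the same
    idempotent \<omega>_q / \<lambda>? splits it off.\<close>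
  have ds: "dsummand n (rideal n ?w) (rideal n (Xi n q))"
    by (rule dsummand_rideal[OF submod_rideal rideal_mono[OF w_X] ww nz(1)])
  have "prime p" using assms(2,3) prime_CHAR_semidom by blast
  then have pc: "pconj_class p n (mset q) = conj_class n (mset q)"
    using cnt assms(5) by (intro pconj_class_eq_conj_class) auto
  have "lam_q (mset q) * card (perms_of_type {1..n} (mset q)) = fact (card {1..n})"
    using assms(6) by (intro card_perms_of_type) (auto simp: pres_parts_def)
  then have cc: "lam_q (mset q) * card (conj_class n (mset q)) = fact n" by (simp add: conj_class_eq)
  have l0: "lam_q (mset q) \<noteq> 0" using nz(1) by (metis of_nat_0)
  then have "card (conj_class n (mset q)) = fact n div lam_q (mset q)"
    using cc by (metis nonzero_mult_div_cancel_left)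
  \<comment> \<open>Both numbers become n! after multiplication by \<lambda>?, which is not
    zero.\<close>
  moreover have "fdim (rideal n ?w) = card (conj_class n (mset q))"
    using fdim_rideal_omega_low[OF q _ nz(1)] assms(2,3) cc l0 by (metis mult_left_cancel)
  ultimately show ?thesis unfolding rw pc using iso1 iso2 proj ds by blast
qed

end
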